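(* For any prime $p$ there is a functor $$\mathrm{Gr}^*(-) \otimes \mathbb{Z}/p \colon (\psi^p\text{-algebras}) \to (\text{unstable } \mathcal{A}\text{-algebras})$$ which associates to each $\psi^p$-algebra $R$ the unstable $\mathcal{A}$-algebra $\mathrm{Gr}^*R \otimes \mathbb{Z}/p$ with Steenrod operations $P^i$ $(i \ge 0)$ given by the operations induced by $\psi^p$ via Atiyah formulas (as defined in the context).
   Context: Tensor products are over $\mathbb{Z}$. $\mathcal{A}$ denotes the mod $p$ Steenrod algebra; when $p=2$, $P^i$ means $\mathrm{Sq}^{2i}$. A filtered algebra is a commutative ring $R$ with unit together with a multiplicative decreasing filtration by ideals $R = I^0 \supset I^1 \supset \cdots$. Its associated graded algebra is $\mathrm{Gr}^*R = \bigoplus_{n\ge 0} I^n/I^{n+1}$; for $r \in I^n$ considered in filtration $n$, $\overline{r}$ denotes its image in $\mathrm{Gr}^nR\otimes\mathbb{Z}/p$. Maps of filtered algebras are ring maps preserving the filtrations. A pre-$\psi^p$-algebra is a filtered algebra $R$ with a distinguished ring endomorphism $\psi^p$ such that: (i) $I^{2n} = I^{2n-1}$ for all $n \ge 1$; (ii) for every $q\ge 0$ and $r \in I^{2q}$: if $q > 0$, there exist $r_i \in I^{2q+2i(p-1)}$ $(0 \le i \le q)$ with $r_q = r^p$ and $\psi^p(r) = \sum_{i=0}^q p^{q-i} r_i$; if $q = 0$, there exists $r' \in R$ with $\psi^p(r) = p r' + r^p$; and, for $q>0$, the classes $\overline{r_i} \in \mathrm{Gr}^{2q+2i(p-1)}R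 \otimes \mathbb{Z}/p$ are independent of the choice of such a decomposition. Such a decomposition is called an Atiyah formula for $r$. Operations $P^i$: for a pre-$\psi^p$-algebra $R$ there are well-defined operations $P^i\colon \mathrm{Gr}^{2q}R\otimes\mathbb{Z}/p \to \mathrm{Gr}^{2q+2i(p-1)}R\otimes\mathbb{Z}/p$ $(i\ge0)$: for $\overline{r} \in \mathrm{Gr}^{2q}R\otimes\mathbb{Z}/p$ lift it to $r$ in filtration $2q$, take an Atiyah formula for $r$, and set $P^i\overline{r} = \overline{r}^{\,p}$ if $i=q=0$, $P^i\overline{r}=\overline{r_i}$ if $0\le i\le q$ and $q>0$, and $P^i\overline{r}=0$ if $i>q$. A $\psi^p$-algebra is a pre-$\psi^p$-algebra $R$ for which these operations on $\mathrm{Gr}^*R\otimes\mathbb{Z}/p$ satisfy $P^0 = \mathrm{Id}$ and the Adem relations: for $i,j>0$ with $i<pj$, $$P^iP^j = \sum_{t=0}^{\lfloor i/p\rfloor} (-1)^{i+t}\binom{(p-1)(j-t)-1}{i-pt}P^{i+j-t}P^t \ (p>2), \qquad P^iP^j = \sum_{t=0}^{\lfloor i/2\rfloor}\binom{2j-2t-1}{2i-4t}P^{i+j-t}P^t\ (p=2).$$ A $\psi^p$-algebra map is a filtered algebra map $f$ with $f\psi^p=\psi^pf$. An $\mathcal{A}$-algebra is a graded $\mathbb{Z}/p$-algebra with an $\mathcal{A}$-module structure satisfying the Cartan formula; it is unstable if $P^i(m)=m^p$ when $2i=|m|$ and $\beta^\varepsilon P^i(m)=0$ when $2i+\varepsilon>|m|$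 ($\varepsilon=0,1$), with the usual analogues for $p=2$. Since $\mathrm{Gr}^*R\otimes\mathbb{Z}/p$ is concentrated in even degrees, the Bockstein $\beta$ (resp. the odd $\mathrm{Sq}^{j}$ for $p=2$) acts as zero. The functor sends a map $f$ to the induced map on mod $p$ associated graded algebras. *)

theory Defs
  imports
    "HOL-Algebra.QuotRing"
    "HOL-Algebra.Product_Groups"
    "HOL-Number_Theory.Residues"
begin

section \<open>Reduction mod p of an abelian group\<close>

text \<open>
  The group \<open>G \<otimes> \<int>/p\<close> is represented by \<open>G/pG\<close> (with \<open>G\<close> written multiplicatively), the pure
  tensor \<open>x \<otimes> k\<close> being the class of \<open>k x\<close>.  The lemmas \<open>tensor_pair_biadditive\<close> and
  \<open>tensor_Zp_universal\<close> show that this is the tensor product over \<open>\<int>\<close>.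
\<close>

definition p_multiples :: "nat \<Rightarrow> ('a, 'x) monoid_scheme \<Rightarrow> 'a set"
  where "p_multiples p G = (\<lambda>x. x [^]\<^bsub>G\<^esub> p) ` carrier G"

definition tensor_Zp :: "nat \<Rightarrow> ('a, 'x) monoid_scheme \<Rightarrow> 'a set monoid"
  where "tensor_Zp p G = G Mod p_multiples p G"

definition tensor_pair :: "nat \<Rightarrow> ('a, 'x) monoid_scheme \<Rightarrow> 'a \<Rightarrow> int \<Rightarrow> 'a set"
  where "tensor_pair p G x k = p_multiples p G #>\<^bsub>G\<^esub> (x [^]\<^bsub>G\<^esub> k)"

definition biadditive ::
    "('a, 'x) monoid_scheme \<Rightarrow> ('b, 'y) monoid_scheme \<Rightarrow> ('c, 'z) monoid_scheme \<Rightarrow> ('a \<Rightarrow> 'b \<Rightarrow> 'c) \<Rightarrow> bool"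
  where "biadditive G K H B \<longleftrightarrow>
    (\<forall>x\<in>carrier G. B x \<in> hom K H) \<and> (\<forall>k\<in>carrier K. (\<lambda>x. B x k) \<in> hom G H)"

lemma p_multiples_subgroup:
  assumes "comm_group G"
  shows "subgroup (p_multiples p G) G"
proof -
  interpret comm_group G by fact
  show ?thesis
    unfolding p_multiples_def
  proof (rule subgroupI)
    fix a assume "a \<in> (\<lambda>x. x [^]\<^bsub>G\<^esub> p) ` carrier G"
    then obtain x where "x \<in> carrier G" "a = x [^]\<^bsub>G\<^esub> p" by blast
    then show "inv\<^bsub>G\<^esub> a \<in> (\<lambda>x. x [^]\<^bsub>G\<^esub> p) ` carrier G"
      by (intro image_eqI[where x="inv\<^bsub>G\<^esub> x"]) (simp_all add: nat_pow_inv)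
  next
    fix a b assume "a \<in> (\<lambda>x. x [^]\<^bsub>G\<^esub> p) ` carrier G" "b \<in> (\<lambda>x. x [^]\<^bsub>G\<^esub> p) ` carrier G"
    then obtain x y where "x \<in> carrier G" "y \<in> carrier G" "a = x [^]\<^bsub>G\<^esub> p" "b = y [^]\<^bsub>G\<^esub> p"
      by auto
    then show "a \<otimes>\<^bsub>G\<^esub> b \<in> (\<lambda>x. x [^]\<^bsub>G\<^esub> p) ` carrier G"
      by (intro image_eqI[where x="x \<otimes>\<^bsub>G\<^esub> y"]) (simp_all add: nat_pow_distrib)
  qed auto
qed

lemma p_multiples_normal:
  assumes "comm_group G"
  shows "p_multiples p G \<lhd> G"
  by (simp add: assms p_multiples_subgroup comm_group.subgroup_imp_normal)

lemma tensor_pair_biadditive: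
  assumes G: "comm_group G" and p: "p > 1"
  shows "biadditive G (integer_mod_group p) (tensor_Zp p G) (tensor_pair p G)"
proof -
  interpret comm_group G by (rule G)
  let ?N = "p_multiples p G"
  interpret N: normal ?N G by (rule p_multiples_normal[OF G])
  have mult: "(?N #>\<^bsub>G\<^esub> x) \<otimes>\<^bsub>tensor_Zp p G\<^esub> (?N #>\<^bsub>G\<^esub> y) = ?N #>\<^bsub>G\<^esub> (x \<otimes>\<^bsub>G\<^esub> y)"
    if "x \<in> carrier G" "y \<in> carrier G" for x y
    using that by (simp add: tensor_Zp_def FactGroup_def N.rcos_sum)
  have closed: "?N #>\<^bsub>G\<^esub> x \<in> carrier (tensor_Zp p G)" if "x \<in> carrier G" for x
    using that by (auto simp: tensor_Zp_def FactGroup_def RCOSETS_def)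
  have absorb: "?N #>\<^bsub>G\<^esub> (x [^]\<^bsub>G\<^esub> (k mod int p)) = ?N #>\<^bsub>G\<^esub> (x [^]\<^bsub>G\<^esub> k)"
    if x: "x \<in> carrier G" for x and k :: int
  proof -
    have "x [^]\<^bsub>G\<^esub> k = x [^]\<^bsub>G\<^esub> (int p * (k div int p)) \<otimes>\<^bsub>G\<^esub> x [^]\<^bsub>G\<^esub> (k mod int p)"
      using int_pow_mult[OF x, of "int p * (k div int p)" "k mod int p"] by simp
    also have "x [^]\<^bsub>G\<^esub> (int p * (k div int p)) = (x [^]\<^bsub>G\<^esub> (k div int p)) [^]\<^bsub>G\<^esub> p"
      using int_pow_pow[OF x, of "k div int p" "int p"] by (simp add: mult.commute int_pow_int)
    finally have eq: "x [^]\<^bsub>G\<^esub> k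
        = (x [^]\<^bsub>G\<^esub> (k div int p)) [^]\<^bsub>G\<^esub> p \<otimes>\<^bsub>G\<^esub> x [^]\<^bsub>G\<^esub> (k mod int p)" .
    have mem: "(x [^]\<^bsub>G\<^esub> (k div int p)) [^]\<^bsub>G\<^esub> p \<in> ?N"
      using x by (auto simp: p_multiples_def)
    then have "x [^]\<^bsub>G\<^esub> k \<in> ?N #>\<^bsub>G\<^esub> (x [^]\<^bsub>G\<^esub> (k mod int p))"
      unfolding eq r_coset_def by auto
    with x show ?thesis
      by (metis N.subgroup_axioms int_pow_closed repr_independence)
  qed
  show ?thesis
    unfolding biadditive_def
  proof (intro conjI ballI)
    fix x assume x: "x \<in> carrier G"
    show "tensor_pair p G x \<in> hom (integer_mod_group p) (tensor_Zp p G)"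
    proof (rule homI)
      fix k l assume "k \<in> carrier (integer_mod_group p)" "l \<in> carrier (integer_mod_group p)"
      have "tensor_pair p G x ((k + l) mod int p) = ?N #>\<^bsub>G\<^esub> (x [^]\<^bsub>G\<^esub> (k + l))"
        using x by (simp add: tensor_pair_def absorb)
      also have "\<dots> = tensor_pair p G x k \<otimes>\<^bsub>tensor_Zp p G\<^esub> tensor_pair p G x l"
        using x by (simp add: tensor_pair_def mult int_pow_mult)
      finally show "tensor_pair p G x (k \<otimes>\<^bsub>integer_mod_group p\<^esub> l)
          = tensor_pair p G x k \<otimes>\<^bsub>tensor_Zp p G\<^esub> tensor_pair p G x l"
        using p by (simp add: integer_mod_group_def)
    qed (use x in \<open>auto simp: tensor_pair_def closed\<close>)
  next
    fix k assume "k \<in> carrier (integer_mod_group p)"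
    show "(\<lambda>x. tensor_pair p G x k) \<in> hom G (tensor_Zp p G)"
      by (rule homI) (auto simp: tensor_pair_def closed mult int_pow_distrib)
  qed
qed

lemma tensor_Zp_universal:
  assumes G: "comm_group G" and H: "comm_group H" and p: "p > 1"
    and B: "biadditive G (integer_mod_group p) H B"
  shows "\<exists>!h. h \<in> hom (tensor_Zp p G) H \<inter> extensional (carrier (tensor_Zp p G)) \<and>
    (\<forall>x\<in>carrier G. \<forall>k\<in>carrier (integer_mod_group p). h (tensor_pair p G x k) = B x k)"
proof -
  interpret G: comm_group G by (rule G)
  interpret H: comm_group H by (rule H)
  let ?N = "p_multiples p G" and ?K = "integer_mod_group p" and ?T = "tensor_Zp p G"
  interpret N: normal ?N G by (rule p_multiples_normal[OF G])
  have K: "carrier ?K = {0..<int p}" "\<And>k l. k \<otimes>\<^bsub>?K\<^esub> l = (k + l) mod int p"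
    using p by (simp_all add: integer_mod_group_def)
  define b where "b x = B x 1" for x
  have one: "1 \<in> carrier ?K" using p by (simp add: K)
  then have b: "b \<in> hom G H"
    using B unfolding biadditive_def b_def[abs_def] by blast
  then interpret b: group_hom G H b
    by (simp add: group_hom_def group_hom_axioms_def)
  have Bhom: "B x \<in> hom ?K H" if "x \<in> carrier G" for x
    using that B by (simp add: biadditive_def)
  have Badd: "B x ((k + l) mod int p) = B x k \<otimes>\<^bsub>H\<^esub> B x l"
    if "x \<in> carrier G" "k \<in> {0..<int p}" "l \<in> {0..<int p}" for x k l
    using hom_mult[OF Bhom[OF that(1)], of k l] that by (simp only: K)
  have Bcl: "B x k \<in> carrier H" if "x \<in> carrier G" "k \<in> {0..<int p}" for x k
    using hom_in_carrier[OF Bhom[OF that(1)], of k] that by (simp only: K)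
  have B0: "B x 0 = \<one>\<^bsub>H\<^esub>" if "x \<in> carrier G" for x
    using Badd[OF that, of 0 0] Bcl[OF that, of 0] p by simp
  have pow_mod: "B x (int n mod int p) = b x [^]\<^bsub>H\<^esub> n" if x: "x \<in> carrier G" for x n
  proof (induction n)
    case 0
    then show ?case using x by (simp add: B0)
  next
    case (Suc n)
    have "B x (int (Suc n) mod int p) = B x ((int n mod int p + 1) mod int p)"
      by (metis mod_add_left_eq of_nat_Suc add.commute)
    also have "\<dots> = B x (int n mod int p) \<otimes>\<^bsub>H\<^esub> B x 1"
      using x p by (intro Badd) auto
    finally show ?case using Suc by (simp add: b_def)
  qed
  have pow: "B x k = b x [^]\<^bsub>H\<^esub> k" if "x \<in> carrier G" "k \<in> carrier ?K" for x k
    using pow_mod[OF that(1), of "nat k"] that(2) int_pow_int[of H "b x" "nat k"] by (simp add: K)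
  have bN: "b x = \<one>\<^bsub>H\<^esub>" if "x \<in> ?N" for x
  proof -
    from that obtain y where y: "y \<in> carrier G" "x = y [^]\<^bsub>G\<^esub> p"
      by (auto simp: p_multiples_def)
    then show ?thesis
      using pow_mod[OF y(1), of p] B0[OF y(1)] b.hom_nat_pow[OF y(1), of p] by simp
  qed
  have b_cong: "b x = b y"
    if xy: "x \<in> carrier G" "y \<in> carrier G" "?N #>\<^bsub>G\<^esub> x = ?N #>\<^bsub>G\<^esub> y" for x y
  proof -
    have "x \<in> ?N #>\<^bsub>G\<^esub> y"
      using G.rcos_self[OF xy(1) N.subgroup_axioms] xy(3) by simp
    then obtain n where "n \<in> ?N" "x = n \<otimes>\<^bsub>G\<^esub> y" by (auto simp: r_coset_def)
    then show "b x = b y"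
      using b.hom_mult[OF N.mem_carrier xy(2)] bN b.hom_closed[OF xy(2)] by simp
  qed
  obtain g where g: "g \<in> hom ?T H" "\<And>x. x \<in> carrier G \<Longrightarrow> g (?N #>\<^bsub>G\<^esub> x) = b x"
    unfolding tensor_Zp_def
    using FactGroup_universal[OF b N.normal_axioms b_cong] by blast
  have carrT: "\<exists>x\<in>carrier G. X = ?N #>\<^bsub>G\<^esub> x" if "X \<in> carrier ?T" for X
    using that by (auto simp: tensor_Zp_def FactGroup_def RCOSETS_def)
  have Tgroup: "group ?T" unfolding tensor_Zp_def by (rule N.factorgroup_is_group)
  have gval: "g (tensor_pair p G x k) = B x k" if "x \<in> carrier G" "k \<in> carrier ?K" for x k
    unfolding tensor_pair_def
    using that g(2)[of "x [^]\<^bsub>G\<^esub> k"] pow[OF that] b.hom_int_pow[OF that(1), of k] by simp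
  have pairT: "tensor_pair p G x k \<in> carrier ?T" if "x \<in> carrier G" for x k
    using that by (auto simp: tensor_pair_def tensor_Zp_def FactGroup_def RCOSETS_def)
  let ?g = "restrict g (carrier ?T)"
  show ?thesis
  proof (rule ex1I[of _ ?g])
    show "?g \<in> hom ?T H \<inter> extensional (carrier ?T) \<and>
      (\<forall>x\<in>carrier G. \<forall>k\<in>carrier ?K. ?g (tensor_pair p G x k) = B x k)"
    proof (intro conjI ballI IntI homI)
      fix X Y assume "X \<in> carrier ?T" "Y \<in> carrier ?T"
      then show "?g (X \<otimes>\<^bsub>?T\<^esub> Y) = ?g X \<otimes>\<^bsub>H\<^esub> ?g Y"
        using hom_mult[OF g(1)] monoid.m_closed[OF group.is_monoid[OF Tgroup]] by simp
    qed (use hom_in_carrier[OF g(1)] gval pairT in simp_all)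
  next
    fix h assume h: "h \<in> hom ?T H \<inter> extensional (carrier ?T) \<and>
      (\<forall>x\<in>carrier G. \<forall>k\<in>carrier ?K. h (tensor_pair p G x k) = B x k)"
    show "h = ?g"
    proof (rule extensionalityI[of _ "carrier ?T"])
      fix X assume X: "X \<in> carrier ?T"
      then obtain x where x: "x \<in> carrier G" "X = ?N #>\<^bsub>G\<^esub> x" using carrT by blast
      then have pair: "X = tensor_pair p G x 1" by (simp add: tensor_pair_def)
      have "h X = B x 1" using h x(1) one unfolding pair by blast
      then show "h X = ?g X" using X gval[OF x(1) one] by (simp add: pair)
    qed (use h in \<open>simp_all add: restrict_extensional\<close>)
  qed
qed


section \<open>The mod p Steenrod algebra\<close>

text \<open>The free associative unital algebra over \<open>K\<close> on the set \<open>X\<close>, with basis the words in \<open>X\<close>.\<close>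

definition free_algebra :: "('k, 'z) ring_scheme \<Rightarrow> 'x set \<Rightarrow> ('x list \<Rightarrow> 'k) ring"
  where "free_algebra K X =
    \<lparr>carrier = {f. (\<forall>w. f w \<in> carrier K) \<and> finite {w. f w \<noteq> \<zero>\<^bsub>K\<^esub>} \<and>
                   (\<forall>w. f w \<noteq> \<zero>\<^bsub>K\<^esub> \<longrightarrow> set w \<subseteq> X)},
     monoid.mult = (\<lambda>f g w. \<Oplus>\<^bsub>K\<^esub>k\<in>{..length w}. f (take k w) \<otimes>\<^bsub>K\<^esub> g (drop k w)),
     one = (\<lambda>w. if w = [] then \<one>\<^bsub>K\<^esub> else \<zero>\<^bsub>K\<^esub>),
     zero = (\<lambda>w. \<zero>\<^bsub>K\<^esub>),
     add = (\<lambda>f g w. f w \<oplus>\<^bsub>K\<^esub> g w)\<rparr>"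

definition word_monomial :: "('k, 'z) ring_scheme \<Rightarrow> 'x list \<Rightarrow> 'x list \<Rightarrow> 'k"
  where "word_monomial K w = (\<lambda>v. if v = w then \<one>\<^bsub>K\<^esub> else \<zero>\<^bsub>K\<^esub>)"

datatype steenrod_gen = Sq nat | Bockstein | Pow nat

definition steenrod_gens :: "nat \<Rightarrow> steenrod_gen set"
  where "steenrod_gens p = (if p = 2 then range Sq else insert Bockstein (range Pow))"

fun gen_degree :: "nat \<Rightarrow> steenrod_gen \<Rightarrow> nat" where
  "gen_degree p (Sq j) = j"
| "gen_degree p Bockstein = 1"
| "gen_degree p (Pow i) = 2 * i * (p - 1)"

abbreviation steenrod_free :: "nat \<Rightarrow> (steenrod_gen list \<Rightarrow> int) ring"
  where "steenrod_free p \<equiv> free_algebra (residue_ring (int p)) (steenrod_gens p)"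

abbreviation steenrod_word :: "nat \<Rightarrow> steenrod_gen list \<Rightarrow> steenrod_gen list \<Rightarrow> int"
  where "steenrod_word p \<equiv> word_monomial (residue_ring (int p))"

text \<open>
  Subtractions of natural numbers below never truncate: in the first argument of a binomial
  coefficient this follows from the hypotheses on \<open>a\<close> and \<open>b\<close>.
\<close>

definition steenrod_relations_2 :: "(steenrod_gen list \<Rightarrow> int) set"
  where "steenrod_relations_2 =
    (let F = steenrod_free 2; m = steenrod_word 2 in
      {m [Sq 0] \<ominus>\<^bsub>F\<^esub> \<one>\<^bsub>F\<^esub>} \<union>
      {m [Sq a, Sq b] \<ominus>\<^bsub>F\<^esub>
         (\<Oplus>\<^bsub>F\<^esub>j\<in>{..a div 2}. [int ((b - j - 1) choose (a - 2 * j))] \<cdot>\<^bsub>F\<^esub> m [Sq (a + b - j), Sq j])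
       | a b. 0 < a \<and> a < 2 * b})"

definition steenrod_relations_odd :: "nat \<Rightarrow> (steenrod_gen list \<Rightarrow> int) set"
  where "steenrod_relations_odd p =
    (let F = steenrod_free p; m = steenrod_word p in
      {m [Pow 0] \<ominus>\<^bsub>F\<^esub> \<one>\<^bsub>F\<^esub>, m [Bockstein, Bockstein]} \<union>
      {m [Pow a, Pow b] \<ominus>\<^bsub>F\<^esub>
         (\<Oplus>\<^bsub>F\<^esub>t\<in>{..a div p}.
            [((-1) ^ (a + t) * int (((p - 1) * (b - t) - 1) choose (a - p * t)))] \<cdot>\<^bsub>F\<^esub>
              m [Pow (a + b - t), Pow t])
       | a b. 0 < a \<and> a < p * b} \<union>
      {m [Pow a, Bockstein, Pow b] \<ominus>\<^bsub>F\<^esub>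
         ((\<Oplus>\<^bsub>F\<^esub>t\<in>{..a div p}.
            [((-1) ^ (a + t) * int (((p - 1) * (b - t)) choose (a - p * t)))] \<cdot>\<^bsub>F\<^esub>
              m [Bockstein, Pow (a + b - t), Pow t]) \<oplus>\<^bsub>F\<^esub>
          (\<Oplus>\<^bsub>F\<^esub>t\<in>{..(a - 1) div p}.
            [((-1) ^ (a + t + 1) * int (((p - 1) * (b - t) - 1) choose (a - p * t - 1)))] \<cdot>\<^bsub>F\<^esub>
              m [Pow (a + b - t), Bockstein, Pow t]))
       | a b. 0 < a \<and> a \<le> p * b})"

definition steenrod_ideal :: "nat \<Rightarrow> (steenrod_gen list \<Rightarrow> int) set"
  where "steenrod_ideal p =
    genideal (steenrod_free p) (if p = 2 then steenrod_relations_2 else steenrod_relations_odd p)"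

type_synonym steenrod_elt = "(steenrod_gen list \<Rightarrow> int) set"

definition steenrod_algebra :: "nat \<Rightarrow> steenrod_elt ring"
  where "steenrod_algebra p = steenrod_free p Quot steenrod_ideal p"

definition steenrod_part :: "nat \<Rightarrow> nat \<Rightarrow> steenrod_elt set"
  where "steenrod_part p k =
    {steenrod_ideal p +>\<^bsub>steenrod_free p\<^esub> f | f. f \<in> carrier (steenrod_free p) \<and>
       (\<forall>w. f w \<noteq> 0 \<longrightarrow> sum_list (map (gen_degree p) w) = k)}"

definition steenrod_op :: "nat \<Rightarrow> steenrod_gen \<Rightarrow> steenrod_elt"
  where "steenrod_op p g = steenrod_ideal p +>\<^bsub>steenrod_free p\<^esub> steenrod_word p [g]"

text \<open>The operation \<open>P\<^sup>i\<close>, which means \<open>Sq\<^sup>2\<^sup>i\<close> at the prime 2.\<close>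

definition steenrod_P :: "nat \<Rightarrow> nat \<Rightarrow> steenrod_elt"
  where "steenrod_P p i = steenrod_op p (if p = 2 then Sq (2 * i) else Pow i)"


section \<open>Unstable algebras over the Steenrod algebra\<close>

record 'm steenrod_alg = "'m ring" +
  part :: "nat \<Rightarrow> 'm set"
  act :: "steenrod_elt \<Rightarrow> 'm \<Rightarrow> 'm"

text \<open>
  A ring carries at most one \<open>\<int>/p\<close>-algebra structure, and it carries one iff \<open>p = 0\<close> in it.
\<close>

definition graded_Zp_algebra :: "nat \<Rightarrow> ('m, 'z) steenrod_alg_scheme \<Rightarrow> bool"
  where "graded_Zp_algebra p M \<longleftrightarrow>
    ring M \<and> [p] \<cdot>\<^bsub>M\<^esub> \<one>\<^bsub>M\<^esub> = \<zero>\<^bsub>M\<^esub> \<and>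
    (\<forall>n. subgroup (part M n) (add_monoid M)) \<and>
    (\<forall>x\<in>carrier M. \<exists>!c. (\<forall>n. c n \<in> part M n) \<and> finite {n. c n \<noteq> \<zero>\<^bsub>M\<^esub>} \<and>
       x = (\<Oplus>\<^bsub>M\<^esub>n\<in>{n. c n \<noteq> \<zero>\<^bsub>M\<^esub>}. c n)) \<and>
    \<one>\<^bsub>M\<^esub> \<in> part M 0 \<and>
    (\<forall>m n. \<forall>x\<in>part M m. \<forall>y\<in>part M n. x \<otimes>\<^bsub>M\<^esub> y \<in> part M (m + n))"

definition graded_steenrod_module :: "nat \<Rightarrow> ('m, 'z) steenrod_alg_scheme \<Rightarrow> bool"
  where "graded_steenrod_module p M \<longleftrightarrow>
    (let A = steenrod_algebra p in
      (\<forall>a\<in>carrier A. \<forall>x\<in>carrier M. act M a x \<in> carrier M) \<and>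
      (\<forall>a\<in>carrier A. \<forall>x\<in>carrier M. \<forall>y\<in>carrier M.
         act M a (x \<oplus>\<^bsub>M\<^esub> y) = act M a x \<oplus>\<^bsub>M\<^esub> act M a y) \<and>
      (\<forall>a\<in>carrier A. \<forall>b\<in>carrier A. \<forall>x\<in>carrier M.
         act M (a \<oplus>\<^bsub>A\<^esub> b) x = act M a x \<oplus>\<^bsub>M\<^esub> act M b x) \<and>
      (\<forall>a\<in>carrier A. \<forall>b\<in>carrier A. \<forall>x\<in>carrier M.
         act M (a \<otimes>\<^bsub>A\<^esub> b) x = act M a (act M b x)) \<and>
      (\<forall>x\<in>carrier M. act M \<one>\<^bsub>A\<^esub> x = x) \<and>
      (\<forall>k n. \<forall>a\<in>steenrod_part p k. \<forall>x\<in>part M n. act M a x \<in> part M (n + k)))"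

definition cartan_formula :: "nat \<Rightarrow> ('m, 'z) steenrod_alg_scheme \<Rightarrow> bool"
  where "cartan_formula p M \<longleftrightarrow>
    (if p = 2 then
       (\<forall>n. \<forall>x\<in>carrier M. \<forall>y\<in>carrier M. act M (steenrod_op p (Sq n)) (x \<otimes>\<^bsub>M\<^esub> y) =
          (\<Oplus>\<^bsub>M\<^esub>i\<in>{..n}. act M (steenrod_op p (Sq i)) x \<otimes>\<^bsub>M\<^esub> act M (steenrod_op p (Sq (n - i))) y))
     else
       (\<forall>n. \<forall>x\<in>carrier M. \<forall>y\<in>carrier M. act M (steenrod_op p (Pow n)) (x \<otimes>\<^bsub>M\<^esub> y) =
          (\<Oplus>\<^bsub>M\<^esub>i\<in>{..n}. act M (steenrod_op p (Pow i)) x \<otimes>\<^bsub>M\<^esub> act M (steenrod_op p (Pow (n - i))) y)) \<and>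
       (\<forall>m. \<forall>x\<in>part M m. \<forall>y\<in>carrier M. act M (steenrod_op p Bockstein) (x \<otimes>\<^bsub>M\<^esub> y) =
          (act M (steenrod_op p Bockstein) x \<otimes>\<^bsub>M\<^esub> y) \<oplus>\<^bsub>M\<^esub>
          [((-1) ^ m :: int)] \<cdot>\<^bsub>M\<^esub> (x \<otimes>\<^bsub>M\<^esub> act M (steenrod_op p Bockstein) y)))"

definition steenrod_unstable :: "nat \<Rightarrow> ('m, 'z) steenrod_alg_scheme \<Rightarrow> bool"
  where "steenrod_unstable p M \<longleftrightarrow>
    (if p = 2 then
       (\<forall>i. \<forall>x\<in>part M i. act M (steenrod_op p (Sq i)) x = x [^]\<^bsub>M\<^esub> (2::nat)) \<and>
       (\<forall>i n. \<forall>x\<in>part M n. n < i \<longrightarrow> act M (steenrod_op p (Sq i)) x = \<zero>\<^bsub>M\<^esub>)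
     else
       (\<forall>i. \<forall>x\<in>part M (2 * i). act M (steenrod_op p (Pow i)) x = x [^]\<^bsub>M\<^esub> p) \<and>
       (\<forall>i n. \<forall>x\<in>part M n. n < 2 * i \<longrightarrow> act M (steenrod_op p (Pow i)) x = \<zero>\<^bsub>M\<^esub>) \<and>
       (\<forall>i n. \<forall>x\<in>part M n. n < 2 * i + 1 \<longrightarrow>
          act M (steenrod_op p Bockstein \<otimes>\<^bsub>steenrod_algebra p\<^esub> steenrod_op p (Pow i)) x = \<zero>\<^bsub>M\<^esub>))"

definition steenrod_algebra_object :: "nat \<Rightarrow> ('m, 'z) steenrod_alg_scheme \<Rightarrow> bool"
  where "steenrod_algebra_object p M \<longleftrightarrow>
    graded_Zp_algebra p M \<and> graded_steenrod_module p M \<and> cartan_formula p M"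

definition unstable_steenrod_algebra :: "nat \<Rightarrow> ('m, 'z) steenrod_alg_scheme \<Rightarrow> bool"
  where "unstable_steenrod_algebra p M \<longleftrightarrow> steenrod_algebra_object p M \<and> steenrod_unstable p M"

definition steenrod_algebra_map ::
    "nat \<Rightarrow> ('m, 'z) steenrod_alg_scheme \<Rightarrow> ('n, 'y) steenrod_alg_scheme \<Rightarrow> ('m \<Rightarrow> 'n) \<Rightarrow> bool"
  where "steenrod_algebra_map p M N h \<longleftrightarrow>
    h \<in> ring_hom M N \<and> (\<forall>n. h ` part M n \<subseteq> part N n) \<and>
    (\<forall>a\<in>carrier (steenrod_algebra p). \<forall>x\<in>carrier M. h (act M a x) = act N a (h x))"


section \<open>Filtered algebras and their mod p associated graded algebras\<close>

record 'a filtered_ring = "'a ring" +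
  filt :: "nat \<Rightarrow> 'a set"

definition filtered_algebra :: "('a, 'z) filtered_ring_scheme \<Rightarrow> bool"
  where "filtered_algebra R \<longleftrightarrow>
    cring R \<and> filt R 0 = carrier R \<and> (\<forall>n. ideal (filt R n) R) \<and>
    (\<forall>n. filt R (Suc n) \<subseteq> filt R n) \<and>
    (\<forall>m n. \<forall>r\<in>filt R m. \<forall>s\<in>filt R n. r \<otimes>\<^bsub>R\<^esub> s \<in> filt R (m + n))"

definition filtered_map ::
    "('a, 'z) filtered_ring_scheme \<Rightarrow> ('b, 'y) filtered_ring_scheme \<Rightarrow> ('a \<Rightarrow> 'b) \<Rightarrow> bool"
  where "filtered_map R S f \<longleftrightarrow> f \<in> ring_hom R S \<and> (\<forall>n. f ` filt R n \<subseteq> filt S n)"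

text \<open>\<open>gr R n\<close> is the additive group \<open>I\<^sup>n / I\<^sup>n\<^sup>+\<^sup>1\<close>, written multiplicatively as all monoids are.\<close>

definition gr :: "('a, 'z) filtered_ring_scheme \<Rightarrow> nat \<Rightarrow> 'a set monoid"
  where "gr R n = (add_monoid R)\<lparr>carrier := filt R n\<rparr> Mod filt R (Suc n)"

definition grp :: "nat \<Rightarrow> ('a, 'z) filtered_ring_scheme \<Rightarrow> nat \<Rightarrow> 'a set set monoid"
  where "grp p R n = tensor_Zp p (gr R n)"

text \<open>\<open>bar p R n r\<close> is the class \<open>r \<otimes> 1\<close> of \<open>r\<close>, considered in filtration \<open>n\<close>.\<close>

definition bar :: "nat \<Rightarrow> ('a, 'z) filtered_ring_scheme \<Rightarrow> nat \<Rightarrow> 'a \<Rightarrow> 'a set set"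
  where "bar p R n r = tensor_pair p (gr R n) (filt R (Suc n) +>\<^bsub>R\<^esub> r) 1"

text \<open>
  The product, the induced maps and the operations \<open>P\<^sup>i\<close> are all given by lifting classes to \<open>R\<close>.
  The description operator selects the class so obtained, which does not depend on the lifts.
\<close>

definition grp_mult ::
    "nat \<Rightarrow> ('a, 'z) filtered_ring_scheme \<Rightarrow> nat \<Rightarrow> nat \<Rightarrow> 'a set set \<Rightarrow> 'a set set \<Rightarrow> 'a set set"
  where "grp_mult p R m n X Y =
    (THE Z. \<exists>r\<in>filt R m. \<exists>s\<in>filt R n.
       bar p R m r = X \<and> bar p R n s = Y \<and> bar p R (m + n) (r \<otimes>\<^bsub>R\<^esub> s) = Z)"

text \<open>The ring \<open>Gr\<^sup>* R \<otimes> \<int>/p\<close>, as the direct sum of the groups \<open>Gr\<^sup>n R \<otimes> \<int>/p\<close>.\<close>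

definition gr_ring :: "nat \<Rightarrow> ('a, 'z) filtered_ring_scheme \<Rightarrow> (nat \<Rightarrow> 'a set set) ring"
  where "gr_ring p R =
    \<lparr>carrier = carrier (sum_group UNIV (grp p R)),
     monoid.mult = (\<lambda>x y n. finprod (grp p R n) (\<lambda>i. grp_mult p R i (n - i) (x i) (y (n - i))) {..n}),
     one = (\<lambda>n. if n = 0 then bar p R 0 \<one>\<^bsub>R\<^esub> else \<one>\<^bsub>grp p R n\<^esub>),
     zero = \<one>\<^bsub>sum_group UNIV (grp p R)\<^esub>,
     add = monoid.mult (sum_group UNIV (grp p R))\<rparr>"

text \<open>The inclusion of the summand of degree \<open>n\<close>.\<close>

definition gr_hom :: "nat \<Rightarrow> ('a, 'z) filtered_ring_scheme \<Rightarrow> nat \<Rightarrow> 'a set set \<Rightarrow> nat \<Rightarrow> 'a set set"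
  where "gr_hom p R n X = (\<lambda>m. if m = n then X else \<one>\<^bsub>grp p R m\<^esub>)"

definition gr_map ::
    "nat \<Rightarrow> ('a, 'z) filtered_ring_scheme \<Rightarrow> ('b, 'y) filtered_ring_scheme \<Rightarrow> ('a \<Rightarrow> 'b) \<Rightarrow>
     (nat \<Rightarrow> 'a set set) \<Rightarrow> nat \<Rightarrow> 'b set set"
  where "gr_map p R S f x = (\<lambda>n. THE Y. \<exists>r\<in>filt R n. bar p R n r = x n \<and> bar p S n (f r) = Y)"


section \<open>Rings with an operation satisfying Atiyah formulas\<close>

record 'a psi_ring = "'a filtered_ring" +
  psi :: "'a \<Rightarrow> 'a"

text \<open>\<open>atiyah_formula p R q r c\<close> is the Atiyah formula with \<open>r\<^sub>i = c i\<close>, to be used for \<open>q > 0\<close>.\<close>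

definition atiyah_formula :: "nat \<Rightarrow> ('a, 'z) psi_ring_scheme \<Rightarrow> nat \<Rightarrow> 'a \<Rightarrow> (nat \<Rightarrow> 'a) \<Rightarrow> bool"
  where "atiyah_formula p R q r c \<longleftrightarrow>
    (\<forall>i\<le>q. c i \<in> filt R (2 * q + 2 * i * (p - 1))) \<and>
    c q = r [^]\<^bsub>R\<^esub> p \<and>
    psi R r = (\<Oplus>\<^bsub>R\<^esub>i\<in>{..q}. [(p ^ (q - i))] \<cdot>\<^bsub>R\<^esub> c i)"

definition pre_psi_algebra :: "nat \<Rightarrow> ('a, 'z) psi_ring_scheme \<Rightarrow> bool"
  where "pre_psi_algebra p R \<longleftrightarrow>
    filtered_algebra R \<and> psi R \<in> ring_hom R R \<and>
    (\<forall>n\<ge>1. filt R (2 * n) = filt R (2 * n - 1)) \<and>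
    (\<forall>r\<in>filt R 0. \<exists>r'\<in>carrier R. psi R r = ([p] \<cdot>\<^bsub>R\<^esub> r') \<oplus>\<^bsub>R\<^esub> (r [^]\<^bsub>R\<^esub> p)) \<and>
    (\<forall>q>0. \<forall>r\<in>filt R (2 * q). \<exists>c. atiyah_formula p R q r c) \<and>
    (\<forall>q>0. \<forall>r\<in>filt R (2 * q). \<forall>c d. atiyah_formula p R q r c \<longrightarrow> atiyah_formula p R q r d \<longrightarrow>
       (\<forall>i\<le>q. bar p R (2 * q + 2 * i * (p - 1)) (c i) = bar p R (2 * q + 2 * i * (p - 1)) (d i)))"

text \<open>\<open>P\<^sup>i\<close> on \<open>Gr\<^sup>2\<^sup>q R \<otimes> \<int>/p\<close>, and its extension to \<open>Gr\<^sup>* R \<otimes> \<int>/p\<close> (which is zero in odd degrees).\<close>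

definition grp_P ::
    "nat \<Rightarrow> ('a, 'z) psi_ring_scheme \<Rightarrow> nat \<Rightarrow> nat \<Rightarrow> 'a set set \<Rightarrow> 'a set set"
  where "grp_P p R i q X =
    (THE Y. \<exists>r\<in>filt R (2 * q). bar p R (2 * q) r = X \<and>
       (if i > q then Y = \<one>\<^bsub>grp p R (2 * q + 2 * i * (p - 1))\<^esub>
        else if q = 0 then Y = bar p R 0 (r [^]\<^bsub>R\<^esub> p)
        else \<exists>c. atiyah_formula p R q r c \<and> Y = bar p R (2 * q + 2 * i * (p - 1)) (c i)))"

definition gr_P ::
    "nat \<Rightarrow> ('a, 'z) psi_ring_scheme \<Rightarrow> nat \<Rightarrow> (nat \<Rightarrow> 'a set set) \<Rightarrow> nat \<Rightarrow> 'a set set"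
  where "gr_P p R i x = (\<lambda>m.
    let d = 2 * i * (p - 1) in
      if d \<le> m \<and> even (m - d) then grp_P p R i ((m - d) div 2) (x (m - d)) else \<one>\<^bsub>grp p R m\<^esub>)"

definition psi_algebra :: "nat \<Rightarrow> ('a, 'z) psi_ring_scheme \<Rightarrow> bool"
  where "psi_algebra p R \<longleftrightarrow>
    pre_psi_algebra p R \<and>
    (\<forall>x\<in>carrier (gr_ring p R). gr_P p R 0 x = x) \<and>
    (\<forall>i>0. \<forall>j>0. i < p * j \<longrightarrow> (\<forall>x\<in>carrier (gr_ring p R).
       gr_P p R i (gr_P p R j x) =
         (\<Oplus>\<^bsub>gr_ring p R\<^esub>t\<in>{..i div p}.
            [(if p = 2 then int ((2 * j - 2 * t - 1) choose (2 * i - 4 * t))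
             else (-1) ^ (i + t) * int (((p - 1) * (j - t) - 1) choose (i - p * t)))]
            \<cdot>\<^bsub>gr_ring p R\<^esub> gr_P p R (i + j - t) (gr_P p R t x))))"

definition psi_algebra_map ::
    "('a, 'z) psi_ring_scheme \<Rightarrow> ('b, 'y) psi_ring_scheme \<Rightarrow> ('a \<Rightarrow> 'b) \<Rightarrow> bool"
  where "psi_algebra_map R S f \<longleftrightarrow>
    filtered_map R S f \<and> (\<forall>r\<in>carrier R. f (psi R r) = psi S (f r))"


section \<open>The Steenrod action on the associated graded algebra\<close>

text \<open>
  Generators act through the operations \<open>P\<^sup>i\<close>, the Bockstein and the odd squares by zero; this is
  extended multiplicatively to words and linearly to the free algebra, and then passes to the
  quotient.
\<close>

fun gr_gen_act ::
    "nat \<Rightarrow> ('a, 'z) psi_ring_scheme \<Rightarrow> steenrod_gen \<Rightarrow> (nat \<Rightarrow> 'a set set) \<Rightarrow> nat \<Rightarrow> 'a set set" where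
  "gr_gen_act p R (Sq j) x = (if even j then gr_P p R (j div 2) x else \<zero>\<^bsub>gr_ring p R\<^esub>)"
| "gr_gen_act p R Bockstein x = \<zero>\<^bsub>gr_ring p R\<^esub>"
| "gr_gen_act p R (Pow i) x = gr_P p R i x"

definition gr_act ::
    "nat \<Rightarrow> ('a, 'z) psi_ring_scheme \<Rightarrow> steenrod_elt \<Rightarrow> (nat \<Rightarrow> 'a set set) \<Rightarrow> nat \<Rightarrow> 'a set set"
  where "gr_act p R a x =
    (THE y. \<exists>f\<in>a. y = (\<Oplus>\<^bsub>gr_ring p R\<^esub>w\<in>{w. f w \<noteq> 0}.
       [f w] \<cdot>\<^bsub>gr_ring p R\<^esub> foldr (gr_gen_act p R) w x))"

definition gr_alg :: "nat \<Rightarrow> ('a, 'z) psi_ring_scheme \<Rightarrow> (nat \<Rightarrow> 'a set set) steenrod_alg"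
  where "gr_alg p R = ring.extend (gr_ring p R) (steenrod_alg.fields
    (\<lambda>n. {x \<in> carrier (gr_ring p R). \<forall>m. m \<noteq> n \<longrightarrow> x m = \<one>\<^bsub>grp p R m\<^esub>})
    (gr_act p R))"

end

theory Submission
  imports Defs
begin

text \<open>
  Everything is checked on homogeneous generators: \<open>Gr\<^sup>* R \<otimes> \<int>/p\<close> is additively generated by the
  classes of elements of the filtration ideals, the free algebra by words, and all the laws in
  question are additive in each variable.  The operations are additive and satisfy the Cartan formula
  because Atiyah formulas may be added and, by multiplying out
  \<open>\<psi>\<^sup>p(r s) = \<psi>\<^sup>p(r) \<psi>\<^sup>p(s)\<close>, multiplied; the top term, which has to be exactly a \<open>p\<close>-th power, is corrected
  by moving a multiple of \<open>p\<close> into the preceding term, where it has too high a filtration to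
  matter.  At the prime 2 the relations among all the squares reduce to those among the even ones,
  the remaining coefficients being even binomial coefficients.
\<close>

section \<open>The mod p associated graded ring\<close>

text \<open>The axioms give independence of the classes of the terms for one fixed lift
  \<open>r\<close>; the obstacle is that P^i must not depend on the lift either. Two lifts of a
  class differ by p t + u with t of filtration 2q and u of filtration 2q + 1, hence 2q + 2 by axiom
  (i). Additivity of formulas disposes of p t, and a formula for u in degree q + 1, read in degree
  q, has all its terms two filtrations deeper than required, so its classes are zero. This is why
  additivity has to be established for formulas, before any operation is known to be well defined.
  The Steenrod action is built on the free algebra and descends because the elements acting as zero
  form a two-sided ideal, so only the defining relations need inspection. At odd primes those free
  of the Bockstein are \<open>P^0 = Id\<close> and the Adem relations of the hypotheses; those
  containing it hold because every word involved acts as zero.\<close>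

definition filt_group :: "('a, 'z) filtered_ring_scheme \<Rightarrow> nat \<Rightarrow> ('a, \<lparr>filt :: nat \<Rightarrow> 'a set, \<dots> :: 'z\<rparr>) monoid_scheme"
  where "filt_group R n = (add_monoid R)\<lparr>carrier := filt R n\<rparr>"

lemma filt_group_simps [simp]:
  "carrier (filt_group R n) = filt R n"
  "x \<otimes>\<^bsub>filt_group R n\<^esub> y = x \<oplus>\<^bsub>R\<^esub> y"
  "\<one>\<^bsub>filt_group R n\<^esub> = \<zero>\<^bsub>R\<^esub>"
  "x [^]\<^bsub>filt_group R n\<^esub> (k::nat) = [k] \<cdot>\<^bsub>R\<^esub> x"
  "A #>\<^bsub>filt_group R n\<^esub> x = A +>\<^bsub>R\<^esub> x"
  by (simp_all add: filt_group_def add_pow_def nat_pow_def r_coset_def a_r_coset_def)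

lemma gr_eq: "gr R n = filt_group R n Mod filt R (Suc n)"
  by (simp add: gr_def filt_group_def)

section \<open>Filtration ideals and the classes of their elements\<close>

locale filtered_alg =
  fixes R :: "('a, 'z) filtered_ring_scheme" (structure) and p :: nat
  assumes filtered: "filtered_algebra R"

sublocale filtered_alg \<subseteq> cring R
  using filtered by (simp add: filtered_algebra_def)

context filtered_alg
begin

lemma filt_0: "filt R 0 = carrier R"
  and filt_ideal: "ideal (filt R n) R"
  and filt_Suc_subset: "filt R (Suc n) \<subseteq> filt R n"
  and filt_mult: "r \<in> filt R m \<Longrightarrow> s \<in> filt R n \<Longrightarrow> r \<otimes> s \<in> filt R (m + n)"
  using filtered by (auto simp: filtered_algebra_def)

lemma filt_antimono: "m \<le> n \<Longrightarrow> filt R n \<subseteq> filt R m"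
  by (rule lift_Suc_antimono_le[where f = "filt R"]) (simp_all add: filt_Suc_subset)

lemma filt_mono_mem: "r \<in> filt R n \<Longrightarrow> m \<le> n \<Longrightarrow> r \<in> filt R m"
  using filt_antimono by blast

lemma filt_additive_subgroup: "additive_subgroup (filt R n) R"
  using filt_ideal by (rule ideal.axioms)

lemma filt_carrier: "r \<in> filt R n \<Longrightarrow> r \<in> carrier R"
  using additive_subgroup.a_Hcarr[OF filt_additive_subgroup] by blast

lemma filt_zero: "\<zero> \<in> filt R n"
  by (rule additive_subgroup.zero_closed[OF filt_additive_subgroup])

lemma filt_add: "r \<in> filt R n \<Longrightarrow> s \<in> filt R n \<Longrightarrow> r \<oplus> s \<in> filt R n"
  by (rule additive_subgroup.a_closed[OF filt_additive_subgroup])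

lemma filt_neg: "r \<in> filt R n \<Longrightarrow> \<ominus> r \<in> filt R n"
  by (rule additive_subgroup.a_inv_closed[OF filt_additive_subgroup])

lemma filt_minus: "r \<in> filt R n \<Longrightarrow> s \<in> filt R n \<Longrightarrow> r \<ominus> s \<in> filt R n"
  by (simp add: a_minus_def filt_add filt_neg)

lemma filt_nat_mult: "r \<in> filt R n \<Longrightarrow> [(k::nat)] \<cdot> r \<in> filt R n"
  by (induction k) (auto simp: filt_zero filt_add)

lemma filt_pow: "r \<in> filt R n \<Longrightarrow> r [^] (k::nat) \<in> filt R (n * k)"
proof (induction k)
  case (Suc k)
  then show ?case using filt_mult[of "r [^] k" "n * k" r n] by (simp add: add.commute)
qed (simp add: filt_0)

lemma filt_finsum:
  assumes "finite A" "\<And>i. i \<in> A \<Longrightarrow> f i \<in> filt R n"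
  shows "(\<Oplus>i\<in>A. f i) \<in> filt R n"
  using assms
proof (induction A)
  case (insert x A)
  then have "f \<in> A \<rightarrow> carrier R" "f x \<in> carrier R" using filt_carrier by blast+
  with insert show ?case by (simp add: filt_add)
qed (simp add: filt_zero)

lemma comm_group_filt: "comm_group (filt_group R n)"
proof (rule group.group_comm_groupI)
  show "Group.group (filt_group R n)"
    unfolding filt_group_def
    by (rule group.subgroup_imp_group[OF a_group additive_subgroup.a_subgroup[OF filt_additive_subgroup]])
qed (simp add: a_comm filt_carrier)

lemma subgroup_filt: "subgroup (filt R (Suc n)) (filt_group R n)"
  using comm_group_filt[of n] comm_group_filt[of "Suc n"] filt_Suc_subset[of n]
  by (intro group.group_incl_imp_subgroup) (auto simp: comm_group_def filt_group_def)

lemma comm_group_gr: "comm_group (gr R n)"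
  unfolding gr_eq by (rule comm_group.abelian_FactGroup[OF comm_group_filt subgroup_filt])

lemma comm_group_grp: "comm_group (grp p R n)"
  unfolding grp_def tensor_Zp_def
  by (rule comm_group.abelian_FactGroup[OF comm_group_gr p_multiples_subgroup[OF comm_group_gr]])

sublocale grp: comm_group "grp p R n" for n
  by (rule comm_group_grp)

lemma bar_hom: "bar p R n \<in> hom (filt_group R n) (grp p R n)"
proof -
  let ?F = "filt_group R n" and ?N = "p_multiples p (gr R n)"
  interpret F: comm_group ?F by (rule comm_group_filt)
  interpret G: comm_group "gr R n" by (rule comm_group_gr)
  have 1: "(\<lambda>r. filt R (Suc n) +> r) \<in> hom ?F (gr R n)"
    using normal.r_coset_hom_Mod[OF F.subgroup_imp_normal[OF subgroup_filt]]
    by (simp add: gr_eq)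
  have 2: "(\<lambda>x. ?N #>\<^bsub>gr R n\<^esub> x) \<in> hom (gr R n) (grp p R n)"
    unfolding grp_def tensor_Zp_def by (rule normal.r_coset_hom_Mod[OF p_multiples_normal[OF comm_group_gr]])
  \<comment> \<open>The power with integer exponent 1 in \<open>tensor_pair\<close> is known to be
    the identity only on the carrier, so the equation is restricted to
    \<open>filt R n\<close>.\<close>
  have eq: "bar p R n r = ((\<lambda>x. ?N #>\<^bsub>gr R n\<^esub> x) \<circ> (\<lambda>r. filt R (Suc n) +> r)) r" if "r \<in> filt R n" for r
    using hom_in_carrier[OF 1, of r] that by (simp add: bar_def tensor_pair_def)
  have "(\<lambda>x. ?N #>\<^bsub>gr R n\<^esub> x) \<circ> (\<lambda>r. filt R (Suc n) +> r) \<in> hom ?F (grp p R n)"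
    by (rule hom_compose[OF 1 2])
  then show ?thesis
    by (auto simp: hom_def Pi_def eq filt_add)
qed

lemma bar_closed: "r \<in> filt R n \<Longrightarrow> bar p R n r \<in> carrier (grp p R n)"
  using hom_in_carrier[OF bar_hom] by simp

lemma bar_add: "r \<in> filt R n \<Longrightarrow> s \<in> filt R n \<Longrightarrow> bar p R n (r \<oplus> s) = bar p R n r \<otimes>\<^bsub>grp p R n\<^esub> bar p R n s"
  using hom_mult[OF bar_hom] by simp

lemma bar_surj:
  assumes "X \<in> carrier (grp p R n)"
  obtains r where "r \<in> filt R n" "X = bar p R n r"
proof -
  interpret G: comm_group "gr R n" by (rule comm_group_gr)
  from assms obtain x where x: "x \<in> carrier (gr R n)" "X = p_multiples p (gr R n) #>\<^bsub>gr R n\<^esub> x"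
    by (auto simp: grp_def tensor_Zp_def FactGroup_def RCOSETS_def)
  then obtain r where "r \<in> filt R n" "x = filt R (Suc n) +> r"
    by (auto simp: gr_eq FactGroup_def RCOSETS_def)
  with x that show thesis by (simp add: bar_def tensor_pair_def)
qed

sublocale bar: group_hom "filt_group R n" "grp p R n" "bar p R n" for n
  using comm_group_filt comm_group_grp bar_hom
  by (simp add: group_hom_def group_hom_axioms_def comm_group_def)

lemma bar_zero: "bar p R n \<zero> = \<one>\<^bsub>grp p R n\<^esub>"
  using bar.hom_one by simp

lemma bar_nat_mult: "r \<in> filt R n \<Longrightarrow> bar p R n ([(k::nat)] \<cdot> r) = bar p R n r [^]\<^bsub>grp p R n\<^esub> k"
  using bar.hom_nat_pow[of r n k] by simp

text \<open>The kernel of the passage from I^n to classes is p I^n + I^(n+1): the coset of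
  \<open>r\<close> is a p-multiple in I^n/I^(n+1) exactly when \<open>r\<close> agrees with some
  \<open>[p] \<cdot> t\<close> modulo I^(n+1). The well-definedness arguments compare lifts through
  this description.\<close>

lemma bar_eq_one_iff:
  assumes r: "r \<in> filt R n"
  shows "bar p R n r = \<one>\<^bsub>grp p R n\<^esub> \<longleftrightarrow> (\<exists>t\<in>filt R n. \<exists>u\<in>filt R (Suc n). r = [p] \<cdot> t \<oplus> u)"
proof -
  let ?F = "filt_group R n" and ?N = "p_multiples p (gr R n)" and ?J = "filt R (Suc n)"
  interpret F: comm_group ?F by (rule comm_group_filt)
  interpret G: comm_group "gr R n" by (rule comm_group_gr)
  have 1: "group_hom ?F (gr R n) (\<lambda>r. ?J +> r)"
    using normal.r_coset_hom_Mod[OF F.subgroup_imp_normal[OF subgroup_filt]] comm_group.axioms(2)[OF comm_group_filt] comm_group.axioms(2)[OF comm_group_gr]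
    by (simp add: group_hom_def group_hom_axioms_def gr_eq)
  interpret c: group_hom ?F "gr R n" "\<lambda>r. ?J +> r" by (rule 1)
  have car: "carrier (gr R n) = (\<lambda>r. ?J +> r) ` filt R n"
    by (auto simp: gr_eq FactGroup_def RCOSETS_def)
  have cl: "?J +> r \<in> carrier (gr R n)" using r by (simp add: car)
  have "bar p R n r = \<one>\<^bsub>grp p R n\<^esub> \<longleftrightarrow> ?N #>\<^bsub>gr R n\<^esub> (?J +> r) = ?N"
    using cl by (simp add: bar_def tensor_pair_def grp_def tensor_Zp_def)
  also have "\<dots> \<longleftrightarrow> ?J +> r \<in> ?N"
    using G.coset_join1[OF _ cl p_multiples_subgroup[OF comm_group_gr]]
      G.coset_join2[OF cl p_multiples_subgroup[OF comm_group_gr]] by blast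
  also have "\<dots> \<longleftrightarrow> (\<exists>t\<in>filt R n. ?J +> r = (?J +> t) [^]\<^bsub>gr R n\<^esub> p)"
    by (auto simp: p_multiples_def car)
  also have "\<dots> \<longleftrightarrow> (\<exists>t\<in>filt R n. ?J +> r = ?J +> ([p] \<cdot> t))"
    using c.hom_nat_pow[of _ p] by simp
  also have "\<dots> \<longleftrightarrow> (\<exists>t\<in>filt R n. \<exists>u\<in>?J. r = [p] \<cdot> t \<oplus> u)"
  proof (intro bex_cong refl)
    fix t assume t: "t \<in> filt R n"
    have R: "r \<in> carrier R" "[p] \<cdot> t \<in> carrier R" using r t filt_carrier by auto
    have "?J +> r = ?J +> ([p] \<cdot> t) \<longleftrightarrow> r \<in> ?J +> ([p] \<cdot> t)"
      using R add.repr_independence[of r ?J "[p] \<cdot> t"] add.rcos_self[OF R(1), of ?J]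
        additive_subgroup.a_subgroup[OF filt_additive_subgroup, of "Suc n"] by (auto simp: a_r_coset_def)
    also have "\<dots> \<longleftrightarrow> (\<exists>u\<in>?J. r = [p] \<cdot> t \<oplus> u)"
      using R filt_carrier by (auto simp: a_r_coset_def r_coset_def a_comm)
    finally show "?J +> r = ?J +> ([p] \<cdot> t) \<longleftrightarrow> (\<exists>u\<in>?J. r = [p] \<cdot> t \<oplus> u)" .
  qed
  finally show ?thesis .
qed

lemma bar_eq_oneI:
  assumes "u \<in> filt R m" "n < m"
  shows "bar p R n u = \<one>\<^bsub>grp p R n\<^esub>"
proof -
  have u: "u \<in> filt R n" "u \<in> filt R (Suc n)" "u = [p] \<cdot> \<zero> \<oplus> u"
    using assms filt_mono_mem[of u m] filt_carrier[of u m] by auto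
  then show ?thesis using filt_zero[of n] by (auto simp only: bar_eq_one_iff)
qed

lemma bar_eq_iff:
  assumes "r \<in> filt R n" "s \<in> filt R n"
  shows "bar p R n r = bar p R n s \<longleftrightarrow>
    (\<exists>t\<in>filt R n. \<exists>u\<in>filt R (Suc n). r = s \<oplus> ([p] \<cdot> t \<oplus> u))"
proof -
  have rs: "r = s \<oplus> (r \<ominus> s)" and R: "r \<in> carrier R" "s \<in> carrier R"
    using assms filt_carrier by (auto simp: a_minus_def) algebra
  have d: "r \<ominus> s \<in> filt R n" using assms by (rule filt_minus)
  have "bar p R n r = bar p R n s \<otimes>\<^bsub>grp p R n\<^esub> bar p R n (r \<ominus> s)"
    by (subst rs) (rule bar_add[OF assms(2) d])
  then have "bar p R n r = bar p R n s \<longleftrightarrow> bar p R n (r \<ominus> s) = \<one>\<^bsub>grp p R n\<^esub>"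
    using bar_closed[OF assms(2)] bar_closed[OF d] by simp
  also have "\<dots> \<longleftrightarrow> (\<exists>t\<in>filt R n. \<exists>u\<in>filt R (Suc n). r = s \<oplus> ([p] \<cdot> t \<oplus> u))"
    unfolding bar_eq_one_iff[OF d]
  proof (intro bex_cong refl)
    fix t u assume tu: "t \<in> filt R n" "u \<in> filt R (Suc n)"
    then have tuR: "[p] \<cdot> t \<oplus> u \<in> carrier R" using filt_carrier by auto
    have "r = s \<oplus> v \<longleftrightarrow> r \<ominus> s = v" if "v \<in> carrier R" for v
      using R that by (metis a_comm a_minus_def add.inv_solve_right' minus_closed rs)
    then show "r \<ominus> s = [p] \<cdot> t \<oplus> u \<longleftrightarrow> r = s \<oplus> ([p] \<cdot> t \<oplus> u)" using tuR by simp
  qed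
  finally show ?thesis .
qed

lemma grp_pow_p: "X \<in> carrier (grp p R n) \<Longrightarrow> X [^]\<^bsub>grp p R n\<^esub> p = \<one>\<^bsub>grp p R n\<^esub>"
proof (erule bar_surj)
  fix r assume r: "r \<in> filt R n" "X = bar p R n r"
  have "[p] \<cdot> r = [p] \<cdot> r \<oplus> \<zero>" using r filt_carrier by auto
  then have "bar p R n ([p] \<cdot> r) = \<one>\<^bsub>grp p R n\<^esub>"
    using r filt_nat_mult[of r n p] filt_zero[of "Suc n"] bar_eq_one_iff by blast
  with r show ?thesis by (simp add: bar_nat_mult)
qed


section \<open>The pairing of graded pieces\<close>

lemma grp_mult_bar:
  assumes r: "r \<in> filt R m" and s: "s \<in> filt R n"
  shows "grp_mult p R m n (bar p R m r) (bar p R n s) = bar p R (m + n) (r \<otimes> s)"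
proof -
  \<comment> \<open>\<open>left\<close> is quantified over its own degrees and elements:
    independence of the second lift follows by applying it to the factors in reversed order.\<close>
  have left: "bar p R (m + n) (r' \<otimes> s) = bar p R (m + n) (r \<otimes> s)"
    if "r \<in> filt R m" "r' \<in> filt R m" "s \<in> filt R n" "bar p R m r' = bar p R m r" for r r' s m n
  proof -
    from that obtain t u where tu: "t \<in> filt R m" "u \<in> filt R (Suc m)" "r' = r \<oplus> ([p] \<cdot> t \<oplus> u)"
      using bar_eq_iff by blast
    have R: "r \<in> carrier R" "s \<in> carrier R" "t \<in> carrier R" "u \<in> carrier R"
      using that tu filt_carrier by blast+
    have "r' \<otimes> s = r \<otimes> s \<oplus> ([p] \<cdot> (t \<otimes> s) \<oplus> u \<otimes> s)"
      using R by (simp add: tu(3) l_distr add_pow_ldistr)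
    moreover have "t \<otimes> s \<in> filt R (m + n)" "u \<otimes> s \<in> filt R (Suc (m + n))"
      using filt_mult tu(1) that(3) filt_mult[OF tu(2) that(3)] by simp_all
    ultimately show ?thesis
      using filt_mult that by (subst bar_eq_iff) blast+
  qed
  have "bar p R (m + n) (r' \<otimes> s') = bar p R (m + n) (r \<otimes> s)"
    if "r' \<in> filt R m" "s' \<in> filt R n" "bar p R m r' = bar p R m r" "bar p R n s' = bar p R n s" for r' s'
  proof -
    have "bar p R (m + n) (r' \<otimes> s') = bar p R (m + n) (r \<otimes> s')"
      using left r that by blast
    also have "\<dots> = bar p R (n + m) (s' \<otimes> r)"
      using r that(2) by (simp add: m_comm filt_carrier add.commute)
    also have "\<dots> = bar p R (n + m) (s \<otimes> r)"
      using left s r that by blast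
    also have "\<dots> = bar p R (m + n) (r \<otimes> s)"
      using r s by (simp add: m_comm filt_carrier add.commute)
    finally show ?thesis .
  qed
  then show ?thesis
    unfolding grp_mult_def by (intro the_equality) (use r s in blast)+
qed

lemma grp_mult_closed:
  "X \<in> carrier (grp p R m) \<Longrightarrow> Y \<in> carrier (grp p R n) \<Longrightarrow> grp_mult p R m n X Y \<in> carrier (grp p R (m + n))"
  by (elim bar_surj) (simp add: grp_mult_bar bar_closed filt_mult)

lemma grp_mult_add_left:
  assumes "X \<in> carrier (grp p R m)" "X' \<in> carrier (grp p R m)" "Y \<in> carrier (grp p R n)"
  shows "grp_mult p R m n (X \<otimes>\<^bsub>grp p R m\<^esub> X') Y =
    grp_mult p R m n X Y \<otimes>\<^bsub>grp p R (m + n)\<^esub> grp_mult p R m n X' Y"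
proof -
  obtain r r' s where "r \<in> filt R m" "X = bar p R m r" "r' \<in> filt R m" "X' = bar p R m r'"
    "s \<in> filt R n" "Y = bar p R n s"
    using assms by (metis bar_surj)
  then show ?thesis
    by (simp flip: bar_add add: grp_mult_bar filt_mult filt_add l_distr filt_carrier)
qed

lemma grp_mult_comm:
  assumes "X \<in> carrier (grp p R m)" "Y \<in> carrier (grp p R n)"
  shows "grp_mult p R m n X Y = grp_mult p R n m Y X"
  using assms by (elim bar_surj) (simp add: grp_mult_bar m_comm filt_carrier add.commute)

lemma grp_mult_one_left:
  "Y \<in> carrier (grp p R n) \<Longrightarrow> grp_mult p R m n \<one>\<^bsub>grp p R m\<^esub> Y = \<one>\<^bsub>grp p R (m + n)\<^esub>"
  by (elim bar_surj) (simp flip: bar_zero add: grp_mult_bar filt_zero filt_carrier)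

lemma grp_mult_one_right:
  "X \<in> carrier (grp p R m) \<Longrightarrow> grp_mult p R m n X \<one>\<^bsub>grp p R n\<^esub> = \<one>\<^bsub>grp p R (m + n)\<^esub>"
  by (elim bar_surj) (simp flip: bar_zero add: grp_mult_bar filt_zero filt_carrier)

section \<open>The direct sum of the graded pieces as a commutative ring\<close>

lemma carrier_gr_ring:
  "carrier (gr_ring p R) = {x. (\<forall>n. x n \<in> carrier (grp p R n)) \<and> finite {n. x n \<noteq> \<one>\<^bsub>grp p R n\<^esub>}}"
  by (auto simp: gr_ring_def carrier_sum_group[OF grp.is_group] PiE_iff)

lemma gr_ring_simps:
  "x \<oplus>\<^bsub>gr_ring p R\<^esub> y = (\<lambda>n. x n \<otimes>\<^bsub>grp p R n\<^esub> y n)"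
  "\<zero>\<^bsub>gr_ring p R\<^esub> = (\<lambda>n. \<one>\<^bsub>grp p R n\<^esub>)"
  "x \<otimes>\<^bsub>gr_ring p R\<^esub> y = (\<lambda>n. finprod (grp p R n) (\<lambda>i. grp_mult p R i (n - i) (x i) (y (n - i))) {..n})"
  "\<one>\<^bsub>gr_ring p R\<^esub> = gr_hom p R 0 (bar p R 0 \<one>)"
  by (auto simp: gr_ring_def gr_hom_def)

lemma gr_ring_mem: "x \<in> carrier (gr_ring p R) \<Longrightarrow> x n \<in> carrier (grp p R n)"
  by (simp add: carrier_gr_ring)

lemma abelian_group_gr_ring: "abelian_group (gr_ring p R)"
proof (rule comm_group_abelian_groupI)
  have eq: "add_monoid (gr_ring p R) = sum_group UNIV (grp p R)"
    by (rule monoid.equality) (simp_all add: gr_ring_def)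
  show "comm_group (add_monoid (gr_ring p R))"
    unfolding eq
    by (rule group.group_comm_groupI[OF sum_group[OF grp.is_group]])
      (auto simp: carrier_sum_group[OF grp.is_group] grp.m_comm PiE_iff)
qed

sublocale gr_ring: abelian_group "gr_ring p R"
  by (rule abelian_group_gr_ring)

lemma gr_hom_closed: "X \<in> carrier (grp p R n) \<Longrightarrow> gr_hom p R n X \<in> carrier (gr_ring p R)"
proof -
  assume "X \<in> carrier (grp p R n)"
  moreover have "{m. gr_hom p R n X m \<noteq> \<one>\<^bsub>grp p R m\<^esub>} \<subseteq> {n}"
    by (auto simp: gr_hom_def)
  ultimately show ?thesis
    using finite_subset by (auto simp: carrier_gr_ring gr_hom_def)
qed

lemma gr_hom_add:
  "X \<in> carrier (grp p R n) \<Longrightarrow> Y \<in> carrier (grp p R n) \<Longrightarrow>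
   gr_hom p R n (X \<otimes>\<^bsub>grp p R n\<^esub> Y) = gr_hom p R n X \<oplus>\<^bsub>gr_ring p R\<^esub> gr_hom p R n Y"
  by (rule ext) (simp add: gr_hom_def gr_ring_simps)

lemma gr_hom_one: "gr_hom p R n \<one>\<^bsub>grp p R n\<^esub> = \<zero>\<^bsub>gr_ring p R\<^esub>"
  by (rule ext) (simp add: gr_hom_def gr_ring_simps)

abbreviation cls :: "nat \<Rightarrow> 'a \<Rightarrow> nat \<Rightarrow> 'a set set"
  where "cls n r \<equiv> gr_hom p R n (bar p R n r)"

lemma cls_closed: "r \<in> filt R n \<Longrightarrow> cls n r \<in> carrier (gr_ring p R)"
  by (simp add: gr_hom_closed bar_closed)

lemma cls_add: "r \<in> filt R n \<Longrightarrow> s \<in> filt R n \<Longrightarrow> cls n (r \<oplus> s) = cls n r \<oplus>\<^bsub>gr_ring p R\<^esub> cls n s"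
  by (simp add: bar_add gr_hom_add bar_closed)

lemma cls_zero: "cls n \<zero> = \<zero>\<^bsub>gr_ring p R\<^esub>"
  by (simp add: bar_zero gr_hom_one)

lemma cls_finsum:
  assumes "finite A" "\<And>i. i \<in> A \<Longrightarrow> f i \<in> filt R n"
  shows "cls n (\<Oplus>i\<in>A. f i) = (\<Oplus>\<^bsub>gr_ring p R\<^esub>i\<in>A. cls n (f i))"
  using assms
proof (induction A)
  case (insert x A)
  then have "f \<in> A \<rightarrow> carrier R" "f x \<in> carrier R" "(\<lambda>i. cls n (f i)) \<in> A \<rightarrow> carrier (gr_ring p R)"
    "(\<Oplus>i\<in>A. f i) \<in> filt R n"
    using filt_carrier cls_closed by (auto intro!: filt_finsum)
  with insert show ?case by (simp add: cls_add cls_closed)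
qed (simp add: cls_zero)

text \<open>Induction over a finite set containing the support: one component is split off as a
  class and replaced by the unit. A superset is used rather than the support itself, since the
  component removed may already be trivial.\<close>

lemma gr_ring_induct [consumes 1, case_names zero cls add]:
  assumes x: "x \<in> carrier (gr_ring p R)"
    and zero: "P \<zero>\<^bsub>gr_ring p R\<^esub>"
    and cls: "\<And>n r. r \<in> filt R n \<Longrightarrow> P (cls n r)"
    and add: "\<And>x y. x \<in> carrier (gr_ring p R) \<Longrightarrow> y \<in> carrier (gr_ring p R) \<Longrightarrow>
      P x \<Longrightarrow> P y \<Longrightarrow> P (x \<oplus>\<^bsub>gr_ring p R\<^esub> y)"
  shows "P x"
proof -
  have "P x" if "finite A" "x \<in> carrier (gr_ring p R)" "{n. x n \<noteq> \<one>\<^bsub>grp p R n\<^esub>} \<subseteq> A" for A x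
    using that
  proof (induction A arbitrary: x)
    case empty
    then have "x = \<zero>\<^bsub>gr_ring p R\<^esub>" by (auto simp: gr_ring_simps)
    then show ?case using zero by simp
  next
    case (insert n A)
    let ?y = "x(n := \<one>\<^bsub>grp p R n\<^esub>)"
    have y2: "{m. ?y m \<noteq> \<one>\<^bsub>grp p R m\<^esub>} \<subseteq> A"
      using insert.prems by auto
    moreover have "?y m \<in> carrier (grp p R m)" for m
      using gr_ring_mem[OF insert.prems(1)] by simp
    ultimately have y1: "?y \<in> carrier (gr_ring p R)"
      using finite_subset[OF y2 insert.hyps(1)] unfolding carrier_gr_ring by blast
    obtain r where r: "r \<in> filt R n" "x n = bar p R n r"
      using bar_surj gr_ring_mem[OF insert.prems(1)] by blast
    have "x = cls n r \<oplus>\<^bsub>gr_ring p R\<^esub> ?y"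
      using gr_ring_mem[OF insert.prems(1)] r(2)[symmetric]
      by (intro ext) (simp add: gr_ring_simps gr_hom_def)
    then show ?case
      using add[OF cls_closed[OF r(1)] y1 cls[OF r(1)] insert.IH[OF y1 y2]] by (simp only:)
  qed
  with x show ?thesis by (auto simp: carrier_gr_ring)
qed

text \<open>A degree with a nontrivial component is the sum of a degree in the support of
  \<open>x\<close> and one in the support of \<open>y\<close>, and there are finitely many such
  sums.\<close>

lemma gr_ring_mult_closed:
  assumes x: "x \<in> carrier (gr_ring p R)" and y: "y \<in> carrier (gr_ring p R)"
  shows "x \<otimes>\<^bsub>gr_ring p R\<^esub> y \<in> carrier (gr_ring p R)"
proof -
  have cl: "grp_mult p R i (n - i) (x i) (y (n - i)) \<in> carrier (grp p R n)" if "i \<le> n" for i n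
    using grp_mult_closed[OF gr_ring_mem[OF x] gr_ring_mem[OF y], of i "n - i"] that by simp
  let ?X = "{n. x n \<noteq> \<one>\<^bsub>grp p R n\<^esub>}" and ?Y = "{n. y n \<noteq> \<one>\<^bsub>grp p R n\<^esub>}"
  have "(x \<otimes>\<^bsub>gr_ring p R\<^esub> y) n = \<one>\<^bsub>grp p R n\<^esub>" if n: "n \<notin> (\<lambda>(i, j). i + j) ` (?X \<times> ?Y)" for n
    unfolding gr_ring_simps
  proof (rule grp.finprod_one_eqI)
    fix i assume "i \<in> {..n}"
    moreover from this n have "x i = \<one>\<^bsub>grp p R i\<^esub> \<or> y (n - i) = \<one>\<^bsub>grp p R (n - i)\<^esub>" by force
    ultimately show "grp_mult p R i (n - i) (x i) (y (n - i)) = \<one>\<^bsub>grp p R n\<^esub>"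
      using grp_mult_one_left[OF gr_ring_mem[OF y], of i "n - i"]
        grp_mult_one_right[OF gr_ring_mem[OF x], of i "n - i"] by auto
  qed
  then have "{n. (x \<otimes>\<^bsub>gr_ring p R\<^esub> y) n \<noteq> \<one>\<^bsub>grp p R n\<^esub>} \<subseteq> (\<lambda>(i, j). i + j) ` (?X \<times> ?Y)" by blast
  moreover have "finite ((\<lambda>(i, j). i + j) ` (?X \<times> ?Y))"
    using x y by (simp add: carrier_gr_ring)
  ultimately have "finite {n. (x \<otimes>\<^bsub>gr_ring p R\<^esub> y) n \<noteq> \<one>\<^bsub>grp p R n\<^esub>}"
    by (rule finite_subset)
  moreover have "(x \<otimes>\<^bsub>gr_ring p R\<^esub> y) n \<in> carrier (grp p R n)" for n
    unfolding gr_ring_simps using cl by (intro grp.finprod_closed) auto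
  ultimately show ?thesis by (simp add: carrier_gr_ring)
qed

lemma gr_ring_l_distr:
  assumes "x \<in> carrier (gr_ring p R)" "x' \<in> carrier (gr_ring p R)" "y \<in> carrier (gr_ring p R)"
  shows "(x \<oplus>\<^bsub>gr_ring p R\<^esub> x') \<otimes>\<^bsub>gr_ring p R\<^esub> y =
    x \<otimes>\<^bsub>gr_ring p R\<^esub> y \<oplus>\<^bsub>gr_ring p R\<^esub> x' \<otimes>\<^bsub>gr_ring p R\<^esub> y"
proof (rule ext)
  fix n
  have cl: "grp_mult p R i (n - i) (z i) (y (n - i)) \<in> carrier (grp p R n)"
    if "i \<le> n" "z \<in> carrier (gr_ring p R)" for i z
    using grp_mult_closed[OF gr_ring_mem[OF that(2)] gr_ring_mem[OF assms(3)], of i "n - i"] that by simp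
  have "finprod (grp p R n) (\<lambda>i. grp_mult p R i (n - i) (x i \<otimes>\<^bsub>grp p R i\<^esub> x' i) (y (n - i))) {..n}
    = finprod (grp p R n) (\<lambda>i. grp_mult p R i (n - i) (x i) (y (n - i)) \<otimes>\<^bsub>grp p R n\<^esub>
        grp_mult p R i (n - i) (x' i) (y (n - i))) {..n}"
    using cl assms by (intro grp.finprod_cong')
      (auto simp: grp_mult_add_left[OF gr_ring_mem gr_ring_mem gr_ring_mem, where n = "n - _"])
  also have "\<dots> = finprod (grp p R n) (\<lambda>i. grp_mult p R i (n - i) (x i) (y (n - i))) {..n} \<otimes>\<^bsub>grp p R n\<^esub>
      finprod (grp p R n) (\<lambda>i. grp_mult p R i (n - i) (x' i) (y (n - i))) {..n}"
    using cl assms by (intro grp.finprod_multf) auto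
  finally show "((x \<oplus>\<^bsub>gr_ring p R\<^esub> x') \<otimes>\<^bsub>gr_ring p R\<^esub> y) n =
    (x \<otimes>\<^bsub>gr_ring p R\<^esub> y \<oplus>\<^bsub>gr_ring p R\<^esub> x' \<otimes>\<^bsub>gr_ring p R\<^esub> y) n"
    by (simp add: gr_ring_simps)
qed

text \<open>Reversal of the summation index together with commutativity of the pairing.
  Distributivity was proved in the first factor; this transfers it to the second.\<close>

lemma gr_ring_comm:
  assumes x: "x \<in> carrier (gr_ring p R)" and y: "y \<in> carrier (gr_ring p R)"
  shows "x \<otimes>\<^bsub>gr_ring p R\<^esub> y = y \<otimes>\<^bsub>gr_ring p R\<^esub> x"
proof (rule ext)
  fix n
  have cl: "grp_mult p R i (n - i) (x i) (y (n - i)) \<in> carrier (grp p R n)" if "i \<le> n" for i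
    using grp_mult_closed[OF gr_ring_mem[OF x] gr_ring_mem[OF y], of i "n - i"] that by simp
  have im: "{..n} = (\<lambda>i. n - i) ` {..n}"
    by (auto simp: image_iff) (metis atMost_iff diff_diff_cancel diff_le_self)
  have "finprod (grp p R n) (\<lambda>i. grp_mult p R i (n - i) (x i) (y (n - i))) {..n}
     = finprod (grp p R n) (\<lambda>i. grp_mult p R i (n - i) (x i) (y (n - i))) ((\<lambda>i. n - i) ` {..n})"
    using im by simp
  also have "\<dots> = finprod (grp p R n) (\<lambda>i. grp_mult p R (n - i) (n - (n - i)) (x (n - i)) (y (n - (n - i)))) {..n}"
    using cl by (intro grp.finprod_reindex) (auto simp: inj_on_def simp flip: im)
  also have "\<dots> = finprod (grp p R n) (\<lambda>i. grp_mult p R i (n - i) (y i) (x (n - i))) {..n}"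
  proof (intro grp.finprod_cong')
    fix i assume "i \<in> {..n}"
    then show "grp_mult p R (n - i) (n - (n - i)) (x (n - i)) (y (n - (n - i))) =
        grp_mult p R i (n - i) (y i) (x (n - i))"
      using cl[of "n - i"] by (simp add: grp_mult_comm[OF gr_ring_mem[OF x] gr_ring_mem[OF y], of "n - i" i])
  next
    show "(\<lambda>i. grp_mult p R i (n - i) (y i) (x (n - i))) \<in> {..n} \<rightarrow> carrier (grp p R n)"
      using grp_mult_closed[OF gr_ring_mem[OF y] gr_ring_mem[OF x]] by (metis (no_types, lifting) Pi_I atMost_iff le_add_diff_inverse)
  qed simp
  finally show "(x \<otimes>\<^bsub>gr_ring p R\<^esub> y) n = (y \<otimes>\<^bsub>gr_ring p R\<^esub> x) n"
    by (simp add: gr_ring_simps)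
qed

lemma cls_mult:
  assumes r: "r \<in> filt R m" and s: "s \<in> filt R n"
  shows "cls m r \<otimes>\<^bsub>gr_ring p R\<^esub> cls n s = cls (m + n) (r \<otimes> s)"
proof (rule ext)
  fix k
  let ?t = "\<lambda>i. grp_mult p R i (k - i) (cls m r i) (cls n s (k - i))"
  \<comment> \<open>Only for \<open>k = m + n\<close> and \<open>i = m\<close> can both factors be
    nontrivial; otherwise one of them is the unit, and so is the product.\<close>
  have t: "?t i = (if k = m + n \<and> i = m then bar p R (m + n) (r \<otimes> s) else \<one>\<^bsub>grp p R k\<^esub>)" if "i \<le> k" for i
    using that grp_mult_one_left[OF gr_ring_mem[OF cls_closed[OF s]], of i "k - i"]
      grp_mult_one_right[OF gr_ring_mem[OF cls_closed[OF r]], of i "k - i"]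
      grp_mult_bar[OF r s]
    by (auto simp: gr_hom_def)
  show "(cls m r \<otimes>\<^bsub>gr_ring p R\<^esub> cls n s) k = cls (m + n) (r \<otimes> s) k"
  proof (cases "k = m + n")
    case True
    have "finprod (grp p R k) ?t {..k} =
        finprod (grp p R k) (\<lambda>i. if m = i then bar p R k (r \<otimes> s) else \<one>\<^bsub>grp p R k\<^esub>) {..k}"
      using t True bar_closed[OF filt_mult[OF r s]] by (intro grp.finprod_cong') auto
    also have "\<dots> = bar p R k (r \<otimes> s)"
      using grp.finprod_singleton[of m "{..k}" "\<lambda>_. bar p R k (r \<otimes> s)" k] True bar_closed[OF filt_mult[OF r s]]
      by simp
    finally show ?thesis using True by (simp add: gr_ring_simps gr_hom_def)
  next
    case False
    then have "finprod (grp p R k) ?t {..k} = \<one>\<^bsub>grp p R k\<^esub>"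
      using t by (intro grp.finprod_one_eqI) auto
    with False show ?thesis by (simp add: gr_ring_simps gr_hom_def)
  qed
qed

lemma cring_gr_ring: "cring (gr_ring p R)"
proof (rule cringI[OF abelian_group_gr_ring])
  let ?G = "gr_ring p R"
  note cl = gr_ring_mult_closed and comm = gr_ring_comm
  have zero: "\<zero>\<^bsub>?G\<^esub> \<otimes>\<^bsub>?G\<^esub> x = \<zero>\<^bsub>?G\<^esub>" "x \<otimes>\<^bsub>?G\<^esub> \<zero>\<^bsub>?G\<^esub> = \<zero>\<^bsub>?G\<^esub>" if "x \<in> carrier ?G" for x
    using gr_ring_l_distr[of "\<zero>\<^bsub>?G\<^esub>" "\<zero>\<^bsub>?G\<^esub>" x] cl[of "\<zero>\<^bsub>?G\<^esub>" x] comm[of x "\<zero>\<^bsub>?G\<^esub>"] that by simp_all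
  have r_distr: "z \<otimes>\<^bsub>?G\<^esub> (x \<oplus>\<^bsub>?G\<^esub> y) = z \<otimes>\<^bsub>?G\<^esub> x \<oplus>\<^bsub>?G\<^esub> z \<otimes>\<^bsub>?G\<^esub> y"
    if "x \<in> carrier ?G" "y \<in> carrier ?G" "z \<in> carrier ?G" for x y z
    using that gr_ring_l_distr[OF that] comm[of z] by simp
  have one: "\<one>\<^bsub>?G\<^esub> \<in> carrier ?G"
    by (simp add: gr_ring_simps cls_closed filt_0)
  have l_one: "\<one>\<^bsub>?G\<^esub> \<otimes>\<^bsub>?G\<^esub> x = x" if "x \<in> carrier ?G" for x
    using that
  proof (induction rule: gr_ring_induct)
    case (cls n r)
    then show ?case by (simp add: gr_ring_simps(4) cls_mult filt_0 filt_carrier)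
  qed (use one zero r_distr in auto)
  have assoc3: "x \<otimes>\<^bsub>?G\<^esub> y \<otimes>\<^bsub>?G\<^esub> z = x \<otimes>\<^bsub>?G\<^esub> (y \<otimes>\<^bsub>?G\<^esub> z)"
    if "x \<in> carrier ?G" "y \<in> carrier ?G" "z \<in> carrier ?G" for x y z
    using that
  proof (induction x rule: gr_ring_induct)
    case x: (cls k r)
    show ?case using \<open>y \<in> carrier ?G\<close>
    proof (induction y rule: gr_ring_induct)
      case y: (cls m s)
      show ?case using \<open>z \<in> carrier ?G\<close>
      proof (induction z rule: gr_ring_induct)
        case (cls n t)
        then show ?case
          using x y by (simp add: cls_mult filt_mult filt_carrier m_assoc add.assoc)
      qed (use x y in \<open>auto simp: zero cl cls_closed r_distr\<close>)
    qed (use x that in \<open>auto simp: zero cl cls_closed r_distr gr_ring_l_distr\<close>)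
  qed (use that in \<open>auto simp: zero cl gr_ring_l_distr\<close>)
  show "comm_monoid ?G"
    by (rule comm_monoidI) (use cl one assoc3 l_one comm in auto)
qed (rule gr_ring_l_distr)

sublocale gr_ring: cring "gr_ring p R"
  by (rule cring_gr_ring)

lemma gr_ring_mult_p: "x \<in> carrier (gr_ring p R) \<Longrightarrow> [p] \<cdot>\<^bsub>gr_ring p R\<^esub> x = \<zero>\<^bsub>gr_ring p R\<^esub>"
proof (rule ext)
  fix n assume x: "x \<in> carrier (gr_ring p R)"
  have "([k] \<cdot>\<^bsub>gr_ring p R\<^esub> x) n = x n [^]\<^bsub>grp p R n\<^esub> k" for k :: nat
    by (induction k) (simp_all add: gr_ring_simps)
  with x show "([p] \<cdot>\<^bsub>gr_ring p R\<^esub> x) n = \<zero>\<^bsub>gr_ring p R\<^esub> n"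
    by (simp add: gr_ring_simps grp_pow_p gr_ring_mem)
qed

lemma finsum_gr_ring_apply:
  assumes "finite A" "\<And>i. i \<in> A \<Longrightarrow> f i \<in> carrier (gr_ring p R)"
  shows "(\<Oplus>\<^bsub>gr_ring p R\<^esub>i\<in>A. f i) n = finprod (grp p R n) (\<lambda>i. f i n) A"
  using assms
proof (induction A)
  case (insert x A)
  then have "f \<in> A \<rightarrow> carrier (gr_ring p R)" "(\<lambda>i. f i n) \<in> A \<rightarrow> carrier (grp p R n)" 
    by (auto simp: gr_ring_mem)
  with insert show ?case by (simp add: gr_ring_simps(1) gr_ring_mem)
qed (simp add: gr_ring_simps)

end

section \<open>Atiyah formulas and the operations\<close>

lemma (in abelian_monoid) add_pow_finsum:
  assumes "finite A" "f \<in> A \<rightarrow> carrier G"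
  shows "[(k::nat)] \<cdot> (\<Oplus>i\<in>A. f i) = (\<Oplus>i\<in>A. [k] \<cdot> f i)"
  using assms
  by (induction A) (simp_all add: Pi_def add.nat_pow_distrib)

lemma (in cring) binomial_expansion:
  assumes [simp]: "r \<in> carrier R" "s \<in> carrier R"
  shows "(r \<oplus> s) [^] (n::nat) = (\<Oplus>k\<in>{..n}. [(n choose k)] \<cdot> (r [^] k \<otimes> s [^] (n - k)))"
proof (induction n)
  case (Suc n)
  \<comment> \<open>The coefficient in \<open>g m k\<close> always has upper index \<open>n\<close>;
    only the exponent of \<open>s\<close> depends on \<open>m\<close>. So \<open>g (Suc n)\<close>
    lists the terms after multiplication by \<open>s\<close>, its last one vanishing because
    \<open>n choose Suc n\<close> is zero, and \<open>h\<close> lists those after multiplication by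
    \<open>r\<close>. Pascal's rule adds \<open>h k\<close> to
    \<open>g (Suc n) (Suc k)\<close>.\<close>
  define g where "g m k = [(n choose k)] \<cdot> (r [^] k \<otimes> s [^] (m - k))" for m k
  define h where "h k = [(n choose k)] \<cdot> (r [^] Suc k \<otimes> s [^] (n - k))" for k
  have [simp]: "g m k \<in> carrier R" "h k \<in> carrier R" for m k by (simp_all add: g_def h_def)
  have 1: "(r \<oplus> s) [^] n \<otimes> r = (\<Oplus>k\<in>{..n}. h k)"
  proof -
    have "(\<Oplus>k\<in>{..n}. g n k) \<otimes> r = (\<Oplus>k\<in>{..n}. g n k \<otimes> r)" by (simp add: finsum_ldistr)
    also have "\<dots> = (\<Oplus>k\<in>{..n}. h k)"
      by (intro finsum_cong') (auto simp: g_def h_def add_pow_ldistr add_pow_rdistr m_assoc m_comm m_lcomm)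
    finally show ?thesis by (simp add: Suc g_def)
  qed
  have 2: "(r \<oplus> s) [^] n \<otimes> s = (\<Oplus>k\<in>{..Suc n}. g (Suc n) k)"
  proof -
    have "(\<Oplus>k\<in>{..n}. g n k) \<otimes> s = (\<Oplus>k\<in>{..n}. g n k \<otimes> s)" by (simp add: finsum_ldistr)
    also have "\<dots> = (\<Oplus>k\<in>{..n}. g (Suc n) k)"
      by (intro finsum_cong') (auto simp: g_def add_pow_ldistr m_assoc Suc_diff_le)
    also have "\<dots> = (\<Oplus>k\<in>{..Suc n}. g (Suc n) k)"
      by (simp add: g_def[of _ "Suc n"] binomial_eq_0)
    finally show ?thesis by (simp add: Suc g_def)
  qed
  have "(\<Oplus>k\<in>{..Suc n}. [(Suc n choose k)] \<cdot> (r [^] k \<otimes> s [^] (Suc n - k)))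
    = (\<Oplus>k\<in>{..n}. h k \<oplus> g (Suc n) (Suc k)) \<oplus> g (Suc n) 0"
    by (subst finsum_Suc2) (auto simp: g_def h_def add.nat_pow_mult simp del: nat_pow_Suc)
  also have "\<dots> = (\<Oplus>k\<in>{..n}. h k) \<oplus> (\<Oplus>k\<in>{..Suc n}. g (Suc n) k)"
    by (subst finsum_Suc2) (simp_all add: finsum_addf a_assoc)
  also have "\<dots> = (r \<oplus> s) [^] Suc n"
    by (simp add: 1[symmetric] 2[symmetric] r_distr)
  finally show ?case ..
qed simp

text \<open>The inner binomial coefficients are divisible by \<open>p\<close>. The quotient is kept
  as an explicit sum so that the filtration of each summand can be read off later.\<close>

lemma (in cring) frobenius_add:
  assumes p: "prime p" and [simp]: "r \<in> carrier R" "s \<in> carrier R"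
  shows "(r \<oplus> s) [^] p = r [^] p \<oplus> s [^] p \<oplus>
    [p] \<cdot> (\<Oplus>k\<in>{..p - 2}. [((p choose Suc k) div p)] \<cdot> (r [^] Suc k \<otimes> s [^] (p - Suc k)))"
proof -
  obtain m where m: "p = Suc (Suc m)"
    using prime_ge_2_nat[OF p] by (metis add_2_eq_Suc le_Suc_ex)
  let ?g = "\<lambda>k. [(p choose k)] \<cdot> (r [^] k \<otimes> s [^] (p - k))"
  have "(r \<oplus> s) [^] p = (\<Oplus>k\<in>{..p}. ?g k)" by (rule binomial_expansion) simp_all
  also have "\<dots> = ?g p \<oplus> ((\<Oplus>k\<in>{..m}. ?g (Suc k)) \<oplus> ?g 0)"
    unfolding m by (subst finsum_Suc, simp, subst finsum_Suc2) (simp_all del: binomial_Suc_Suc)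
  also have "(\<Oplus>k\<in>{..m}. ?g (Suc k)) =
      (\<Oplus>k\<in>{..m}. [p] \<cdot> ([((p choose Suc k) div p)] \<cdot> (r [^] Suc k \<otimes> s [^] (p - Suc k))))"
  proof (intro finsum_cong' refl)
    fix k assume "k \<in> {..m}"
    then have "p dvd (p choose Suc k)" using p m by (intro dvd_choose_prime) auto
    then show "?g (Suc k) = [p] \<cdot> ([((p choose Suc k) div p)] \<cdot> (r [^] Suc k \<otimes> s [^] (p - Suc k)))"
      by (simp add: add.nat_pow_pow mult.commute del: nat_pow_Suc)
  qed simp
  also have "\<dots> = [p] \<cdot> (\<Oplus>k\<in>{..m}. [((p choose Suc k) div p)] \<cdot> (r [^] Suc k \<otimes> s [^] (p - Suc k)))"
    by (subst add_pow_finsum) simp_all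
  finally show ?thesis
    using m by (simp add: a_ac)
qed


section \<open>The calculus of weak Atiyah formulas\<close>

locale pre_psi_alg =
  fixes R :: "('a, 'z) psi_ring_scheme" (structure) and p :: nat
  assumes pre_psi: "pre_psi_algebra p R" and prime_p: "prime p"

sublocale pre_psi_alg \<subseteq> filtered_alg R p
  using pre_psi by unfold_locales (simp add: pre_psi_algebra_def)

context pre_psi_alg
begin

lemma psi_hom: "psi R \<in> ring_hom R R"
  and filt_even: "n \<ge> 1 \<Longrightarrow> filt R (2 * n) = filt R (2 * n - 1)"
  and atiyah_ex: "q > 0 \<Longrightarrow> r \<in> filt R (2 * q) \<Longrightarrow> \<exists>c. atiyah_formula p R q r c"
  using pre_psi by (simp_all add: pre_psi_algebra_def)

lemma atiyah_unique:
  assumes "q > 0" "r \<in> filt R (2 * q)" "atiyah_formula p R q r c" "atiyah_formula p R q r d" "i \<le> q"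
  shows "bar p R (2 * q + 2 * i * (p - 1)) (c i) = bar p R (2 * q + 2 * i * (p - 1)) (d i)"
proof -
  have "\<forall>q>0. \<forall>r\<in>filt R (2 * q). \<forall>c d. atiyah_formula p R q r c \<longrightarrow> atiyah_formula p R q r d \<longrightarrow>
       (\<forall>i\<le>q. bar p R (2 * q + 2 * i * (p - 1)) (c i) = bar p R (2 * q + 2 * i * (p - 1)) (d i))"
    using pre_psi unfolding pre_psi_algebra_def by (elim conjE)
  then show ?thesis using assms by blast
qed

lemma psi_zero_degree: "r \<in> carrier R \<Longrightarrow> \<exists>r'\<in>carrier R. psi R r = [p] \<cdot> r' \<oplus> r [^] p"
  using pre_psi unfolding pre_psi_algebra_def by (simp add: filt_0)

lemma p_pos: "p > 0" and p_gt_1: "p > 1"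
  using prime_gt_0_nat[OF prime_p] prime_gt_1_nat[OF prime_p] by auto

text \<open>Axiom (i) in the direction in which it is used: an element of odd filtration lies one
  step deeper for free.\<close>

lemma filt_odd: "filt R (Suc (2 * n)) = filt R (2 * Suc n)"
  using filt_even[of "Suc n"] by simp

text \<open>
  Atiyah formulas in which the top term only has to agree with \<open>r\<^sup>p\<close> up to a \<open>p\<close>-multiple of high
  filtration.  Unlike the formulas themselves they are closed under sums and products, they make
  sense for \<open>q = 0\<close>, and they still determine the classes of the terms.
\<close>

definition weak_atiyah :: "nat \<Rightarrow> 'a \<Rightarrow> (nat \<Rightarrow> 'a) \<Rightarrow> bool"
  where "weak_atiyah q r c \<longleftrightarrow>
    (\<forall>i. c i \<in> filt R (2 * q + 2 * i * (p - 1))) \<and> (\<forall>i>q. c i = \<zero>) \<and>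
    (\<exists>u\<in>filt R (2 * q * p). c q \<oplus> [p] \<cdot> u = r [^] p) \<and>
    psi R r = (\<Oplus>i\<in>{..q}. [(p ^ (q - i))] \<cdot> c i)"

text \<open>The filtration demanded of the top term of a formula is that of the p-th power. The
  second form serves goals in which the simplifier has turned \<open>1\<close> into
  \<open>Suc 0\<close>.\<close>

lemma top_filt: "2 * q + 2 * q * (p - 1) = 2 * q * p" "2 * q + 2 * q * (p - Suc 0) = 2 * q * p"
  using p_pos by (cases p; simp)+

text \<open>Each mixed term is a product of \<open>p\<close> factors of filtration \<open>n\<close>,
  so the remainder is \<open>p\<close> times an element as deep in the filtration as the p-th powers
  themselves.\<close>

lemma frobenius_filt:
  assumes r: "r \<in> filt R n" and s: "s \<in> filt R n"
  obtains v where "v \<in> filt R (n * p)" "(r \<oplus> s) [^] p = r [^] p \<oplus> s [^] p \<oplus> [p] \<cdot> v"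
proof -
  have "r [^] Suc k \<otimes> s [^] (p - Suc k) \<in> filt R (n * p)" if "k \<le> p - 2" for k
  proof -
    have "n * Suc k + n * (p - Suc k) = n * p"
      using that p_gt_1 by (simp only: add_mult_distrib2[symmetric]) simp
    then show ?thesis
      using filt_mult[OF filt_pow[OF r, of "Suc k"] filt_pow[OF s, of "p - Suc k"]] by (simp only:)
  qed
  then have "(\<Oplus>k\<in>{..p - 2}. [((p choose Suc k) div p)] \<cdot> (r [^] Suc k \<otimes> s [^] (p - Suc k))) \<in> filt R (n * p)"
    by (intro filt_finsum filt_nat_mult) auto
  then show thesis
    using that frobenius_add[OF prime_p filt_carrier[OF r] filt_carrier[OF s]] by blast
qed

lemma weak_atiyah_filt: "weak_atiyah q r c \<Longrightarrow> c i \<in> filt R (2 * q + 2 * i * (p - 1))"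
  by (simp add: weak_atiyah_def)

lemma weak_atiyah_carrier: "weak_atiyah q r c \<Longrightarrow> c i \<in> carrier R"
  using weak_atiyah_filt filt_carrier by blast

lemma atiyah_imp_weak:
  assumes r: "r \<in> filt R (2 * q)" and c: "atiyah_formula p R q r c"
  shows "weak_atiyah q r (\<lambda>i. if i \<le> q then c i else \<zero>)"
proof -
  have cR: "c i \<in> carrier R" if "i \<le> q" for i
    using c that filt_carrier by (auto simp: atiyah_formula_def)
  have "psi R r = (\<Oplus>i\<in>{..q}. [(p ^ (q - i))] \<cdot> c i)"
    using c by (simp add: atiyah_formula_def)
  also have "\<dots> = (\<Oplus>i\<in>{..q}. [(p ^ (q - i))] \<cdot> (if i \<le> q then c i else \<zero>))"
    using cR by (intro finsum_cong') auto
  finally have psi: "psi R r = \<dots>" .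
  show ?thesis
    unfolding weak_atiyah_def psi
    using c r cR[of q] filt_zero filt_carrier
    by (auto simp: atiyah_formula_def intro!: bexI[where x = \<zero>])
qed

lemma weak_atiyah_ex:
  assumes r: "r \<in> filt R (2 * q)"
  shows "\<exists>c. weak_atiyah q r c"
proof (cases "q = 0")
  case True
  with r have rR: "r \<in> carrier R" by (simp add: filt_0)
  then obtain r' where r': "r' \<in> carrier R" "psi R r = [p] \<cdot> r' \<oplus> r [^] p"
    using psi_zero_degree by blast
  \<comment> \<open>In degree zero the single term of the weak formula is psi(r) itself, and the
    axiom psi(r) = p r' + r^p makes \<open>\<ominus> r'\<close> the correction of the top
    term.\<close>
  have "psi R r \<oplus> [p] \<cdot> (\<ominus> r') = r [^] p"
    using r' rR by (simp add: add.nat_pow_inv a_ac r_neg)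
  then have "weak_atiyah q r (\<lambda>i. if i = 0 then psi R r else \<zero>)"
    using True r' rR ring_hom_closed[OF psi_hom rR]
    by (auto simp: weak_atiyah_def filt_0 filt_zero intro!: bexI[where x = "\<ominus> r'"])
  then show ?thesis by blast
next
  case False
  then show ?thesis using atiyah_ex[of q r] atiyah_imp_weak[OF r] r by blast
qed

lemma weak_atiyah_bar_top:
  assumes c: "weak_atiyah q r c" and r: "r \<in> filt R (2 * q)"
  shows "bar p R (2 * q * p) (c q) = bar p R (2 * q * p) (r [^] p)"
proof -
  obtain u where u: "u \<in> filt R (2 * q * p)" "c q \<oplus> [p] \<cdot> u = r [^] p"
    using c by (auto simp: weak_atiyah_def)
  have cq: "c q \<in> filt R (2 * q * p)"
    using weak_atiyah_filt[OF c, of q] by (simp add: top_filt)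
  have "r [^] p = c q \<oplus> ([p] \<cdot> u \<oplus> \<zero>)"
    using u filt_carrier[OF u(1)] by simp
  then show ?thesis
    using bar_eq_iff[OF filt_pow[OF r, of p] cq] u(1) filt_zero by metis
qed

lemma weak_atiyah_normalize:
  assumes q: "q > 0" and c: "weak_atiyah q r c" and r: "r \<in> filt R (2 * q)"
  obtains e where "atiyah_formula p R q r e"
    "\<And>i. i \<le> q \<Longrightarrow> bar p R (2 * q + 2 * i * (p - 1)) (e i) = bar p R (2 * q + 2 * i * (p - 1)) (c i)"
proof -
  obtain u where u: "u \<in> filt R (2 * q * p)" "c q \<oplus> [p] \<cdot> u = r [^] p"
    using c by (auto simp: weak_atiyah_def)
  obtain k where k: "q = Suc k" using q by (cases q) auto
  note cR [simp] = weak_atiyah_carrier[OF c] and cF = weak_atiyah_filt[OF c]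
  have [simp]: "u \<in> carrier R" "r \<in> carrier R" using u r filt_carrier by auto
  define e where "e i = (if i = q then r [^] p else if i = k then c k \<ominus> u else c i)" for i
  \<comment> \<open>The filtration of \<open>u\<close> exceeds the one required of the term
    \<open>k = q - 1\<close> by \<open>2 * (p - 1)\<close>, so subtracting \<open>u\<close> there
    affects neither membership nor class.\<close>
  have lt: "2 * q + 2 * k * (p - 1) < 2 * q * p"
    unfolding top_filt(1)[symmetric] using p_gt_1 by (simp add: k)
  have uF: "u \<in> filt R (2 * q + 2 * k * (p - 1))"
    using filt_mono_mem[OF u(1)] lt by simp
  have eF: "e i \<in> filt R (2 * q + 2 * i * (p - 1))" for i
    using cF[of i] filt_minus[OF cF[of k] uF] filt_pow[OF r, of p] by (auto simp: e_def top_filt)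
  have eR [simp]: "e i \<in> carrier R" for i using eF filt_carrier by blast
  \<comment> \<open>The last two terms are isolated because their coefficients are 1 and
    \<open>p\<close>: adding p u to the one and subtracting u from the other leaves the sum
    unchanged.\<close>
  have split: "(\<Oplus>i\<in>{..q}. [(p ^ (q - i))] \<cdot> f i) =
      f q \<oplus> ([p] \<cdot> f k \<oplus> (\<Oplus>i\<in>{..<k}. [(p ^ (q - i))] \<cdot> f i))" if "\<And>i. f i \<in> carrier R" for f
    unfolding k by (subst finsum_Suc, simp add: that, subst add.finprod_Suc3) (simp_all add: that)
  have "(\<Oplus>i\<in>{..<k}. [(p ^ (q - i))] \<cdot> e i) = (\<Oplus>i\<in>{..<k}. [(p ^ (q - i))] \<cdot> c i)"
    by (intro finsum_cong') (auto simp: e_def k)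
  then have "(\<Oplus>i\<in>{..q}. [(p ^ (q - i))] \<cdot> e i) =
      (c q \<oplus> [p] \<cdot> u) \<oplus> ([p] \<cdot> (c k \<ominus> u) \<oplus> (\<Oplus>i\<in>{..<k}. [(p ^ (q - i))] \<cdot> c i))"
    by (subst split) (simp_all add: e_def k u(2)[unfolded k])
  also have "\<dots> = c q \<oplus> (([p] \<cdot> u \<oplus> [p] \<cdot> (c k \<ominus> u)) \<oplus> (\<Oplus>i\<in>{..<k}. [(p ^ (q - i))] \<cdot> c i))"
    by (simp add: a_assoc)
  also have "[p] \<cdot> u \<oplus> [p] \<cdot> (c k \<ominus> u) = [p] \<cdot> c k"
    by (subst add.nat_pow_distrib[symmetric]) (simp_all add: a_minus_def a_lcomm[of u] r_neg)
  also have "c q \<oplus> ([p] \<cdot> c k \<oplus> (\<Oplus>i\<in>{..<k}. [(p ^ (q - i))] \<cdot> c i)) = psi R r"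
    using c by (subst split[symmetric]) (simp_all add: weak_atiyah_def)
  finally have "atiyah_formula p R q r e"
    using eF by (simp add: atiyah_formula_def e_def)
  moreover have "bar p R (2 * q + 2 * i * (p - 1)) (e i) = bar p R (2 * q + 2 * i * (p - 1)) (c i)" if "i \<le> q" for i
  proof -
    have "c k = (c k \<ominus> u) \<oplus> u" by (simp add: a_minus_def a_assoc l_neg)
    then have "bar p R (2 * q + 2 * k * (p - 1)) (c k) =
        bar p R (2 * q + 2 * k * (p - 1)) (c k \<ominus> u) \<otimes>\<^bsub>grp p R (2 * q + 2 * k * (p - 1))\<^esub>
        bar p R (2 * q + 2 * k * (p - 1)) u"
      using bar_add[OF filt_minus[OF cF[of k] uF] uF] by (simp only:)
    then have "bar p R (2 * q + 2 * k * (p - 1)) (c k \<ominus> u) = bar p R (2 * q + 2 * k * (p - 1)) (c k)"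
      using bar_eq_oneI[OF u(1) lt] bar_closed[OF filt_minus[OF cF[of k] uF]] by simp
    then show ?thesis
      using weak_atiyah_bar_top[OF c r] by (auto simp: e_def top_filt)
  qed
  ultimately show thesis using that by blast
qed

text \<open>For \<open>q > 0\<close> and \<open>i \<le> q\<close> both formulas are normalized and
  the axiom on genuine formulas applies. Beyond \<open>q\<close> all terms are zero, and for
  \<open>q = 0\<close> the single term has the class of r^p.\<close>

lemma weak_atiyah_unique:
  assumes r: "r \<in> filt R (2 * q)" and c: "weak_atiyah q r c" and d: "weak_atiyah q r d"
  shows "bar p R (2 * q + 2 * i * (p - 1)) (c i) = bar p R (2 * q + 2 * i * (p - 1)) (d i)"
proof (cases "i \<le> q \<and> q > 0")
  case True
  then show ?thesis
    using weak_atiyah_normalize[OF _ c r] weak_atiyah_normalize[OF _ d r] atiyah_unique[OF _ r]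
    by metis
next
  case False
  then consider "i > q" | "q = 0" "i = 0" by linarith
  then show ?thesis
    using c d weak_atiyah_bar_top[OF c r] weak_atiyah_bar_top[OF d r]
    by cases (auto simp: weak_atiyah_def)
qed

lemma psi_add: "r \<in> carrier R \<Longrightarrow> s \<in> carrier R \<Longrightarrow> psi R (r \<oplus> s) = psi R r \<oplus> psi R s"
  and psi_mult: "r \<in> carrier R \<Longrightarrow> s \<in> carrier R \<Longrightarrow> psi R (r \<otimes> s) = psi R r \<otimes> psi R s"
  using psi_hom by (auto simp: ring_hom_def)

lemma weak_atiyah_add:
  assumes r: "r \<in> filt R (2 * q)" and s: "s \<in> filt R (2 * q)"
    and c: "weak_atiyah q r c" and d: "weak_atiyah q s d"
  shows "weak_atiyah q (r \<oplus> s) (\<lambda>i. c i \<oplus> d i)"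
proof -
  note [simp] = weak_atiyah_carrier[OF c] weak_atiyah_carrier[OF d] filt_carrier[OF r] filt_carrier[OF s]
  obtain u where u: "u \<in> filt R (2 * q * p)" "c q \<oplus> [p] \<cdot> u = r [^] p"
    using c by (auto simp: weak_atiyah_def)
  obtain v where v: "v \<in> filt R (2 * q * p)" "d q \<oplus> [p] \<cdot> v = s [^] p"
    using d by (auto simp: weak_atiyah_def)
  obtain w where w: "w \<in> filt R (2 * q * p)" "(r \<oplus> s) [^] p = r [^] p \<oplus> s [^] p \<oplus> [p] \<cdot> w"
    using frobenius_filt[OF r s] by blast
  have [simp]: "u \<in> carrier R" "v \<in> carrier R" "w \<in> carrier R" using u v w filt_carrier by auto
  \<comment> \<open>\<open>u\<close> and \<open>v\<close> correct the two top terms, and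
    \<open>w\<close> accounts for the p-th power of a sum.\<close>
  have "c q \<oplus> d q \<oplus> [p] \<cdot> (u \<oplus> v \<oplus> w) = (r \<oplus> s) [^] p"
    by (simp add: w(2) u(2)[symmetric] v(2)[symmetric] add.nat_pow_distrib a_ac)
  moreover have "u \<oplus> v \<oplus> w \<in> filt R (2 * q * p)" using u v w by (simp add: filt_add)
  moreover have "psi R (r \<oplus> s) = (\<Oplus>i\<in>{..q}. [(p ^ (q - i))] \<cdot> (c i \<oplus> d i))"
    using c d by (simp add: psi_add weak_atiyah_def add.nat_pow_distrib finsum_addf)
  ultimately show ?thesis
    using c d unfolding weak_atiyah_def by (auto simp: filt_add)
qed

lemma weak_atiyah_zero: "weak_atiyah q \<zero> (\<lambda>i. \<zero>)"
proof -
  have "psi R \<zero> = \<zero>" using psi_hom ring_hom_zero ring_axioms by blast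
  moreover have "\<zero> \<oplus> [p] \<cdot> \<zero> = \<zero> [^] p" using p_pos by (simp add: nat_pow_zero)
  ultimately show ?thesis
    using filt_zero unfolding weak_atiyah_def by (auto intro!: bexI[where x = \<zero>])
qed

lemma weak_atiyah_nat_mult:
  assumes r: "r \<in> filt R (2 * q)" and c: "weak_atiyah q r c"
  shows "weak_atiyah q ([(k::nat)] \<cdot> r) (\<lambda>i. [k] \<cdot> c i)"
proof (induction k)
  case 0
  then show ?case by (simp add: weak_atiyah_zero)
next
  case (Suc k)
  show ?case
    using weak_atiyah_add[OF filt_nat_mult[OF r] r Suc c] by simp
qed

text \<open>A formula of degree q + 1 read as one of degree q: each weight below the top two gives
  up one factor \<open>p\<close> to its term, and the last two terms merge into p c_q + c_(q+1). The
  filtrations are still counted from 2q + 2, so the classes in the degrees counted from 2q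
  vanish.\<close>

lemma weak_atiyah_shift:
  assumes r: "r \<in> filt R (2 * Suc q)" and c: "weak_atiyah (Suc q) r c"
  obtains d where "weak_atiyah q r d" "\<And>i. bar p R (2 * q + 2 * i * (p - 1)) (d i) = \<one>\<^bsub>grp p R (2 * q + 2 * i * (p - 1))\<^esub>"
proof -
  note [simp] = weak_atiyah_carrier[OF c] filt_carrier[OF r]
  note cF = weak_atiyah_filt[OF c]
  obtain u where u: "u \<in> filt R (2 * Suc q * p)" "c (Suc q) \<oplus> [p] \<cdot> u = r [^] p"
    using c by (auto simp: weak_atiyah_def)
  have [simp]: "u \<in> carrier R" using u filt_carrier by auto
  define d where "d i = (if i < q then [p] \<cdot> c i else if i = q then [p] \<cdot> c q \<oplus> c (Suc q) else \<zero>)" for i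
  have dF: "d i \<in> filt R (2 * Suc q + 2 * i * (p - 1))" for i
    using filt_nat_mult[OF cF, of p i] filt_zero filt_mono_mem[OF cF[of "Suc q"], of "2 * Suc q + 2 * q * (p - 1)"]
    by (auto simp: d_def intro: filt_add)
  have dR [simp]: "d i \<in> carrier R" for i using dF filt_carrier by blast
  have "d i \<in> filt R (2 * q + 2 * i * (p - 1))" for i
    using filt_mono_mem[OF dF] by simp
  \<comment> \<open>The merged top term exceeds the old one by p c_q, hence the correction
    \<open>u \<ominus> c q\<close> in place of \<open>u\<close>.\<close>
  moreover have "u \<ominus> c q \<in> filt R (2 * q * p)"
    using filt_mono_mem[OF u(1), of "2 * q * p"] filt_mono_mem[OF cF[of q], of "2 * q * p"]
    by (intro filt_minus) (simp_all flip: top_filt(2))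
  moreover have "d q \<oplus> [p] \<cdot> (u \<ominus> c q) = r [^] p"
  proof -
    have "d q \<oplus> [p] \<cdot> (u \<ominus> c q) = c (Suc q) \<oplus> ([p] \<cdot> c q \<oplus> [p] \<cdot> (u \<ominus> c q))"
      by (simp add: d_def a_ac)
    also have "[p] \<cdot> c q \<oplus> [p] \<cdot> (u \<ominus> c q) = [p] \<cdot> u"
      by (subst add.nat_pow_distrib[symmetric]) (simp_all add: a_minus_def a_ac r_neg)
    finally show ?thesis using u(2) by simp
  qed
  moreover have "psi R r = (\<Oplus>i\<in>{..q}. [(p ^ (q - i))] \<cdot> d i)"
  proof -
    have "(\<Oplus>i\<in>{..<q}. [(p ^ (q - i))] \<cdot> d i) = (\<Oplus>i\<in>{..<q}. [(p ^ (Suc q - i))] \<cdot> c i)"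
      by (intro finsum_cong') (auto simp: d_def add.nat_pow_pow Suc_diff_le mult.commute)
    then have "(\<Oplus>i\<in>{..q}. [(p ^ (q - i))] \<cdot> d i) =
        ([p] \<cdot> c q \<oplus> c (Suc q)) \<oplus> (\<Oplus>i\<in>{..<q}. [(p ^ (Suc q - i))] \<cdot> c i)"
      by (subst add.finprod_Suc3) (simp_all add: d_def)
    also have "\<dots> = (\<Oplus>i\<in>{..Suc q}. [(p ^ (Suc q - i))] \<cdot> c i)"
      by (subst finsum_Suc, simp, subst add.finprod_Suc3) (simp_all add: a_ac)
    also have "\<dots> = psi R r"
      using c by (simp add: weak_atiyah_def)
    finally show ?thesis ..
  qed
  ultimately have "weak_atiyah q r d"
    unfolding weak_atiyah_def by (auto simp: d_def)
  moreover have "bar p R (2 * q + 2 * i * (p - 1)) (d i) = \<one>\<^bsub>grp p R (2 * q + 2 * i * (p - 1))\<^esub>" for i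
    by (rule bar_eq_oneI[OF dF]) simp
  ultimately show thesis using that by blast
qed

lemma weak_atiyah_bar_cong:
  assumes r: "r \<in> filt R (2 * q)" and s: "s \<in> filt R (2 * q)"
    and eq: "bar p R (2 * q) r = bar p R (2 * q) s"
    and c: "weak_atiyah q r c" and d: "weak_atiyah q s d"
  shows "bar p R (2 * q + 2 * i * (p - 1)) (c i) = bar p R (2 * q + 2 * i * (p - 1)) (d i)"
proof -
  let ?n = "2 * q + 2 * i * (p - 1)"
  obtain t u where t: "t \<in> filt R (2 * q)" and u: "u \<in> filt R (Suc (2 * q))"
    and rs: "r = s \<oplus> ([p] \<cdot> t \<oplus> u)"
    using eq bar_eq_iff[OF r s] by blast
  \<comment> \<open>The gain of one filtration degree is what allows a formula of degree
    \<open>Suc q\<close> for \<open>u\<close>, to be shifted down.\<close>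
  have u': "u \<in> filt R (2 * Suc q)" "u \<in> filt R (2 * q)"
    using u filt_odd filt_mono_mem[OF u, of "2 * q"] by auto
  obtain e where e: "weak_atiyah q t e" using weak_atiyah_ex[OF t] by blast
  obtain f' where "weak_atiyah (Suc q) u f'" using weak_atiyah_ex[OF u'(1)] by blast
  then obtain f where f: "weak_atiyah q u f" "bar p R ?n (f i) = \<one>\<^bsub>grp p R ?n\<^esub>"
    using weak_atiyah_shift[OF u'(1)] by metis
  have "weak_atiyah q r (\<lambda>i. d i \<oplus> ([p] \<cdot> e i \<oplus> f i))"
    unfolding rs
    by (intro weak_atiyah_add weak_atiyah_nat_mult s d filt_add filt_nat_mult t u' e f)
  then have "bar p R ?n (c i) = bar p R ?n (d i \<oplus> ([p] \<cdot> e i \<oplus> f i))"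
    by (rule weak_atiyah_unique[OF r c])
  also have "\<dots> = bar p R ?n (d i)"
    using weak_atiyah_filt[OF d, of i] weak_atiyah_filt[OF e, of i] weak_atiyah_filt[OF f(1), of i] f(2)
    by (simp add: bar_add bar_nat_mult filt_add filt_nat_mult bar_closed grp_pow_p)
  finally show ?thesis .
qed

text \<open>In terms of weak formulas the three branches in the definition of \<open>grp_P\<close>
  say the same thing: the value is the class of the i-th term. Independence of formula and lift then
  evaluates the description operator.\<close>

lemma grp_P_bar:
  assumes r: "r \<in> filt R (2 * q)" and c: "weak_atiyah q r c"
  shows "grp_P p R i q (bar p R (2 * q) r) = bar p R (2 * q + 2 * i * (p - 1)) (c i)"
proof -
  let ?n = "2 * q + 2 * i * (p - 1)"
  have body: "(if i > q then Y = \<one>\<^bsub>grp p R ?n\<^esub>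
        else if q = 0 then Y = bar p R 0 (s [^] p)
        else \<exists>c. atiyah_formula p R q s c \<and> Y = bar p R ?n (c i)) \<longleftrightarrow>
      (\<exists>d. weak_atiyah q s d \<and> Y = bar p R ?n (d i))" (is "?L \<longleftrightarrow> ?Q") if s: "s \<in> filt R (2 * q)" for s Y
  proof -
    obtain d where d: "weak_atiyah q s d" using weak_atiyah_ex[OF s] by blast
    then have Q: "?Q \<longleftrightarrow> Y = bar p R ?n (d i)"
      using weak_atiyah_unique[OF s] by metis
    consider "i > q" | "i = 0" "q = 0" | "i \<le> q" "q > 0" by linarith
    then show ?thesis
    proof cases
      case 1
      then show ?thesis using d Q by (simp add: weak_atiyah_def bar_zero)
    next
      case 2
      then show ?thesis using weak_atiyah_bar_top[OF d s] Q by simp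
    next
      case 3
      obtain e where e: "atiyah_formula p R q s e" "bar p R ?n (e i) = bar p R ?n (d i)"
        using weak_atiyah_normalize[OF 3(2) d s] 3(1) by metis
      have L: "?L \<longleftrightarrow> (\<exists>c. atiyah_formula p R q s c \<and> Y = bar p R ?n (c i))"
        using 3 by simp
      have "?L \<longleftrightarrow> Y = bar p R ?n (e i)"
        unfolding L
      proof
        assume "\<exists>c. atiyah_formula p R q s c \<and> Y = bar p R ?n (c i)"
        then obtain c where "atiyah_formula p R q s c" "Y = bar p R ?n (c i)" by blast
        then show "Y = bar p R ?n (e i)"
          using atiyah_unique[OF 3(2) s _ e(1) 3(1)] by simp
      qed (use e(1) in blast)
      then show ?thesis using Q e by simp
    qed
  qed
  show ?thesis
    unfolding grp_P_def
  proof (rule the_equality)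
    show "\<exists>s\<in>filt R (2 * q). bar p R (2 * q) s = bar p R (2 * q) r \<and>
      (if i > q then bar p R ?n (c i) = \<one>\<^bsub>grp p R ?n\<^esub>
        else if q = 0 then bar p R ?n (c i) = bar p R 0 (s [^] p)
        else \<exists>d. atiyah_formula p R q s d \<and> bar p R ?n (c i) = bar p R ?n (d i))"
      using body[OF r, of "bar p R ?n (c i)"] r c by (intro bexI[of _ r]) auto
  next
    fix Y assume "\<exists>s\<in>filt R (2 * q). bar p R (2 * q) s = bar p R (2 * q) r \<and>
      (if i > q then Y = \<one>\<^bsub>grp p R ?n\<^esub>
        else if q = 0 then Y = bar p R 0 (s [^] p)
        else \<exists>c. atiyah_formula p R q s c \<and> Y = bar p R ?n (c i))"
    then obtain s d where "s \<in> filt R (2 * q)" "bar p R (2 * q) s = bar p R (2 * q) r"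
      "weak_atiyah q s d" "Y = bar p R ?n (d i)"
      using body by blast
    then show "Y = bar p R ?n (c i)"
      using weak_atiyah_bar_cong r c by metis
  qed
qed


text \<open>The weights multiply as p^(q-i) p^(q'-j) = p^(q+q'-i-j), so multiplicativity of psi
  makes the terms for a product convolutions. That weak formulas are continued by zero beyond
  \<open>q\<close> spares the convolution any bounds on its indices.\<close>

lemma weak_atiyah_mult:
  assumes r: "r \<in> filt R (2 * q)" and s: "s \<in> filt R (2 * q')"
    and c: "weak_atiyah q r c" and d: "weak_atiyah q' s d"
  shows "weak_atiyah (q + q') (r \<otimes> s) (\<lambda>k. \<Oplus>i\<in>{..k}. c i \<otimes> d (k - i))"
proof -
  note [simp] = weak_atiyah_carrier[OF c] weak_atiyah_carrier[OF d] filt_carrier[OF r] filt_carrier[OF s]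
  have c0 [simp]: "i > q \<Longrightarrow> c i = \<zero>" and d0 [simp]: "i > q' \<Longrightarrow> d i = \<zero>" for i
    using c d by (auto simp: weak_atiyah_def)
  let ?e = "\<lambda>k. \<Oplus>i\<in>{..k}. c i \<otimes> d (k - i)"
  have eF: "?e k \<in> filt R (2 * (q + q') + 2 * k * (p - 1))" for k
  proof (rule filt_finsum)
    fix i assume "i \<in> {..k}"
    then obtain j where "k = i + j" by (auto dest: le_Suc_ex)
    then have "2 * q + 2 * i * (p - 1) + (2 * q' + 2 * (k - i) * (p - 1)) = 2 * (q + q') + 2 * k * (p - 1)"
      by (simp add: algebra_simps)
    then show "c i \<otimes> d (k - i) \<in> filt R (2 * (q + q') + 2 * k * (p - 1))"
      using filt_mult[OF weak_atiyah_filt[OF c, of i] weak_atiyah_filt[OF d, of "k - i"]] by (simp only:)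
  qed simp
  \<comment> \<open>At or beyond the top index one of the two indices exceeds its bound, except for
    \<open>i = q\<close> when \<open>k = q + q'\<close>. Hence the top term is a single
    product.\<close>
  have vanish: "c i \<otimes> d (k - i) = \<zero>" if "i \<le> k" "q + q' \<le> k" "\<not> (k = q + q' \<and> i = q)" for i k
  proof -
    from that have "i > q \<or> k - i > q'" by linarith
    then show ?thesis by auto
  qed
  have e_top: "?e (q + q') = c q \<otimes> d q'"
  proof -
    have "?e (q + q') = (\<Oplus>i\<in>{..q + q'}. if q = i then c q \<otimes> d q' else \<zero>)"
      using vanish[of _ "q + q'"] by (intro finsum_cong') auto
    then show ?thesis
      using finsum_singleton[of q "{..q + q'}" "\<lambda>_. c q \<otimes> d q'"] by simp
  qed
  have e_zero: "?e k = \<zero>" if "k > q + q'" for k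
    using that vanish[of _ k] by (intro add.finprod_one_eqI) auto
  obtain u where u: "u \<in> filt R (2 * q * p)" "c q \<oplus> [p] \<cdot> u = r [^] p"
    using c by (auto simp: weak_atiyah_def)
  obtain v where v: "v \<in> filt R (2 * q' * p)" "d q' \<oplus> [p] \<cdot> v = s [^] p"
    using d by (auto simp: weak_atiyah_def)
  have [simp]: "u \<in> carrier R" "v \<in> carrier R" using u v filt_carrier by auto
  \<comment> \<open>Obtained by multiplying out (c_q + p u) s^p and then replacing s^p by d_q' + p v
    in the first summand only.\<close>
  let ?w = "u \<otimes> s [^] p \<oplus> c q \<otimes> v"
  have "2 * q * p + 2 * q' * p = 2 * (q + q') * p" by (simp add: algebra_simps)
  moreover have "c q \<in> filt R (2 * q * p)" "s [^] p \<in> filt R (2 * q' * p)"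
    using weak_atiyah_filt[OF c, of q] filt_pow[OF s, of p] by (simp_all add: top_filt)
  ultimately have w: "?w \<in> filt R (2 * (q + q') * p)"
    using filt_mult[OF u(1)] filt_mult[OF _ v(1)] by (metis filt_add)
  have "(r \<otimes> s) [^] p = (c q \<oplus> [p] \<cdot> u) \<otimes> s [^] p"
    by (simp add: nat_pow_distrib u(2))
  also have "\<dots> = c q \<otimes> (d q' \<oplus> [p] \<cdot> v) \<oplus> [p] \<cdot> (u \<otimes> s [^] p)"
    by (simp add: l_distr add_pow_ldistr v(2))
  also have "\<dots> = c q \<otimes> d q' \<oplus> [p] \<cdot> ?w"
    by (simp add: r_distr add_pow_rdistr add.nat_pow_distrib a_ac)
  finally have top: "?e (q + q') \<oplus> [p] \<cdot> ?w = (r \<otimes> s) [^] p"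
    by (simp only: e_top)
  let ?f = "\<lambda>i. [(p ^ (q - i))] \<cdot> c i" and ?g = "\<lambda>i. [(p ^ (q' - i))] \<cdot> d i"
  have "psi R (r \<otimes> s) = (\<Oplus>i\<in>{..q}. ?f i) \<otimes> (\<Oplus>i\<in>{..q'}. ?g i)"
    using c d by (simp add: psi_mult weak_atiyah_def)
  also have "\<dots> = (\<Oplus>k\<in>{..q + q'}. \<Oplus>i\<in>{..k}. ?f i \<otimes> ?g (k - i))"
    by (rule cauchy_product[symmetric]) (auto simp: bound_def)
  also have "\<dots> = (\<Oplus>k\<in>{..q + q'}. [(p ^ (q + q' - k))] \<cdot> ?e k)"
  proof (intro finsum_cong' refl)
    fix k assume "k \<in> {..q + q'}"
    have "(\<Oplus>i\<in>{..k}. ?f i \<otimes> ?g (k - i)) = (\<Oplus>i\<in>{..k}. [(p ^ (q + q' - k))] \<cdot> (c i \<otimes> d (k - i)))"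
    proof (intro finsum_cong' refl)
      fix i assume i: "i \<in> {..k}"
      show "?f i \<otimes> ?g (k - i) = [(p ^ (q + q' - k))] \<cdot> (c i \<otimes> d (k - i))"
      \<comment> \<open>The truncated exponents add up only in this range; outside it a vanishing
        factor makes both sides zero.\<close>
      proof (cases "i \<le> q \<and> k - i \<le> q'")
        case True
        with i have "q - i + (q' - (k - i)) = q + q' - k" by auto
        then show ?thesis
          by (simp add: add_pow_ldistr add_pow_rdistr add.nat_pow_pow flip: power_add)
      qed auto
    qed auto
    also have "\<dots> = [(p ^ (q + q' - k))] \<cdot> ?e k"
      by (rule add_pow_finsum[symmetric]) auto
    finally show "(\<Oplus>i\<in>{..k}. ?f i \<otimes> ?g (k - i)) = [(p ^ (q + q' - k))] \<cdot> ?e k" .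
  qed auto
  finally show ?thesis
    using eF e_zero w top unfolding weak_atiyah_def by blast
qed

section \<open>The operations on the whole graded ring and their Cartan formula\<close>

lemma cls_odd: "r \<in> filt R (2 * n + 1) \<Longrightarrow> cls (2 * n + 1) r = \<zero>\<^bsub>gr_ring p R\<^esub>"
  using bar_eq_oneI[of r "2 * Suc n" "2 * n + 1"] by (simp add: filt_odd gr_hom_one)

lemma grp_P_closed:
  "X \<in> carrier (grp p R (2 * q)) \<Longrightarrow> grp_P p R i q X \<in> carrier (grp p R (2 * q + 2 * i * (p - 1)))"
  by (metis bar_surj weak_atiyah_ex grp_P_bar bar_closed weak_atiyah_filt)

lemma grp_P_add:
  assumes "X \<in> carrier (grp p R (2 * q))" "Y \<in> carrier (grp p R (2 * q))"
  shows "grp_P p R i q (X \<otimes>\<^bsub>grp p R (2 * q)\<^esub> Y) =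
    grp_P p R i q X \<otimes>\<^bsub>grp p R (2 * q + 2 * i * (p - 1))\<^esub> grp_P p R i q Y"
proof -
  obtain r s where rs: "r \<in> filt R (2 * q)" "X = bar p R (2 * q) r" "s \<in> filt R (2 * q)" "Y = bar p R (2 * q) s"
    using assms by (metis bar_surj)
  obtain c d where cd: "weak_atiyah q r c" "weak_atiyah q s d" using weak_atiyah_ex rs by blast
  have "grp_P p R i q (bar p R (2 * q) (r \<oplus> s)) = bar p R (2 * q + 2 * i * (p - 1)) (c i \<oplus> d i)"
    using grp_P_bar[OF filt_add weak_atiyah_add] rs cd by blast
  then show ?thesis
    using rs cd by (simp only: bar_add grp_P_bar weak_atiyah_filt)
qed

lemma grp_P_one: "grp_P p R i q \<one>\<^bsub>grp p R (2 * q)\<^esub> = \<one>\<^bsub>grp p R (2 * q + 2 * i * (p - 1))\<^esub>"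
  using grp_P_bar[OF filt_zero weak_atiyah_zero] by (simp only: bar_zero)

lemma gr_P_apply:
  "gr_P p R i x (2 * q + 2 * i * (p - 1)) = grp_P p R i q (x (2 * q))"
  by (simp add: gr_P_def)

lemma gr_P_apply_other:
  assumes "\<nexists>q. m = 2 * q + 2 * i * (p - 1)"
  shows "gr_P p R i x m = \<one>\<^bsub>grp p R m\<^esub>"
proof -
  have "\<not> (2 * i * (p - 1) \<le> m \<and> even (m - 2 * i * (p - 1)))"
  proof
    assume a: "2 * i * (p - 1) \<le> m \<and> even (m - 2 * i * (p - 1))"
    then obtain q where "m - 2 * i * (p - 1) = 2 * q" using evenE by blast
    with a have "m = 2 * q + 2 * i * (p - 1)" by linarith
    with assms show False by blast
  qed
  then show ?thesis by (simp only: gr_P_def Let_def if_False)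
qed

text \<open>The operations send the zero class to zero, so the support is at most moved by
  \<open>2 * i * (p - 1)\<close> and stays finite.\<close>

lemma gr_P_closed:
  assumes x: "x \<in> carrier (gr_ring p R)"
  shows "gr_P p R i x \<in> carrier (gr_ring p R)"
proof -
  have "gr_P p R i x m \<in> carrier (grp p R m)" for m
  proof (cases "\<exists>q. m = 2 * q + 2 * i * (p - 1)")
    case True
    then show ?thesis using grp_P_closed gr_ring_mem[OF x] gr_P_apply by metis
  qed (simp add: gr_P_apply_other)
  moreover have "{m. gr_P p R i x m \<noteq> \<one>\<^bsub>grp p R m\<^esub>} \<subseteq>
      (\<lambda>n. n + 2 * i * (p - 1)) ` {n. x n \<noteq> \<one>\<^bsub>grp p R n\<^esub>}"
  proof
    fix m assume m: "m \<in> {m. gr_P p R i x m \<noteq> \<one>\<^bsub>grp p R m\<^esub>}"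
    then obtain q where q: "m = 2 * q + 2 * i * (p - 1)" using gr_P_apply_other[of m i x] by blast
    then have "x (2 * q) \<noteq> \<one>\<^bsub>grp p R (2 * q)\<^esub>"
      using m grp_P_one by (metis (mono_tags, lifting) gr_P_apply mem_Collect_eq)
    then show "m \<in> (\<lambda>n. n + 2 * i * (p - 1)) ` {n. x n \<noteq> \<one>\<^bsub>grp p R n\<^esub>}"
      using q by blast
  qed
  moreover have "finite ((\<lambda>n. n + 2 * i * (p - 1)) ` {n. x n \<noteq> \<one>\<^bsub>grp p R n\<^esub>})"
    using x by (simp add: carrier_gr_ring)
  ultimately show ?thesis
    using finite_subset unfolding carrier_gr_ring by blast
qed

lemma gr_P_add:
  assumes x: "x \<in> carrier (gr_ring p R)" and y: "y \<in> carrier (gr_ring p R)"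
  shows "gr_P p R i (x \<oplus>\<^bsub>gr_ring p R\<^esub> y) = gr_P p R i x \<oplus>\<^bsub>gr_ring p R\<^esub> gr_P p R i y"
proof (rule ext)
  fix m
  show "gr_P p R i (x \<oplus>\<^bsub>gr_ring p R\<^esub> y) m = (gr_P p R i x \<oplus>\<^bsub>gr_ring p R\<^esub> gr_P p R i y) m"
  proof (cases "\<exists>q. m = 2 * q + 2 * i * (p - 1)")
    case True
    then obtain q where q: "m = 2 * q + 2 * i * (p - 1)" by blast
    show ?thesis
      unfolding q gr_P_apply gr_ring_simps(1)
      by (rule grp_P_add[OF gr_ring_mem[OF x] gr_ring_mem[OF y]])
  qed (simp add: gr_P_apply_other gr_ring_simps(1))
qed

lemma gr_P_gr_hom:
  "gr_P p R i (gr_hom p R (2 * q) X) = gr_hom p R (2 * q + 2 * i * (p - 1)) (grp_P p R i q X)"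
proof (rule ext)
  fix m
  show "gr_P p R i (gr_hom p R (2 * q) X) m = gr_hom p R (2 * q + 2 * i * (p - 1)) (grp_P p R i q X) m"
  proof (cases "\<exists>q. m = 2 * q + 2 * i * (p - 1)")
    case True
    then obtain q' where q': "m = 2 * q' + 2 * i * (p - 1)" by blast
    show ?thesis
      unfolding q' gr_P_apply
      by (cases "q = q'") (auto simp: gr_hom_def grp_P_one[unfolded One_nat_def])
  qed (auto simp: gr_P_apply_other gr_hom_def)
qed

lemma gr_P_cls:
  "r \<in> filt R (2 * q) \<Longrightarrow> weak_atiyah q r c \<Longrightarrow>
    gr_P p R i (cls (2 * q) r) = cls (2 * q + 2 * i * (p - 1)) (c i)"
  by (simp only: gr_P_gr_hom grp_P_bar)

lemma gr_P_zero: "gr_P p R i \<zero>\<^bsub>gr_ring p R\<^esub> = \<zero>\<^bsub>gr_ring p R\<^esub>"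
  using gr_P_gr_hom[of i 0 "\<one>\<^bsub>grp p R (2 * 0)\<^esub>"] unfolding grp_P_one gr_hom_one .

text \<open>Classes of odd degree vanish by axiom (i), which leaves those of even degree, where
  formulas are available.\<close>

lemma gr_ring_even_induct [consumes 1, case_names zero cls add]:
  assumes x: "x \<in> carrier (gr_ring p R)"
    and zero: "P \<zero>\<^bsub>gr_ring p R\<^esub>"
    and cls: "\<And>q r. r \<in> filt R (2 * q) \<Longrightarrow> P (cls (2 * q) r)"
    and add: "\<And>x y. x \<in> carrier (gr_ring p R) \<Longrightarrow> y \<in> carrier (gr_ring p R) \<Longrightarrow>
      P x \<Longrightarrow> P y \<Longrightarrow> P (x \<oplus>\<^bsub>gr_ring p R\<^esub> y)"
  shows "P x"
  using x
proof (induction rule: gr_ring_induct)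
  case (cls n r)
  then show ?case
    using assms(3) zero cls_odd[of r "n div 2"] by (cases "even n") (auto elim!: evenE oddE)
qed (use zero add in auto)

text \<open>On two classes the right side is the class of the n-th convolution of their formulas,
  the degrees of its summands being all equal. No bound on \<open>n\<close> intervenes because the
  terms of weak formulas are defined for all indices.\<close>

lemma gr_P_cartan:
  assumes x: "x \<in> carrier (gr_ring p R)" and y: "y \<in> carrier (gr_ring p R)"
  shows "gr_P p R n (x \<otimes>\<^bsub>gr_ring p R\<^esub> y) =
    (\<Oplus>\<^bsub>gr_ring p R\<^esub>i\<in>{..n}. gr_P p R i x \<otimes>\<^bsub>gr_ring p R\<^esub> gr_P p R (n - i) y)"
  using x
proof (induction x rule: gr_ring_even_induct)
  case zero
  then show ?case using y by (simp add: gr_P_zero gr_P_closed)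
next
  case (add x x')
  then show ?case
    using y by (simp add: gr_ring.l_distr gr_P_add gr_P_closed gr_ring.finsum_addf)
next
  case x: (cls q r)
  note cx = cls_closed[OF x]
  show ?case using y
  proof (induction y rule: gr_ring_even_induct)
    case zero
    then show ?case using cx by (simp add: gr_P_zero gr_P_closed)
  next
    case (add y y')
    then show ?case
      using cx by (simp add: gr_ring.r_distr gr_P_add gr_P_closed gr_ring.finsum_addf)
  next
    case y: (cls q' s)
    obtain c d where c: "weak_atiyah q r c" and d: "weak_atiyah q' s d"
      using weak_atiyah_ex x y by blast
    let ?m = "2 * (q + q') + 2 * n * (p - 1)"
    have deg: "2 * q + 2 * i * (p - 1) + (2 * q' + 2 * (n - i) * (p - 1)) = ?m" if "i \<le> n" for i
    proof -
      from that obtain j where "n = i + j" by (auto dest: le_Suc_ex)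
      then show ?thesis by (simp add: algebra_simps)
    qed
    have rs: "r \<otimes> s \<in> filt R (2 * (q + q'))"
      using filt_mult[OF x y] by (simp add: distrib_left)
    have F: "c i \<otimes> d (n - i) \<in> filt R ?m" if "i \<le> n" for i
      using filt_mult[OF weak_atiyah_filt[OF c, of i] weak_atiyah_filt[OF d, of "n - i"]] deg[OF that]
      by (simp only:)
    have "gr_P p R n (cls (2 * q) r \<otimes>\<^bsub>gr_ring p R\<^esub> cls (2 * q') s) = gr_P p R n (cls (2 * (q + q')) (r \<otimes> s))"
      by (simp only: cls_mult[OF x y] distrib_left)
    also have "\<dots> = cls ?m (\<Oplus>i\<in>{..n}. c i \<otimes> d (n - i))"
      using gr_P_cls[OF rs weak_atiyah_mult[OF x y c d]] .
    also have "\<dots> = (\<Oplus>\<^bsub>gr_ring p R\<^esub>i\<in>{..n}. cls ?m (c i \<otimes> d (n - i)))"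
      using F by (intro cls_finsum) auto
    also have "\<dots> = (\<Oplus>\<^bsub>gr_ring p R\<^esub>i\<in>{..n}.
        gr_P p R i (cls (2 * q) r) \<otimes>\<^bsub>gr_ring p R\<^esub> gr_P p R (n - i) (cls (2 * q') s))"
    proof (intro gr_ring.finsum_cong' refl)
      fix i assume "i \<in> {..n}"
      then show "cls ?m (c i \<otimes> d (n - i)) =
        gr_P p R i (cls (2 * q) r) \<otimes>\<^bsub>gr_ring p R\<^esub> gr_P p R (n - i) (cls (2 * q') s)"
        using deg[of i] by (simp only: gr_P_cls[OF x c] gr_P_cls[OF y d]
          cls_mult[OF weak_atiyah_filt[OF c] weak_atiyah_filt[OF d]] atMost_iff)
    qed (use x y in \<open>auto intro!: gr_ring.m_closed gr_P_closed cls_closed\<close>)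
    finally show ?case .
  qed
qed

lemma gr_P_top:
  assumes r: "r \<in> filt R (2 * q)"
  shows "gr_P p R q (cls (2 * q) r) = cls (2 * q * p) (r [^] p)"
proof -
  obtain c where c: "weak_atiyah q r c" using weak_atiyah_ex[OF r] by blast
  show ?thesis
    using gr_P_cls[OF r c, of q] weak_atiyah_bar_top[OF c r] by (simp add: top_filt)
qed

lemma gr_P_above:
  assumes r: "r \<in> filt R (2 * q)" and "q < i"
  shows "gr_P p R i (cls (2 * q) r) = \<zero>\<^bsub>gr_ring p R\<^esub>"
proof -
  obtain c where c: "weak_atiyah q r c" using weak_atiyah_ex[OF r] by blast
  then show ?thesis
    using gr_P_cls[OF r c, of i] assms by (simp add: weak_atiyah_def cls_zero)
qed

lemma cls_pow: "r \<in> filt R n \<Longrightarrow> cls n r [^]\<^bsub>gr_ring p R\<^esub> (k::nat) = cls (n * k) (r [^] k)"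
  by (induction k) (simp_all add: gr_ring_simps(4) cls_mult filt_pow add.commute)

lemma gr_P_atiyah:
  assumes "q > 0" "r \<in> filt R (2 * q)" "atiyah_formula p R q r c" "i \<le> q"
  shows "gr_P p R i (cls (2 * q) r) = cls (2 * q + 2 * i * (p - 1)) (c i)"
  using gr_P_cls[OF assms(2) atiyah_imp_weak[OF assms(2,3)], of i] assms(4) by simp

end

section \<open>Actions of free algebras\<close>

text \<open>Unlike \<open>word_monomial\<close> it carries a coefficient, so that these elements are
  closed under multiplication and generate the free algebra additively.\<close>

definition word_term :: "('k, 'z) ring_scheme \<Rightarrow> 'k \<Rightarrow> 'x list \<Rightarrow> 'x list \<Rightarrow> 'k"
  where "word_term K c w = (\<lambda>v. if v = w then c else \<zero>\<^bsub>K\<^esub>)"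

lemma word_monomial_eq: "word_monomial K w = word_term K \<one>\<^bsub>K\<^esub> w"
  by (simp add: word_monomial_def word_term_def)

lemma free_algebra_simps:
  "f \<otimes>\<^bsub>free_algebra K X\<^esub> g = (\<lambda>w. \<Oplus>\<^bsub>K\<^esub>k\<in>{..length w}. f (take k w) \<otimes>\<^bsub>K\<^esub> g (drop k w))"
  "\<one>\<^bsub>free_algebra K X\<^esub> = word_term K \<one>\<^bsub>K\<^esub> []"
  "\<zero>\<^bsub>free_algebra K X\<^esub> = (\<lambda>w. \<zero>\<^bsub>K\<^esub>)"
  "f \<oplus>\<^bsub>free_algebra K X\<^esub> g = (\<lambda>w. f w \<oplus>\<^bsub>K\<^esub> g w)"
  by (simp_all add: free_algebra_def word_term_def)

lemma free_algebra_carrier: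
  "f \<in> carrier (free_algebra K X) \<longleftrightarrow> (\<forall>w. f w \<in> carrier K) \<and> finite {w. f w \<noteq> \<zero>\<^bsub>K\<^esub>} \<and>
     (\<forall>w. f w \<noteq> \<zero>\<^bsub>K\<^esub> \<longrightarrow> set w \<subseteq> X)"
  by (simp add: free_algebra_def)

section \<open>Integer multiples in abelian groups\<close>

context abelian_group
begin

lemma int_mult_closed: "x \<in> carrier G \<Longrightarrow> [(k::int)] \<cdot> x \<in> carrier G"
  using group.int_pow_closed[OF a_group, of x k] by (simp add: add_pow_def)

lemma int_mult_0: "[(0::int)] \<cdot> x = \<zero>"
  by (simp add: add_pow_def)

lemma int_mult_1: "x \<in> carrier G \<Longrightarrow> [(1::int)] \<cdot> x = x"
  using group.int_pow_1[OF a_group, of x] by (simp add: add_pow_def)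

lemma int_mult_zero: "[(k::int)] \<cdot> \<zero> = \<zero>"
  using group.int_pow_one[OF a_group, of k] by (simp add: add_pow_def)

lemma int_mult_add_left: "x \<in> carrier G \<Longrightarrow> [(j + k :: int)] \<cdot> x = [j] \<cdot> x \<oplus> [k] \<cdot> x"
  using group.int_pow_mult[OF a_group, of x j k] by (simp add: add_pow_def)

lemma int_mult_mult: "x \<in> carrier G \<Longrightarrow> [j] \<cdot> ([k] \<cdot> x) = [(j * k :: int)] \<cdot> x"
  using group.int_pow_pow[OF a_group, of x k j] by (simp add: add_pow_def mult.commute)

lemma int_mult_add_right:
  "x \<in> carrier G \<Longrightarrow> y \<in> carrier G \<Longrightarrow> [(k::int)] \<cdot> (x \<oplus> y) = [k] \<cdot> x \<oplus> [k] \<cdot> y"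
  using comm_group.int_pow_distrib[OF a_comm_group, of x y k] by (simp add: add_pow_def)

end

section \<open>The ring structure of the free algebra\<close>

context ring
begin

lemma word_term_closed:
  assumes "c \<in> carrier R" "set w \<subseteq> X"
  shows "word_term R c w \<in> carrier (free_algebra R X)"
proof -
  have "{v. word_term R c w v \<noteq> \<zero>} \<subseteq> {w}" by (auto simp: word_term_def)
  then have "finite {v. word_term R c w v \<noteq> \<zero>}" by (rule finite_subset) simp
  then show ?thesis using assms by (auto simp: free_algebra_carrier word_term_def)
qed

lemma free_algebra_add_closed:
  assumes f: "f \<in> carrier (free_algebra R X)" and g: "g \<in> carrier (free_algebra R X)"
  shows "f \<oplus>\<^bsub>free_algebra R X\<^esub> g \<in> carrier (free_algebra R X)"
proof -
  let ?h = "f \<oplus>\<^bsub>free_algebra R X\<^esub> g"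
  have s: "{w. ?h w \<noteq> \<zero>} \<subseteq> {w. f w \<noteq> \<zero>} \<union> {w. g w \<noteq> \<zero>}"
    by (auto simp: free_algebra_simps)
  have "finite {w. ?h w \<noteq> \<zero>}" using f g by (intro finite_subset[OF s]) (simp add: free_algebra_carrier)
  then show ?thesis
    using f g s by (auto simp: free_algebra_carrier free_algebra_simps) blast+
qed

text \<open>A nonzero coefficient at \<open>w\<close> requires a splitting of \<open>w\<close> into
  two words with nonzero coefficients; this bounds both the support and the letters.\<close>

lemma free_algebra_mult_closed:
  assumes f: "f \<in> carrier (free_algebra R X)" and g: "g \<in> carrier (free_algebra R X)"
  shows "f \<otimes>\<^bsub>free_algebra R X\<^esub> g \<in> carrier (free_algebra R X)"
proof -
  let ?h = "f \<otimes>\<^bsub>free_algebra R X\<^esub> g"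
  have cl: "f w \<in> carrier R" "g w \<in> carrier R" for w using f g by (auto simp: free_algebra_carrier)
  have s: "\<exists>u v. w = u @ v \<and> f u \<noteq> \<zero> \<and> g v \<noteq> \<zero>" if "?h w \<noteq> \<zero>" for w
  proof (rule ccontr)
    assume no: "\<nexists>u v. w = u @ v \<and> f u \<noteq> \<zero> \<and> g v \<noteq> \<zero>"
    have "f (take k w) \<otimes> g (drop k w) = \<zero>" for k
      using no cl by (metis append_take_drop_id l_null r_null)
    then have "?h w = \<zero>" by (simp add: free_algebra_simps)
    with that show False by simp
  qed
  then have "{w. ?h w \<noteq> \<zero>} \<subseteq> (\<lambda>(u, v). u @ v) ` ({w. f w \<noteq> \<zero>} \<times> {w. g w \<noteq> \<zero>})" by force
  then have "finite {w. ?h w \<noteq> \<zero>}"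
    using f g by (rule_tac finite_subset) (auto simp: free_algebra_carrier)
  moreover have "?h w \<in> carrier R" for w using cl by (simp add: free_algebra_simps)
  moreover have "set w \<subseteq> X" if "?h w \<noteq> \<zero>" for w
    using s[OF that] f g by (auto simp: free_algebra_carrier subset_iff)
  ultimately show ?thesis by (simp add: free_algebra_carrier)
qed

lemma abelian_group_free_algebra: "abelian_group (free_algebra R X)"
proof (rule abelian_groupI)
  fix f assume f: "f \<in> carrier (free_algebra R X)"
  then have "(\<lambda>w. \<ominus> f w) \<in> carrier (free_algebra R X)"
    by (auto simp: free_algebra_carrier)
  moreover have "(\<lambda>w. \<ominus> f w) \<oplus>\<^bsub>free_algebra R X\<^esub> f = \<zero>\<^bsub>free_algebra R X\<^esub>"
    using f by (auto simp: free_algebra_carrier free_algebra_simps l_neg)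
  ultimately show "\<exists>g\<in>carrier (free_algebra R X). g \<oplus>\<^bsub>free_algebra R X\<^esub> f = \<zero>\<^bsub>free_algebra R X\<^esub>"
    by blast
next
  fix f g h assume fgh: "f \<in> carrier (free_algebra R X)" "g \<in> carrier (free_algebra R X)" "h \<in> carrier (free_algebra R X)"
  then have mem: "f w \<in> carrier R" "g w \<in> carrier R" "h w \<in> carrier R" for w
    by (auto simp: free_algebra_carrier)
  show "f \<oplus>\<^bsub>free_algebra R X\<^esub> g \<oplus>\<^bsub>free_algebra R X\<^esub> h = f \<oplus>\<^bsub>free_algebra R X\<^esub> (g \<oplus>\<^bsub>free_algebra R X\<^esub> h)"
    by (simp only: free_algebra_simps a_assoc[OF mem])
next
  fix f g assume fg: "f \<in> carrier (free_algebra R X)" "g \<in> carrier (free_algebra R X)"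
  then have mem: "f w \<in> carrier R" "g w \<in> carrier R" for w
    by (auto simp: free_algebra_carrier)
  show "f \<oplus>\<^bsub>free_algebra R X\<^esub> g = g \<oplus>\<^bsub>free_algebra R X\<^esub> f"
    by (simp only: free_algebra_simps a_comm[OF mem])
  show "f \<oplus>\<^bsub>free_algebra R X\<^esub> g \<in> carrier (free_algebra R X)"
    using fg by (rule free_algebra_add_closed)
next
  fix f assume f: "f \<in> carrier (free_algebra R X)"
  show "\<zero>\<^bsub>free_algebra R X\<^esub> \<oplus>\<^bsub>free_algebra R X\<^esub> f = f"
    using f by (simp add: free_algebra_carrier free_algebra_simps)
qed (simp add: free_algebra_carrier free_algebra_simps)

lemma free_algebra_induct [consumes 1, case_names zero word_term add]:
  assumes f: "f \<in> carrier (free_algebra R X)"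
    and zero: "P \<zero>\<^bsub>free_algebra R X\<^esub>"
    and word_term: "\<And>c w. c \<in> carrier R \<Longrightarrow> set w \<subseteq> X \<Longrightarrow> P (word_term R c w)"
    and add: "\<And>f g. f \<in> carrier (free_algebra R X) \<Longrightarrow> g \<in> carrier (free_algebra R X) \<Longrightarrow>
      P f \<Longrightarrow> P g \<Longrightarrow> P (f \<oplus>\<^bsub>free_algebra R X\<^esub> g)"
  shows "P f"
proof -
  have "P f" if "finite A" "f \<in> carrier (free_algebra R X)" "{w. f w \<noteq> \<zero>} \<subseteq> A" for A f
    using that
  proof (induction A arbitrary: f)
    case empty
    then have "f = \<zero>\<^bsub>free_algebra R X\<^esub>" by (auto simp: free_algebra_simps)
    then show ?case using zero by simp
  next
    case (insert w A)
    let ?g = "f(w := \<zero>)"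
    have g2: "{v. ?g v \<noteq> \<zero>} \<subseteq> A" using insert.prems by auto
    then have "finite {v. ?g v \<noteq> \<zero>}" using insert.hyps(1) by (rule finite_subset)
    then have g1: "?g \<in> carrier (free_algebra R X)"
      using insert.prems(1) by (simp add: free_algebra_carrier)
    show ?case
    \<comment> \<open>If the coefficient at \<open>w\<close> is zero, nothing is known about the
      letters of \<open>w\<close>, so no word term may be split off.\<close>
    proof (cases "f w = \<zero>")
      case True
      then have "?g = f" by auto
      then show ?thesis using insert.IH[OF g1 g2] by simp
    next
      case False
      then have w: "f w \<in> carrier R" "set w \<subseteq> X" using insert.prems(1) by (auto simp: free_algebra_carrier)
      have "f = word_term R (f w) w \<oplus>\<^bsub>free_algebra R X\<^esub> ?g"
        using insert.prems(1) by (intro ext) (simp add: free_algebra_carrier free_algebra_simps word_term_def)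
      then show ?thesis
        using add[OF word_term_closed[OF w] g1 word_term[OF w] insert.IH[OF g1 g2]] by (simp only:)
    qed
  qed
  with f show ?thesis by (auto simp: free_algebra_carrier)
qed

lemma word_term_mult:
  assumes "c \<in> carrier R" "d \<in> carrier R"
  shows "word_term R c u \<otimes>\<^bsub>free_algebra R X\<^esub> word_term R d v = word_term R (c \<otimes> d) (u @ v)"
proof (rule ext)
  fix w
  \<comment> \<open>Of all splittings of \<open>w\<close> only the one after \<open>length u\<close>
    letters can match \<open>u\<close> and \<open>v\<close>.\<close>
  have t: "word_term R c u (take k w) \<otimes> word_term R d v (drop k w) =
      (if length u = k then (if w = u @ v then c \<otimes> d else \<zero>) else \<zero>)" if "k \<le> length w" for k
    using assms that append_take_drop_id[of k w]
    by (auto simp: word_term_def simp del: append_take_drop_id)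
  have "(\<Oplus>k\<in>{..length w}. word_term R c u (take k w) \<otimes> word_term R d v (drop k w)) =
      (\<Oplus>k\<in>{..length w}. if length u = k then (if w = u @ v then c \<otimes> d else \<zero>) else \<zero>)"
    using t assms by (intro finsum_cong') auto
  also have "\<dots> = word_term R (c \<otimes> d) (u @ v) w"
  proof (cases "w = u @ v")
    case True
    then show ?thesis
      using finsum_singleton[of "length u" "{..length w}" "\<lambda>_. c \<otimes> d"] assms by (simp add: word_term_def)
  next
    case False
    then show ?thesis by (simp add: word_term_def cong: if_cong)
  qed
  finally show "(word_term R c u \<otimes>\<^bsub>free_algebra R X\<^esub> word_term R d v) w = word_term R (c \<otimes> d) (u @ v) w"
    by (simp add: free_algebra_simps)
qed

lemma ring_free_algebra: "ring (free_algebra R X)"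
proof (rule ringI[OF abelian_group_free_algebra])
  let ?F = "free_algebra R X"
  interpret F: abelian_group ?F by (rule abelian_group_free_algebra)
  note cl = free_algebra_mult_closed and tcl = word_term_closed
  have mem: "f w \<in> carrier R" if "f \<in> carrier ?F" for f w using that by (simp add: free_algebra_carrier)
  show l: "(f \<oplus>\<^bsub>?F\<^esub> g) \<otimes>\<^bsub>?F\<^esub> h = f \<otimes>\<^bsub>?F\<^esub> h \<oplus>\<^bsub>?F\<^esub> g \<otimes>\<^bsub>?F\<^esub> h"
    if "f \<in> carrier ?F" "g \<in> carrier ?F" "h \<in> carrier ?F" for f g h
    using that by (auto simp: free_algebra_simps mem l_distr finsum_addf)
  show r: "h \<otimes>\<^bsub>?F\<^esub> (f \<oplus>\<^bsub>?F\<^esub> g) = h \<otimes>\<^bsub>?F\<^esub> f \<oplus>\<^bsub>?F\<^esub> h \<otimes>\<^bsub>?F\<^esub> g"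
    if "f \<in> carrier ?F" "g \<in> carrier ?F" "h \<in> carrier ?F" for f g h
    using that by (auto simp: free_algebra_simps mem r_distr finsum_addf)
  have z: "\<zero>\<^bsub>?F\<^esub> \<otimes>\<^bsub>?F\<^esub> f = \<zero>\<^bsub>?F\<^esub>" "f \<otimes>\<^bsub>?F\<^esub> \<zero>\<^bsub>?F\<^esub> = \<zero>\<^bsub>?F\<^esub>" if "f \<in> carrier ?F" for f
    using that by (auto simp: free_algebra_simps mem)
  have one: "\<one>\<^bsub>?F\<^esub> \<in> carrier ?F" by (simp add: free_algebra_simps tcl)
  show "monoid ?F"
  proof (rule monoidI)
    fix f assume "f \<in> carrier ?F"
    then show "\<one>\<^bsub>?F\<^esub> \<otimes>\<^bsub>?F\<^esub> f = f"
    proof (induction f rule: free_algebra_induct)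
      case (word_term c w)
      then show ?case by (simp add: free_algebra_simps(2) word_term_mult)
    qed (use one z r in auto)
    from \<open>f \<in> carrier ?F\<close> show "f \<otimes>\<^bsub>?F\<^esub> \<one>\<^bsub>?F\<^esub> = f"
    proof (induction f rule: free_algebra_induct)
      case (word_term c w)
      then show ?case by (simp add: free_algebra_simps(2) word_term_mult)
    qed (use one z l in auto)
  next
    fix f g h assume fgh: "f \<in> carrier ?F" "g \<in> carrier ?F" "h \<in> carrier ?F"
    from fgh(1) show "f \<otimes>\<^bsub>?F\<^esub> g \<otimes>\<^bsub>?F\<^esub> h = f \<otimes>\<^bsub>?F\<^esub> (g \<otimes>\<^bsub>?F\<^esub> h)"
    proof (induction f rule: free_algebra_induct)
      case f: (word_term c u)
      from fgh(2) show ?case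
      proof (induction g rule: free_algebra_induct)
        case g: (word_term d v)
        from fgh(3) show ?case
        proof (induction h rule: free_algebra_induct)
          case (word_term e w)
          then show ?case using f g by (simp add: word_term_mult m_assoc)
        qed (use f g in \<open>auto simp: z cl tcl r\<close>)
      qed (use f fgh in \<open>auto simp: z cl tcl r l\<close>)
    qed (use fgh in \<open>auto simp: z cl l\<close>)
  qed (use cl one in auto)
qed

end

text \<open>The exponent condition is what lets coefficients, which are residues represented by
  integers below \<open>n\<close>, act by integer multiples; additivity of the operators lets them
  commute with these multiples.\<close>

locale word_action = M: abelian_group M for M :: "('m, 'z) ring_scheme" (structure) +
  fixes n :: nat and X :: "'x set" and \<phi> :: "'x \<Rightarrow> 'm \<Rightarrow> 'm"
  assumes n_gt_1: "n > 1"
    and exponent: "x \<in> carrier M \<Longrightarrow> [n] \<cdot> x = \<zero>"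
    and gen_closed: "g \<in> X \<Longrightarrow> x \<in> carrier M \<Longrightarrow> \<phi> g x \<in> carrier M"
    and gen_add: "g \<in> X \<Longrightarrow> x \<in> carrier M \<Longrightarrow> y \<in> carrier M \<Longrightarrow> \<phi> g (x \<oplus> y) = \<phi> g x \<oplus> \<phi> g y"
begin

abbreviation "F \<equiv> free_algebra (residue_ring (int n)) X"

text \<open>The sum occurring in \<open>gr_act\<close>. Since \<open>foldr\<close> applies the last
  letter first, concatenation of words acts as composition.\<close>

definition Act :: "('x list \<Rightarrow> int) \<Rightarrow> 'm \<Rightarrow> 'm"
  where "Act f x = (\<Oplus>w\<in>{w. f w \<noteq> 0}. [f w] \<cdot> foldr \<phi> w x)"

sublocale K: residues "int n" "residue_ring (int n)"
  using n_gt_1 by unfold_locales auto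

sublocale F: ring F
  by (rule K.ring_free_algebra)

lemma word_closed: "set w \<subseteq> X \<Longrightarrow> x \<in> carrier M \<Longrightarrow> foldr \<phi> w x \<in> carrier M"
  by (induction w) (auto simp: gen_closed)

lemma word_add:
  "set w \<subseteq> X \<Longrightarrow> x \<in> carrier M \<Longrightarrow> y \<in> carrier M \<Longrightarrow> foldr \<phi> w (x \<oplus> y) = foldr \<phi> w x \<oplus> foldr \<phi> w y"
  by (induction w) (auto simp: gen_add word_closed)

text \<open>Coefficients are added and multiplied modulo \<open>n\<close>; on a group killed by
  \<open>n\<close> this reduction is invisible.\<close>

lemma scalar_mod: "x \<in> carrier M \<Longrightarrow> [(k mod int n)] \<cdot> x = [k] \<cdot> x"
proof -
  assume x: "x \<in> carrier M"
  have "[k] \<cdot> x = [(int n * (k div int n) + k mod int n)] \<cdot> x" by simp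
  also have "\<dots> = [(int n * (k div int n))] \<cdot> x \<oplus> [(k mod int n)] \<cdot> x"
    by (rule M.int_mult_add_left[OF x])
  also have "[(int n * (k div int n))] \<cdot> x = [(k div int n)] \<cdot> ([int n] \<cdot> x)"
    by (simp add: M.int_mult_mult[OF x] mult.commute)
  also have "[int n] \<cdot> x = \<zero>"
    using exponent[OF x] by (simp add: add_pow_int_ge)
  finally show ?thesis using x by (simp add: M.int_mult_zero M.int_mult_closed)
qed

lemma F_coeff: "f \<in> carrier F \<Longrightarrow> f w \<noteq> 0 \<Longrightarrow> set w \<subseteq> X"
  by (simp add: free_algebra_carrier K.res_zero_eq)

lemma F_finite: "f \<in> carrier F \<Longrightarrow> finite {w. f w \<noteq> 0}"
  by (simp add: free_algebra_carrier K.res_zero_eq)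

lemma Act_superset:
  assumes "finite A" "{w. f w \<noteq> 0} \<subseteq> A" "A \<subseteq> {w. set w \<subseteq> X}" "x \<in> carrier M"
  shows "Act f x = (\<Oplus>w\<in>A. [f w] \<cdot> foldr \<phi> w x)"
  unfolding Act_def using assms word_closed
  by (intro M.add.finprod_mono_neutral_cong_left) (auto simp: M.int_mult_0 M.int_mult_closed)

lemma Act_closed: "f \<in> carrier F \<Longrightarrow> x \<in> carrier M \<Longrightarrow> Act f x \<in> carrier M"
  unfolding Act_def using F_coeff word_closed by (intro M.finsum_closed) (auto intro!: M.int_mult_closed)

lemma Act_zero: "Act \<zero>\<^bsub>F\<^esub> x = \<zero>"
  by (simp add: Act_def free_algebra_simps K.res_zero_eq)

lemma Act_add:
  assumes f: "f \<in> carrier F" and g: "g \<in> carrier F" and x: "x \<in> carrier M"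
  shows "Act (f \<oplus>\<^bsub>F\<^esub> g) x = Act f x \<oplus> Act g x"
proof -
  let ?A = "{w. f w \<noteq> 0} \<union> {w. g w \<noteq> 0}"
  have A: "finite ?A" "?A \<subseteq> {w. set w \<subseteq> X}" using f g F_finite F_coeff by auto
  have cl: "foldr \<phi> w x \<in> carrier M" if "w \<in> ?A" for w using A(2) that x word_closed by blast
  have "Act (f \<oplus>\<^bsub>F\<^esub> g) x = (\<Oplus>w\<in>?A. [((f \<oplus>\<^bsub>F\<^esub> g) w)] \<cdot> foldr \<phi> w x)"
    using A x by (intro Act_superset) (auto simp: free_algebra_simps K.res_add_eq)
  also have "\<dots> = (\<Oplus>w\<in>?A. [f w] \<cdot> foldr \<phi> w x \<oplus> [g w] \<cdot> foldr \<phi> w x)"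
    using cl by (intro M.finsum_cong') (auto simp: free_algebra_simps K.res_add_eq scalar_mod M.int_mult_add_left intro!: M.int_mult_closed M.a_closed)
  also have "\<dots> = (\<Oplus>w\<in>?A. [f w] \<cdot> foldr \<phi> w x) \<oplus> (\<Oplus>w\<in>?A. [g w] \<cdot> foldr \<phi> w x)"
    using cl by (intro M.finsum_addf) (auto intro!: M.int_mult_closed)
  also have "\<dots> = Act f x \<oplus> Act g x"
    using A x by (simp only: Act_superset[of ?A] Un_upper1 Un_upper2)
  finally show ?thesis .
qed

lemma Act_word_term:
  assumes "c \<in> carrier (residue_ring (int n))" "set w \<subseteq> X" "x \<in> carrier M"
  shows "Act (word_term (residue_ring (int n)) c w) x = [c] \<cdot> foldr \<phi> w x"
proof -
  have "Act (word_term (residue_ring (int n)) c w) x =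
      (\<Oplus>v\<in>{w}. [(word_term (residue_ring (int n)) c w v)] \<cdot> foldr \<phi> v x)"
    using assms by (intro Act_superset) (auto simp: word_term_def K.res_zero_eq)
  then show ?thesis using assms word_closed by (simp add: word_term_def M.int_mult_closed)
qed

lemma Act_one: "x \<in> carrier M \<Longrightarrow> Act \<one>\<^bsub>F\<^esub> x = x"
  using Act_word_term[of 1 "[]" x] K.one_closed by (simp add: free_algebra_simps K.res_one_eq M.int_mult_1)

lemma Act_monomial:
  "set w \<subseteq> X \<Longrightarrow> x \<in> carrier M \<Longrightarrow> Act (word_monomial (residue_ring (int n)) w) x = foldr \<phi> w x"
  using Act_word_term[OF K.one_closed] word_closed by (simp add: word_monomial_eq K.res_one_eq M.int_mult_1)

lemma monomial_closed: "set w \<subseteq> X \<Longrightarrow> word_monomial (residue_ring (int n)) w \<in> carrier F"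
  by (simp add: word_monomial_eq K.word_term_closed)

lemma word_hom: "set w \<subseteq> X \<Longrightarrow> group_hom (add_monoid M) (add_monoid M) (foldr \<phi> w)"
  using M.a_group word_closed word_add by (auto simp: group_hom_def group_hom_axioms_def hom_def)

lemma Act_add_right:
  assumes f: "f \<in> carrier F" and x: "x \<in> carrier M" and y: "y \<in> carrier M"
  shows "Act f (x \<oplus> y) = Act f x \<oplus> Act f y"
  using f
proof (induction f rule: K.free_algebra_induct)
  case (word_term c w)
  then show ?case using x y
    by (simp add: Act_word_term word_add M.int_mult_add_right word_closed)
next
  case (add f g)
  then show ?case using x y by (simp add: Act_add Act_closed M.a_ac)
qed (simp add: Act_zero)

lemma Act_hom:
  assumes "f \<in> carrier F"
  shows "group_hom (add_monoid M) (add_monoid M) (Act f)"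
  using assms M.a_group Act_closed Act_add_right by (auto simp: group_hom_def group_hom_axioms_def hom_def)

lemma Act_zero_right: "f \<in> carrier F \<Longrightarrow> Act f \<zero> = \<zero>"
  using group_hom.hom_one[OF Act_hom] by simp

lemma Act_hom_left:
  assumes "x \<in> carrier M"
  shows "group_hom (add_monoid F) (add_monoid M) (\<lambda>f. Act f x)"
  using assms F.a_group M.a_group Act_closed Act_add by (auto simp: group_hom_def group_hom_axioms_def hom_def)

lemma Act_mult:
  assumes f: "f \<in> carrier F" and g: "g \<in> carrier F" and x: "x \<in> carrier M"
  shows "Act (f \<otimes>\<^bsub>F\<^esub> g) x = Act f (Act g x)"
  using f
proof (induction f rule: K.free_algebra_induct)
  case zero
  then show ?case using g by (simp add: Act_zero)
next
  case (add f f')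
  then show ?case using g x by (simp add: F.l_distr Act_add Act_closed)
next
  case f: (word_term c u)
  then have fF: "word_term (residue_ring (int n)) c u \<in> carrier F" by (rule K.word_term_closed)
  from g show ?case
  proof (induction g rule: K.free_algebra_induct)
    case zero
    then show ?case using fF by (simp add: Act_zero Act_zero_right)
  next
    case (add g g')
    then show ?case using fF x by (simp add: F.r_distr Act_add Act_add_right Act_closed)
  next
    case (word_term d v)
    interpret u: group_hom "add_monoid M" "add_monoid M" "foldr \<phi> u" using f by (intro word_hom)
    have v: "foldr \<phi> v x \<in> carrier M" "foldr \<phi> u (foldr \<phi> v x) \<in> carrier M"
      using word_closed f word_term x by auto
    \<comment> \<open>A word acts additively and so commutes with integer multiples; the inner
      scalar can be pulled out.\<close>
    have "foldr \<phi> u ([d] \<cdot> foldr \<phi> v x) = [d] \<cdot> foldr \<phi> u (foldr \<phi> v x)"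
      using u.hom_int_pow[of "foldr \<phi> v x" d] v by (simp add: add_pow_def)
    then show ?case
      using f word_term x v
      by (simp add: K.word_term_mult Act_word_term K.m_closed K.res_mult_eq scalar_mod M.int_mult_mult)
  qed
qed

lemma Act_minus:
  assumes "f \<in> carrier F" "g \<in> carrier F" "x \<in> carrier M"
  shows "Act (f \<ominus>\<^bsub>F\<^esub> g) x = Act f x \<ominus> Act g x"
proof -
  have "Act (\<ominus>\<^bsub>F\<^esub> g) x = \<ominus> Act g x"
    using group_hom.hom_inv[OF Act_hom_left[OF assms(3)], of g] assms by (simp add: a_inv_def)
  then show ?thesis using assms by (simp add: a_minus_def Act_add)
qed

lemma Act_int_mult:
  assumes "f \<in> carrier F" "x \<in> carrier M"
  shows "Act ([(k::int)] \<cdot>\<^bsub>F\<^esub> f) x = [k] \<cdot> Act f x"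
  using group_hom.hom_int_pow[OF Act_hom_left[OF assms(2)], of f k] assms by (simp add: add_pow_def)

lemma Act_finsum:
  assumes "finite A" "\<And>i. i \<in> A \<Longrightarrow> f i \<in> carrier F" "x \<in> carrier M"
  shows "Act (\<Oplus>\<^bsub>F\<^esub>i\<in>A. f i) x = (\<Oplus>i\<in>A. Act (f i) x)"
  using assms(1,2)
proof (induction A)
  case (insert i A)
  then have "f \<in> A \<rightarrow> carrier F" "(\<lambda>i. Act (f i) x) \<in> A \<rightarrow> carrier M" using Act_closed assms(3) by auto
  with insert show ?case using assms(3) by (simp add: Act_add Act_closed)
qed (simp add: Act_zero)

definition annihilator :: "('x list \<Rightarrow> int) set"
  where "annihilator = {f \<in> carrier F. \<forall>x\<in>carrier M. Act f x = \<zero>}"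

text \<open>A product with an annihilating left factor kills \<open>x\<close> because that factor
  kills every element; with an annihilating right factor it does because the left one sends zero to
  zero. Hence relations that act as zero generate an ideal that acts as zero.\<close>

lemma annihilator_ideal: "ideal annihilator F"
proof (rule idealI[OF F.ring_axioms])
  show "subgroup annihilator (add_monoid F)"
  proof (rule group.subgroupI[OF F.a_group])
    fix f assume "f \<in> annihilator"
    then show "inv\<^bsub>add_monoid F\<^esub> f \<in> annihilator"
      using group_hom.hom_inv[OF Act_hom_left, of _ f] group.inv_closed[OF F.a_group, of f]
        monoid.inv_one[OF M.a_monoid] by (simp add: annihilator_def)
  qed (use Act_zero in \<open>auto simp: annihilator_def Act_add\<close>)
qed (auto simp: annihilator_def Act_mult Act_closed Act_zero_right)

text \<open>The description ranges over all representatives of a coset; they differ by elements of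
  \<open>I\<close>, which act as zero.\<close>

lemma coset_THE:
  assumes I: "ideal I F" "I \<subseteq> annihilator" and f: "f \<in> carrier F" and x: "x \<in> carrier M"
  shows "(THE y. \<exists>g\<in>I +>\<^bsub>F\<^esub> f. y = Act g x) = Act f x"
proof -
  have eq: "Act g x = Act f x" if g: "g \<in> I +>\<^bsub>F\<^esub> f" for g
  proof -
    obtain i where i: "i \<in> I" "g = i \<oplus>\<^bsub>F\<^esub> f"
      using g by (auto simp: a_r_coset_def r_coset_def)
    then have "i \<in> carrier F" "Act i x = \<zero>" using I(2) x by (auto simp: annihilator_def)
    then show ?thesis using i f x by (simp add: Act_add Act_closed)
  qed
  have "\<zero>\<^bsub>F\<^esub> \<in> I" using I(1) by (simp add: additive_subgroup.zero_closed ideal.axioms(1))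
  then have "\<zero>\<^bsub>F\<^esub> \<oplus>\<^bsub>F\<^esub> f \<in> I +>\<^bsub>F\<^esub> f" by (auto simp: a_r_coset_def r_coset_def)
  then have "f \<in> I +>\<^bsub>F\<^esub> f" using f by simp
  then show ?thesis using eq by (intro the_equality) blast+
qed

end

section \<open>The Steenrod relations\<close>

text \<open>In \<open>k * (n choose k) = n * ((n - 1) choose (k - 1))\<close> the right side is even
  and \<open>k\<close> is odd. This disposes of the Adem relations between two odd squares.\<close>

lemma even_choose_odd:
  fixes n k :: nat
  assumes "even n" "odd k"
  shows "even (n choose k)"
proof -
  have "k * (n choose k) = n * ((n - 1) choose (k - 1))"
    using assms(2) by (intro times_binomial_minus1_eq) (auto elim: oddE)
  then have "even (k * (n choose k))" using assms(1) by simp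
  then show ?thesis using assms(2) by simp
qed


text \<open>Serves the prime 2, where sums over all squares lose their odd-indexed terms and become
  sums over the operations P^i.\<close>

lemma (in abelian_monoid) finsum_even:
  fixes n :: nat
  assumes f: "\<And>i. i \<le> n \<Longrightarrow> f i \<in> carrier G" and odd: "\<And>i. i \<le> n \<Longrightarrow> odd i \<Longrightarrow> f i = \<zero>"
  shows "(\<Oplus>i\<in>{..n}. f i) = (\<Oplus>i\<in>{..n div 2}. f (2 * i))"
proof -
  have im: "(\<lambda>i. 2 * i) ` {..n div 2} = {i. i \<le> n \<and> even i}"
    by (auto elim!: evenE)
  have "(\<Oplus>i\<in>{..n div 2}. f (2 * i)) = (\<Oplus>i\<in>(\<lambda>i. 2 * i) ` {..n div 2}. f i)"
    using f by (intro finsum_reindex[symmetric]) (auto simp: inj_on_def)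
  also have "\<dots> = (\<Oplus>i\<in>{..n}. f i)"
    unfolding im using f odd by (intro add.finprod_mono_neutral_cong_left) auto
  finally show ?thesis ..
qed

context word_action
begin

lemma annihilator_diff:
  assumes "f \<in> carrier F" "g \<in> carrier F" "\<And>x. x \<in> carrier M \<Longrightarrow> Act f x = Act g x"
  shows "f \<ominus>\<^bsub>F\<^esub> g \<in> annihilator"
  using assms Act_closed by (simp add: annihilator_def Act_minus M.minus_eq M.r_neg)

lemma combination_closed:
  assumes "finite A" "\<And>t. t \<in> A \<Longrightarrow> set (v t) \<subseteq> X"
  shows "(\<Oplus>\<^bsub>F\<^esub>t\<in>A. [(k t :: int)] \<cdot>\<^bsub>F\<^esub> word_monomial (residue_ring (int n)) (v t)) \<in> carrier F"
  using assms monomial_closed by (intro F.finsum_closed) (auto intro!: F.int_mult_closed)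

text \<open>Evaluates the right sides of the Adem relations, which are integer combinations of
  words.\<close>

lemma Act_combination:
  assumes "finite A" "\<And>t. t \<in> A \<Longrightarrow> set (v t) \<subseteq> X" "x \<in> carrier M"
  shows "Act (\<Oplus>\<^bsub>F\<^esub>t\<in>A. [(k t :: int)] \<cdot>\<^bsub>F\<^esub> word_monomial (residue_ring (int n)) (v t)) x =
    (\<Oplus>t\<in>A. [(k t)] \<cdot> foldr \<phi> (v t) x)"
proof -
  have cl: "word_monomial (residue_ring (int n)) (v t) \<in> carrier F" if "t \<in> A" for t
    using assms that monomial_closed by blast
  have "Act (\<Oplus>\<^bsub>F\<^esub>t\<in>A. [(k t :: int)] \<cdot>\<^bsub>F\<^esub> word_monomial (residue_ring (int n)) (v t)) x =
      (\<Oplus>t\<in>A. Act ([(k t :: int)] \<cdot>\<^bsub>F\<^esub> word_monomial (residue_ring (int n)) (v t)) x)"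
    using assms cl by (intro Act_finsum) (auto intro!: F.int_mult_closed)
  also have "\<dots> = (\<Oplus>t\<in>A. [(k t)] \<cdot> foldr \<phi> (v t) x)"
    using assms cl by (intro M.finsum_cong') (auto simp: Act_int_mult Act_monomial intro!: M.int_mult_closed word_closed)
  finally show ?thesis .
qed

end

section \<open>The Steenrod relations act as zero on the graded ring\<close>

locale psi_alg = pre_psi_alg +
  assumes psi_algebra: "psi_algebra p R"
begin

lemma gr_P_0: "x \<in> carrier (gr_ring p R) \<Longrightarrow> gr_P p R 0 x = x"
  using psi_algebra by (simp add: psi_algebra_def)

lemma gr_P_adem:
  assumes "i > 0" "i < p * j" "x \<in> carrier (gr_ring p R)"
  shows "gr_P p R i (gr_P p R j x) =
    (\<Oplus>\<^bsub>gr_ring p R\<^esub>t\<in>{..i div p}.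
      [(if p = 2 then int ((2 * j - 2 * t - 1) choose (2 * i - 4 * t))
        else (-1) ^ (i + t) * int (((p - 1) * (j - t) - 1) choose (i - p * t)))]
      \<cdot>\<^bsub>gr_ring p R\<^esub> gr_P p R (i + j - t) (gr_P p R t x))"
proof -
  have "j > 0" using assms(2) by (cases j) auto
  moreover have "\<forall>i>0. \<forall>j>0. i < p * j \<longrightarrow> (\<forall>x\<in>carrier (gr_ring p R).
       gr_P p R i (gr_P p R j x) =
         (\<Oplus>\<^bsub>gr_ring p R\<^esub>t\<in>{..i div p}.
            [(if p = 2 then int ((2 * j - 2 * t - 1) choose (2 * i - 4 * t))
             else (-1) ^ (i + t) * int (((p - 1) * (j - t) - 1) choose (i - p * t)))]
            \<cdot>\<^bsub>gr_ring p R\<^esub> gr_P p R (i + j - t) (gr_P p R t x)))"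
    using psi_algebra unfolding psi_algebra_def by (elim conjE)
  ultimately show ?thesis using assms by blast
qed

lemma gr_gen_act_closed:
  "x \<in> carrier (gr_ring p R) \<Longrightarrow> gr_gen_act p R g x \<in> carrier (gr_ring p R)"
  by (cases g) (auto simp: gr_P_closed)

lemma gr_gen_act_add:
  "x \<in> carrier (gr_ring p R) \<Longrightarrow> y \<in> carrier (gr_ring p R) \<Longrightarrow>
   gr_gen_act p R g (x \<oplus>\<^bsub>gr_ring p R\<^esub> y) = gr_gen_act p R g x \<oplus>\<^bsub>gr_ring p R\<^esub> gr_gen_act p R g y"
  by (cases g) (auto simp: gr_P_add)

sublocale act: word_action "gr_ring p R" p "steenrod_gens p" "gr_gen_act p R"
  by unfold_locales (auto simp: p_gt_1[unfolded One_nat_def] gr_ring_mult_p gr_gen_act_closed gr_gen_act_add)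

text \<open>The parities of \<open>a\<close> and \<open>b\<close> decide. If both are even, the
  even-indexed terms form the Adem relation for \<open>gr_P\<close>. If exactly one is odd, every
  word contains an odd square. If both are odd, the left side is zero, odd \<open>j\<close>
  contribute nothing and even \<open>j\<close> carry even coefficients.\<close>

lemma relations_2_annihilate:
  assumes p: "p = 2"
  shows "steenrod_relations_2 \<subseteq> act.annihilator"
proof -
  let ?G = "gr_ring p R"
  have gens: "set w \<subseteq> steenrod_gens p" if "set w \<subseteq> range Sq" for w
    using that p by (simp add: steenrod_gens_def)
  have gen: "Sq i \<in> steenrod_gens p" for i
    using p by (simp add: steenrod_gens_def)
  have p_mod: "int (2 * k) mod int p = 0" for k
    by (simp add: p)
  have 1: "steenrod_word p [Sq 0] \<ominus>\<^bsub>steenrod_free p\<^esub> \<one>\<^bsub>steenrod_free p\<^esub> \<in> act.annihilator"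
    using gens[of "[Sq 0]"] by (intro act.annihilator_diff act.monomial_closed)
      (auto simp: act.Act_monomial act.Act_one gr_P_0)
  have 2: "steenrod_word p [Sq a, Sq b] \<ominus>\<^bsub>steenrod_free p\<^esub>
      (\<Oplus>\<^bsub>steenrod_free p\<^esub>j\<in>{..a div 2}. [int ((b - j - 1) choose (a - 2 * j))] \<cdot>\<^bsub>steenrod_free p\<^esub>
         steenrod_word p [Sq (a + b - j), Sq j]) \<in> act.annihilator"
    if ab: "0 < a" "a < 2 * b" for a b
  proof (intro act.annihilator_diff act.monomial_closed act.combination_closed)
    fix x assume x: "x \<in> carrier ?G"
    let ?f = "\<lambda>j. [int ((b - j - 1) choose (a - 2 * j))] \<cdot>\<^bsub>?G\<^esub> foldr (gr_gen_act p R) [Sq (a + b - j), Sq j] x"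
    have cl: "?f j \<in> carrier ?G" for j
      by (intro gr_ring.int_mult_closed) (simp add: gr_gen_act_closed x del: gr_gen_act.simps)
    \<comment> \<open>For odd \<open>j\<close> the inner square vanishes; for even \<open>j\<close>
      and odd \<open>a + b\<close> the outer one has odd index \<open>a + b - j\<close>.\<close>
    have f_odd: "?f j = \<zero>\<^bsub>?G\<^esub>" if "odd j \<or> odd (a + b)" "j \<le> a div 2" for j
      using that ab by (auto simp: gr_P_zero gr_ring.int_mult_zero)
    have f_odd2: "?f j = \<zero>\<^bsub>?G\<^esub>" if "even j" "odd a" "odd b" "j \<le> a div 2" for j
    proof -
      \<comment> \<open>From \<open>a < 2 * b\<close> it follows that \<open>j < b\<close>, so the
        subtraction does not truncate and its parity can be computed.\<close>
      have "even (b - j - 1)" "odd (a - 2 * j)" using that ab by auto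
      then have "even ((b - j - 1) choose (a - 2 * j))" by (rule even_choose_odd)
      then obtain k where k: "(b - j - 1) choose (a - 2 * j) = 2 * k" by (rule evenE)
      have "foldr (gr_gen_act p R) [Sq (a + b - j), Sq j] x \<in> carrier ?G"
        by (simp add: gr_gen_act_closed x del: gr_gen_act.simps)
      then have "[int (2 * k)] \<cdot>\<^bsub>?G\<^esub> foldr (gr_gen_act p R) [Sq (a + b - j), Sq j] x = \<zero>\<^bsub>?G\<^esub>"
        using act.scalar_mod[of "foldr (gr_gen_act p R) [Sq (a + b - j), Sq j] x" "int (2 * k)"]
          gr_ring.int_mult_0 p_mod[of k] by (simp only:)
      then show ?thesis
        unfolding k .
    qed
    have sum: "(\<Oplus>\<^bsub>?G\<^esub>j\<in>{..a div 2}. ?f j) = foldr (gr_gen_act p R) [Sq a, Sq b] x"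
    proof (cases "even a \<and> even b")
      case True
      then obtain i j where ij: "a = 2 * i" "b = 2 * j" by (auto elim!: evenE)
      then have "i > 0" "i < p * j" using ab p by auto
      have "a div 2 = i" using ij by simp
      moreover have "(\<Oplus>\<^bsub>?G\<^esub>j\<in>{..a div 2}. ?f j) = (\<Oplus>\<^bsub>?G\<^esub>t\<in>{..a div 2 div 2}. ?f (2 * t))"
        by (rule gr_ring.finsum_even) (use cl f_odd in blast)+
      ultimately have "(\<Oplus>\<^bsub>?G\<^esub>j\<in>{..a div 2}. ?f j) = (\<Oplus>\<^bsub>?G\<^esub>t\<in>{..i div 2}. ?f (2 * t))"
        by (simp only:)
      also have "\<dots> = (\<Oplus>\<^bsub>?G\<^esub>t\<in>{..i div p}. [int ((2 * j - 2 * t - 1) choose (2 * i - 4 * t))]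
          \<cdot>\<^bsub>?G\<^esub> gr_P p R (i + j - t) (gr_P p R t x))"
      proof (intro gr_ring.finsum_cong')
        fix t assume "t \<in> {..i div p}"
        \<comment> \<open>For \<open>a = 2 * i\<close> and \<open>b = 2 * j\<close> the coefficient
          at index \<open>2 * t\<close> is literally the one prescribed for P^i P^j at the prime 2,
          so only the indices of the squares have to be halved.\<close>
        have e: "2 * i + 2 * j - 2 * t = 2 * (i + j - t)" by simp
        show "?f (2 * t) = [int ((2 * j - 2 * t - 1) choose (2 * i - 4 * t))]
          \<cdot>\<^bsub>?G\<^esub> gr_P p R (i + j - t) (gr_P p R t x)"
          unfolding ij e by simp
      next
        show "{..i div 2} = {..i div p}" by (simp only: p)
      qed (use x in \<open>auto intro!: gr_ring.int_mult_closed gr_P_closed\<close>)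
      also have "\<dots> = gr_P p R i (gr_P p R j x)"
        using gr_P_adem[OF \<open>i > 0\<close> \<open>i < p * j\<close> x] p by simp
      finally show ?thesis using ij by simp
    next
      case False
      then have "(\<Oplus>\<^bsub>?G\<^esub>j\<in>{..a div 2}. ?f j) = \<zero>\<^bsub>?G\<^esub>"
        using f_odd f_odd2 by (intro gr_ring.add.finprod_one_eqI) (metis atMost_iff even_add)
      with False show ?thesis by (auto simp: gr_P_zero)
    qed
    have "act.Act (steenrod_word p [Sq a, Sq b]) x = foldr (gr_gen_act p R) [Sq a, Sq b] x"
      using gens[of "[Sq a, Sq b]"] x by (intro act.Act_monomial) auto
    also have "\<dots> = (\<Oplus>\<^bsub>?G\<^esub>j\<in>{..a div 2}. ?f j)" by (rule sum[symmetric])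
    also have "\<dots> = act.Act (\<Oplus>\<^bsub>steenrod_free p\<^esub>j\<in>{..a div 2}. [int ((b - j - 1) choose (a - 2 * j))] \<cdot>\<^bsub>steenrod_free p\<^esub>
         steenrod_word p [Sq (a + b - j), Sq j]) x"
      using gen x by (intro act.Act_combination[symmetric]) auto
    finally show "act.Act (steenrod_word p [Sq a, Sq b]) x =
      act.Act (\<Oplus>\<^bsub>steenrod_free p\<^esub>j\<in>{..a div 2}. [int ((b - j - 1) choose (a - 2 * j))] \<cdot>\<^bsub>steenrod_free p\<^esub>
         steenrod_word p [Sq (a + b - j), Sq j]) x" .
  qed (use gen in auto)
  from 1 2 show ?thesis
    unfolding steenrod_relations_2_def Let_def p by blast
qed

lemma relations_odd_annihilate:
  assumes p: "p \<noteq> 2"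
  shows "steenrod_relations_odd p \<subseteq> act.annihilator"
proof -
  let ?G = "gr_ring p R" and ?F = "steenrod_free p"
  have gens: "Bockstein \<in> steenrod_gens p" "Pow i \<in> steenrod_gens p" for i
    using p by (simp_all add: steenrod_gens_def)
  have 1: "steenrod_word p [Pow 0] \<ominus>\<^bsub>?F\<^esub> \<one>\<^bsub>?F\<^esub> \<in> act.annihilator"
    using gens by (intro act.annihilator_diff act.monomial_closed)
      (auto simp: act.Act_monomial act.Act_one gr_P_0)
  have 2: "steenrod_word p [Bockstein, Bockstein] \<in> act.annihilator"
    using gens by (simp add: act.annihilator_def act.monomial_closed act.Act_monomial)
  have 3: "steenrod_word p [Pow a, Pow b] \<ominus>\<^bsub>?F\<^esub>
         (\<Oplus>\<^bsub>?F\<^esub>t\<in>{..a div p}.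
            [((-1) ^ (a + t) * int (((p - 1) * (b - t) - 1) choose (a - p * t)))] \<cdot>\<^bsub>?F\<^esub>
              steenrod_word p [Pow (a + b - t), Pow t]) \<in> act.annihilator"
    if ab: "0 < a" "a < p * b" for a b
  proof (intro act.annihilator_diff act.monomial_closed act.combination_closed)
    fix x assume x: "x \<in> carrier ?G"
    have "act.Act (\<Oplus>\<^bsub>?F\<^esub>t\<in>{..a div p}.
            [((-1) ^ (a + t) * int (((p - 1) * (b - t) - 1) choose (a - p * t)))] \<cdot>\<^bsub>?F\<^esub>
              steenrod_word p [Pow (a + b - t), Pow t]) x =
        (\<Oplus>\<^bsub>?G\<^esub>t\<in>{..a div p}.
            [((-1) ^ (a + t) * int (((p - 1) * (b - t) - 1) choose (a - p * t)))] \<cdot>\<^bsub>?G\<^esub>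
              foldr (gr_gen_act p R) [Pow (a + b - t), Pow t] x)"
      using gens x by (intro act.Act_combination) auto
    also have "\<dots> = gr_P p R a (gr_P p R b x)"
      unfolding gr_P_adem[OF ab x] using p by simp
    also have "\<dots> = act.Act (steenrod_word p [Pow a, Pow b]) x"
      using gens x by (subst act.Act_monomial) auto
    finally show "act.Act (steenrod_word p [Pow a, Pow b]) x =
      act.Act (\<Oplus>\<^bsub>?F\<^esub>t\<in>{..a div p}.
            [((-1) ^ (a + t) * int (((p - 1) * (b - t) - 1) choose (a - p * t)))] \<cdot>\<^bsub>?F\<^esub>
              steenrod_word p [Pow (a + b - t), Pow t]) x" by (rule sym)
  qed (use gens in auto)
  \<comment> \<open>Every word on either side contains the Bockstein and acts as zero, so the
    coefficients are left as variables \<open>k\<close> and \<open>l\<close>.\<close>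
  have 4: "steenrod_word p [Pow a, Bockstein, Pow b] \<ominus>\<^bsub>?F\<^esub>
         ((\<Oplus>\<^bsub>?F\<^esub>t\<in>{..a div p}. [(k t)] \<cdot>\<^bsub>?F\<^esub> steenrod_word p [Bockstein, Pow (a + b - t), Pow t]) \<oplus>\<^bsub>?F\<^esub>
          (\<Oplus>\<^bsub>?F\<^esub>t\<in>{..(a - 1) div p}. [(l t)] \<cdot>\<^bsub>?F\<^esub> steenrod_word p [Pow (a + b - t), Bockstein, Pow t]))
      \<in> act.annihilator" for a b and k l :: "nat \<Rightarrow> int"
  proof (intro act.annihilator_diff act.monomial_closed act.combination_closed act.F.a_closed)
    fix x assume x: "x \<in> carrier ?G"
    show "act.Act (steenrod_word p [Pow a, Bockstein, Pow b]) x = act.Act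
      ((\<Oplus>\<^bsub>?F\<^esub>t\<in>{..a div p}. [(k t)] \<cdot>\<^bsub>?F\<^esub> steenrod_word p [Bockstein, Pow (a + b - t), Pow t]) \<oplus>\<^bsub>?F\<^esub>
          (\<Oplus>\<^bsub>?F\<^esub>t\<in>{..(a - 1) div p}. [(l t)] \<cdot>\<^bsub>?F\<^esub> steenrod_word p [Pow (a + b - t), Bockstein, Pow t])) x"
      using gens x
      by (simp add: act.Act_add act.combination_closed act.Act_combination act.Act_monomial gr_P_zero gr_ring.int_mult_zero)
  qed (use gens in auto)
  show ?thesis
    unfolding steenrod_relations_odd_def Let_def by (safe intro!: 1 2 3 4)
qed

lemma relations_annihilate:
  "(if p = 2 then steenrod_relations_2 else steenrod_relations_odd p) \<subseteq> act.annihilator"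
  using relations_2_annihilate relations_odd_annihilate by simp

lemma steenrod_ideal_annihilates: "steenrod_ideal p \<subseteq> act.annihilator"
  unfolding steenrod_ideal_def by (rule act.F.genideal_minimal[OF act.annihilator_ideal relations_annihilate])

text \<open>Generating an ideal requires the relations to lie in the carrier, which is inherited
  from the annihilator.\<close>

lemma steenrod_ideal_ideal: "ideal (steenrod_ideal p) (steenrod_free p)"
  unfolding steenrod_ideal_def
  by (rule act.F.genideal_ideal) (use relations_annihilate in \<open>auto simp: act.annihilator_def\<close>)

text \<open>Through this, laws of the action of the quotient become laws of \<open>act.Act\<close>
  on representatives.\<close>

lemma gr_act_coset:
  assumes "f \<in> carrier (steenrod_free p)" "x \<in> carrier (gr_ring p R)"
  shows "gr_act p R (steenrod_ideal p +>\<^bsub>steenrod_free p\<^esub> f) x = act.Act f x"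
  using act.coset_THE[OF steenrod_ideal_ideal steenrod_ideal_annihilates assms]
  by (simp add: gr_act_def act.Act_def)

end

section \<open>The unstable algebra\<close>

context filtered_alg
begin

lemma eval_hom: "group_hom (add_monoid (gr_ring p R)) (grp p R m) (\<lambda>x. x m)"
  using gr_ring.a_group grp.is_group
  by (auto simp: group_hom_def group_hom_axioms_def hom_def gr_ring_mem gr_ring_simps(1))

lemma int_mult_apply:
  "x \<in> carrier (gr_ring p R) \<Longrightarrow> ([(k::int)] \<cdot>\<^bsub>gr_ring p R\<^esub> x) m = x m [^]\<^bsub>grp p R m\<^esub> k"
  using group_hom.hom_int_pow[OF eval_hom, of x k m] by (simp add: add_pow_def)

text \<open>The homogeneous parts of \<open>gr_alg\<close>, formulated for filtered algebras so that
  they are available without an operation psi.\<close>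

definition gr_part :: "nat \<Rightarrow> (nat \<Rightarrow> 'a set set) set"
  where "gr_part n = {x \<in> carrier (gr_ring p R). \<forall>m. m \<noteq> n \<longrightarrow> x m = \<one>\<^bsub>grp p R m\<^esub>}"

lemma gr_part_iff: "x \<in> gr_part n \<longleftrightarrow> (\<exists>r\<in>filt R n. x = cls n r)"
proof
  assume x: "x \<in> gr_part n"
  then have "x n \<in> carrier (grp p R n)" by (simp add: gr_part_def gr_ring_mem)
  then obtain r where "r \<in> filt R n" "x n = bar p R n r" by (rule bar_surj)
  with x show "\<exists>r\<in>filt R n. x = cls n r"
    by (intro bexI[of _ r] ext) (auto simp: gr_part_def gr_hom_def)
next
  assume "\<exists>r\<in>filt R n. x = cls n r"
  then obtain r where r: "r \<in> filt R n" "x = cls n r" by blast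
  then have "x m = \<one>\<^bsub>grp p R m\<^esub>" if "m \<noteq> n" for m using that by (simp add: gr_hom_def)
  then show "x \<in> gr_part n" using r cls_closed by (simp add: gr_part_def)
qed

lemma gr_part_subset: "gr_part n \<subseteq> carrier (gr_ring p R)"
  by (auto simp: gr_part_def)

lemma gr_part_subgroup: "subgroup (gr_part n) (add_monoid (gr_ring p R))"
proof (rule group.subgroupI[OF gr_ring.a_group])
  fix x assume x: "x \<in> gr_part n"
  have "(inv\<^bsub>add_monoid (gr_ring p R)\<^esub> x) m = inv\<^bsub>grp p R m\<^esub> (x m)" for m
    using group_hom.hom_inv[OF eval_hom, of x m] x by (simp add: gr_part_def)
  then show "inv\<^bsub>add_monoid (gr_ring p R)\<^esub> x \<in> gr_part n"
    using x group.inv_closed[OF gr_ring.a_group, of x] by (simp add: gr_part_def)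
next
  have "cls n \<zero> \<in> gr_part n" using gr_part_iff filt_zero by blast
  then show "gr_part n \<noteq> {}" by blast
next
  fix x y assume "x \<in> gr_part n" "y \<in> gr_part n"
  then show "x \<otimes>\<^bsub>add_monoid (gr_ring p R)\<^esub> y \<in> gr_part n"
    using gr_ring.a_closed[of x y] by (auto simp: gr_part_def gr_ring_simps(1))
qed (auto simp: gr_part_def)

lemma gr_part_zero: "\<zero>\<^bsub>gr_ring p R\<^esub> \<in> gr_part n"
  using subgroup.one_closed[OF gr_part_subgroup, of n] by simp

lemma gr_part_int_mult: "x \<in> gr_part n \<Longrightarrow> [(k::int)] \<cdot>\<^bsub>gr_ring p R\<^esub> x \<in> gr_part n"
  by (simp add: gr_part_def gr_ring.int_mult_closed int_mult_apply)

lemma gr_part_finsum: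
  assumes "finite A" "\<And>i. i \<in> A \<Longrightarrow> f i \<in> gr_part n"
  shows "(\<Oplus>\<^bsub>gr_ring p R\<^esub>i\<in>A. f i) \<in> gr_part n"
  using assms
proof (induction A)
  case (insert i A)
  then have "f \<in> A \<rightarrow> carrier (gr_ring p R)" "f i \<in> carrier (gr_ring p R)" using gr_part_subset by blast+
  with insert show ?case
    using subgroup.m_closed[OF gr_part_subgroup, of "f i" n] by simp
qed (simp add: gr_part_zero)

lemma gr_part_mult:
  "x \<in> gr_part m \<Longrightarrow> y \<in> gr_part n \<Longrightarrow> x \<otimes>\<^bsub>gr_ring p R\<^esub> y \<in> gr_part (m + n)"
  unfolding gr_part_iff by (auto simp: cls_mult intro: filt_mult)

text \<open>Evaluating a sum of homogeneous elements in degree m leaves only \<open>c m m\<close>.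
  This yields existence, with the components of \<open>x\<close>, as well as uniqueness.\<close>

lemma gr_part_decomposition:
  assumes x: "x \<in> carrier (gr_ring p R)"
  shows "\<exists>!c. (\<forall>n. c n \<in> gr_part n) \<and> finite {n. c n \<noteq> \<zero>\<^bsub>gr_ring p R\<^esub>} \<and>
    x = (\<Oplus>\<^bsub>gr_ring p R\<^esub>n\<in>{n. c n \<noteq> \<zero>\<^bsub>gr_ring p R\<^esub>}. c n)"
proof (rule ex1I[of _ "\<lambda>n. gr_hom p R n (x n)"])
  let ?G = "gr_ring p R"
  have sum: "(\<Oplus>\<^bsub>?G\<^esub>n\<in>{n. c n \<noteq> \<zero>\<^bsub>?G\<^esub>}. c n) m = c m m"
    if c: "\<And>n. c n \<in> gr_part n" and fin: "finite {n. c n \<noteq> \<zero>\<^bsub>?G\<^esub>}" for c m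
  proof -
    let ?A = "{n. c n \<noteq> \<zero>\<^bsub>?G\<^esub>}"
    have cG: "c n \<in> carrier ?G" for n using c gr_part_subset by blast
    have 1: "c n m = \<one>\<^bsub>grp p R m\<^esub>" if "m \<noteq> n" for n
      using c[of n] that by (simp add: gr_part_def)
    have "(\<Oplus>\<^bsub>?G\<^esub>n\<in>?A. c n) m = finprod (grp p R m) (\<lambda>n. c n m) ?A"
      by (rule finsum_gr_ring_apply[OF fin cG])
    also have "\<dots> = c m m"
    proof (cases "m \<in> ?A")
      case True
      have "finprod (grp p R m) (\<lambda>n. c n m) ?A =
          finprod (grp p R m) (\<lambda>n. if m = n then c n m else \<one>\<^bsub>grp p R m\<^esub>) ?A"
        using 1 gr_ring_mem[OF cG] by (intro grp.finprod_cong') auto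
      also have "\<dots> = c m m"
        using gr_ring_mem[OF cG] by (intro grp.finprod_singleton True fin) auto
      finally show ?thesis .
    next
      case False
      then have "c m m = \<one>\<^bsub>grp p R m\<^esub>" by (simp add: gr_ring_simps)
      moreover have "finprod (grp p R m) (\<lambda>n. c n m) ?A = \<one>\<^bsub>grp p R m\<^esub>"
        using False 1 by (intro grp.finprod_one_eqI) metis
      ultimately show ?thesis by simp
    qed
    finally show ?thesis .
  qed
  have part: "gr_hom p R n (x n) \<in> gr_part n" for n
    using gr_hom_closed[OF gr_ring_mem[OF x]] by (simp add: gr_part_def) (simp add: gr_hom_def)
  have "{n. gr_hom p R n (x n) \<noteq> \<zero>\<^bsub>?G\<^esub>} \<subseteq> {n. x n \<noteq> \<one>\<^bsub>grp p R n\<^esub>}"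
    using gr_hom_one by auto
  then have fin: "finite {n. gr_hom p R n (x n) \<noteq> \<zero>\<^bsub>?G\<^esub>}"
    using x finite_subset unfolding carrier_gr_ring by blast
  show "(\<forall>n. gr_hom p R n (x n) \<in> gr_part n) \<and> finite {n. gr_hom p R n (x n) \<noteq> \<zero>\<^bsub>?G\<^esub>} \<and>
    x = (\<Oplus>\<^bsub>?G\<^esub>n\<in>{n. gr_hom p R n (x n) \<noteq> \<zero>\<^bsub>?G\<^esub>}. gr_hom p R n (x n))"
  proof (intro conjI allI part fin ext)
    fix m
    show "x m = (\<Oplus>\<^bsub>?G\<^esub>n\<in>{n. gr_hom p R n (x n) \<noteq> \<zero>\<^bsub>?G\<^esub>}. gr_hom p R n (x n)) m"
      using sum[of "\<lambda>n. gr_hom p R n (x n)", OF part fin, of m] by (simp add: gr_hom_def)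
  qed
  fix c assume c: "(\<forall>n. c n \<in> gr_part n) \<and> finite {n. c n \<noteq> \<zero>\<^bsub>?G\<^esub>} \<and>
    x = (\<Oplus>\<^bsub>?G\<^esub>n\<in>{n. c n \<noteq> \<zero>\<^bsub>?G\<^esub>}. c n)"
  then have xm: "x m = c m m" for m using sum[of c m] by simp
  show "c = (\<lambda>n. gr_hom p R n (x n))"
  proof (intro ext)
    fix n m show "c n m = gr_hom p R n (x n) m"
      using c xm[of n] by (auto simp: gr_hom_def gr_part_def)
  qed
qed

end

lemma gr_alg_simps:
  "carrier (gr_alg p R) = carrier (gr_ring p R)"
  "monoid.mult (gr_alg p R) = monoid.mult (gr_ring p R)"
  "add (gr_alg p R) = add (gr_ring p R)"
  "\<one>\<^bsub>gr_alg p R\<^esub> = \<one>\<^bsub>gr_ring p R\<^esub>"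
  "\<zero>\<^bsub>gr_alg p R\<^esub> = \<zero>\<^bsub>gr_ring p R\<^esub>"
  "act (gr_alg p R) = gr_act p R"
  "part (gr_alg p R) n = {x \<in> carrier (gr_ring p R). \<forall>m. m \<noteq> n \<longrightarrow> x m = \<one>\<^bsub>grp p R m\<^esub>}"
  by (simp_all add: gr_alg_def ring.defs steenrod_alg.defs)

text \<open>\<open>gr_alg\<close> is a longer record than \<open>gr_ring\<close>, so sums, multiples
  and powers formed in the two are different terms; they agree because their definitions use only
  the common fields.\<close>

lemma gr_alg_derived:
  "finsum (gr_alg p R) = finsum (gr_ring p R)"
  "[(k::nat)] \<cdot>\<^bsub>gr_alg p R\<^esub> x = [k] \<cdot>\<^bsub>gr_ring p R\<^esub> x"
  "[(j::int)] \<cdot>\<^bsub>gr_alg p R\<^esub> x = [j] \<cdot>\<^bsub>gr_ring p R\<^esub> x"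
  "x [^]\<^bsub>gr_alg p R\<^esub> (k::nat) = x [^]\<^bsub>gr_ring p R\<^esub> k"
  by (simp add: fun_eq_iff finsum_def finprod_def gr_alg_simps)
    (simp_all add: add_pow_def nat_pow_def int_pow_def m_inv_def gr_alg_simps cong: if_cong)

lemma subgroup_gr_alg:
  "subgroup H (add_monoid (gr_ring p R)) \<Longrightarrow> subgroup H (add_monoid (gr_alg p R))"
  by (simp add: subgroup_def m_inv_def gr_alg_simps)

context pre_psi_alg
begin

lemma part_gr_alg: "part (gr_alg p R) n = gr_part n"
  by (simp add: gr_alg_simps gr_part_def)

lemma cring_gr_alg: "cring (gr_alg p R)"
proof (rule cringI)
  show "abelian_group (gr_alg p R)"
    using abelian_groupE[OF abelian_group_gr_ring] by (intro abelian_groupI) (simp_all only: gr_alg_simps)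
  show "comm_monoid (gr_alg p R)"
    using gr_ring.m_closed gr_ring.one_closed gr_ring.m_assoc gr_ring.l_one gr_ring.m_comm
    by (intro comm_monoidI) (simp_all only: gr_alg_simps)
qed (simp add: gr_alg_simps gr_ring.l_distr)

lemma graded_gr_alg: "graded_Zp_algebra p (gr_alg p R)"
proof -
  have "\<one>\<^bsub>gr_ring p R\<^esub> \<in> gr_part 0"
    unfolding gr_ring_simps(4) gr_part_iff using filt_0 by auto
  then show ?thesis
    using cring.axioms(1)[OF cring_gr_alg] gr_part_mult gr_part_decomposition
      subgroup_gr_alg[OF gr_part_subgroup] gr_ring_mult_p[OF gr_ring.one_closed]
    unfolding graded_Zp_algebra_def part_gr_alg gr_alg_derived gr_alg_simps(1-6) by blast
qed

end

section \<open>Module structure, Cartan formula and instability\<close>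

lemma steenrod_carrier_cases:
  assumes "a \<in> carrier (steenrod_algebra p)"
  obtains f where "f \<in> carrier (steenrod_free p)" "a = steenrod_ideal p +>\<^bsub>steenrod_free p\<^esub> f"
  using assms by (auto simp: steenrod_algebra_def FactRing_def A_RCOSETS_def')

context psi_alg
begin

abbreviation quot :: "(steenrod_gen list \<Rightarrow> int) \<Rightarrow> steenrod_elt"
  where "quot f \<equiv> steenrod_ideal p +>\<^bsub>steenrod_free p\<^esub> f"

lemma quot_add: "f \<in> carrier (steenrod_free p) \<Longrightarrow> g \<in> carrier (steenrod_free p) \<Longrightarrow>
    quot f \<oplus>\<^bsub>steenrod_algebra p\<^esub> quot g = quot (f \<oplus>\<^bsub>steenrod_free p\<^esub> g)"
  using abelian_subgroup.a_rcos_sum[OF abelian_subgroupI3[OF ideal.axioms(1)[OF steenrod_ideal_ideal] act.F.is_abelian_group]]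
  by (simp add: steenrod_algebra_def FactRing_def)

lemma quot_mult: "f \<in> carrier (steenrod_free p) \<Longrightarrow> g \<in> carrier (steenrod_free p) \<Longrightarrow>
    quot f \<otimes>\<^bsub>steenrod_algebra p\<^esub> quot g = quot (f \<otimes>\<^bsub>steenrod_free p\<^esub> g)"
  using ideal.rcoset_mult_add[OF steenrod_ideal_ideal]
  by (simp add: steenrod_algebra_def FactRing_def)

lemma quot_one: "\<one>\<^bsub>steenrod_algebra p\<^esub> = quot \<one>\<^bsub>steenrod_free p\<^esub>"
  by (simp add: steenrod_algebra_def FactRing_def)

lemma gr_act_op:
  assumes "g \<in> steenrod_gens p" "x \<in> carrier (gr_ring p R)"
  shows "gr_act p R (steenrod_op p g) x = gr_gen_act p R g x"
  using assms gr_act_coset[OF act.monomial_closed, of "[g]" x] act.Act_monomial[of "[g]" x]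
  by (simp add: steenrod_op_def)

lemma gr_act_P:
  "x \<in> carrier (gr_ring p R) \<Longrightarrow> gr_act p R (steenrod_P p i) x = gr_P p R i x"
  by (simp add: steenrod_P_def gr_act_op steenrod_gens_def)

lemma gr_P_part:
  assumes "x \<in> gr_part n"
  shows "gr_P p R i x \<in> gr_part (n + 2 * i * (p - 1))"
proof -
  obtain r where r: "r \<in> filt R n" "x = cls n r" using assms by (auto simp: gr_part_iff)
  show ?thesis
  proof (cases "even n")
    case True
    then obtain q where q: "n = 2 * q" by (rule evenE)
    then obtain c where c: "weak_atiyah q r c" using weak_atiyah_ex r by blast
    show ?thesis
      using gr_P_cls[OF _ c, of i] weak_atiyah_filt[OF c, of i] r gr_part_iff unfolding q by metis
  next
    case False
    then have "x = \<zero>\<^bsub>gr_ring p R\<^esub>"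
      using r cls_odd by (auto elim!: oddE)
    then show ?thesis by (simp only: gr_P_zero gr_part_zero)
  qed
qed

lemma gr_gen_act_part:
  assumes "x \<in> gr_part n" "g \<in> steenrod_gens p"
  shows "gr_gen_act p R g x \<in> gr_part (n + gen_degree p g)"
proof (cases g)
  case (Sq j)
  then have "p = 2" using assms(2) by (auto simp: steenrod_gens_def split: if_splits)
  \<comment> \<open>The shift of degrees by P^(j/2), which at the prime 2 is exactly the degree of
    \<open>Sq j\<close>.\<close>
  then have "2 * (j div 2) * (p - 1) = j" if "even j" using that by simp
  then show ?thesis
    using gr_P_part[OF assms(1), of "j div 2"] Sq by (auto simp: gr_part_zero)
qed (use gr_P_part[OF assms(1)] in \<open>auto simp: gr_part_zero\<close>)

lemma word_part:
  "set w \<subseteq> steenrod_gens p \<Longrightarrow> x \<in> gr_part n \<Longrightarrow>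
    foldr (gr_gen_act p R) w x \<in> gr_part (n + sum_list (map (gen_degree p) w))"
proof (induction w)
  case (Cons g w)
  then show ?case
    using gr_gen_act_part[of "foldr (gr_gen_act p R) w x" "n + sum_list (map (gen_degree p) w)" g]
    by (simp add: ac_simps)
qed simp

lemma graded_steenrod_module_gr_alg: "graded_steenrod_module p (gr_alg p R)"
proof -
  let ?A = "steenrod_algebra p" and ?G = "gr_ring p R"
  have c1: "gr_act p R a x \<in> carrier ?G" if "a \<in> carrier ?A" "x \<in> carrier ?G" for a x
    using that(1) by (rule steenrod_carrier_cases) (simp add: gr_act_coset act.Act_closed that(2))
  have c2: "gr_act p R a (x \<oplus>\<^bsub>?G\<^esub> y) = gr_act p R a x \<oplus>\<^bsub>?G\<^esub> gr_act p R a y"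
    if "a \<in> carrier ?A" "x \<in> carrier ?G" "y \<in> carrier ?G" for a x y
    using that(1) by (rule steenrod_carrier_cases) (simp add: gr_act_coset act.Act_add_right that(2,3))
  have c3: "gr_act p R (a \<oplus>\<^bsub>?A\<^esub> b) x = gr_act p R a x \<oplus>\<^bsub>?G\<^esub> gr_act p R b x"
    "gr_act p R (a \<otimes>\<^bsub>?A\<^esub> b) x = gr_act p R a (gr_act p R b x)"
    if ab: "a \<in> carrier ?A" "b \<in> carrier ?A" and x: "x \<in> carrier ?G" for a b x
  proof -
    obtain f g where "f \<in> carrier (steenrod_free p)" "a = quot f" "g \<in> carrier (steenrod_free p)" "b = quot g"
      using ab by (metis steenrod_carrier_cases)
    then show "gr_act p R (a \<oplus>\<^bsub>?A\<^esub> b) x = gr_act p R a x \<oplus>\<^bsub>?G\<^esub> gr_act p R b x"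
      "gr_act p R (a \<otimes>\<^bsub>?A\<^esub> b) x = gr_act p R a (gr_act p R b x)"
      using x by (simp_all add: quot_add quot_mult gr_act_coset act.Act_add act.Act_mult act.Act_closed)
  qed
  have c4: "gr_act p R \<one>\<^bsub>?A\<^esub> x = x" if "x \<in> carrier ?G" for x
    using that by (simp add: quot_one gr_act_coset act.Act_one)
  have c5: "gr_act p R a x \<in> gr_part (n + k)" if a: "a \<in> steenrod_part p k" and x: "x \<in> gr_part n" for a x k n
  proof -
    obtain f where f: "f \<in> carrier (steenrod_free p)" "a = quot f"
      "\<And>w. f w \<noteq> 0 \<Longrightarrow> sum_list (map (gen_degree p) w) = k"
      using a by (auto simp: steenrod_part_def)
    have "x \<in> carrier ?G" using x gr_part_subset by blast
    then have "gr_act p R a x = act.Act f x" using f by (simp add: gr_act_coset)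
    \<comment> \<open>All words in the support of a homogeneous representative have total degree
      \<open>k\<close>, so every summand already lies in degree \<open>n + k\<close>.\<close>
    also have "\<dots> \<in> gr_part (n + k)"
      unfolding act.Act_def
      using f act.F_finite[OF f(1)] act.F_coeff[OF f(1)] word_part[OF _ x]
      by (intro gr_part_finsum gr_part_int_mult) fastforce+
    finally show ?thesis .
  qed
  show ?thesis
    unfolding graded_steenrod_module_def Let_def part_gr_alg gr_alg_simps(1-6)
    by (intro conjI allI ballI c1 c2 c3 c4 c5)
qed

lemma cartan_formula_gr_alg: "cartan_formula p (gr_alg p R)"
proof (cases "p = 2")
  case True
  let ?G = "gr_ring p R"
  have gens: "Sq i \<in> steenrod_gens p" for i using True by (simp add: steenrod_gens_def)
  have "gr_act p R (steenrod_op p (Sq n)) (x \<otimes>\<^bsub>?G\<^esub> y) =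
      (\<Oplus>\<^bsub>?G\<^esub>i\<in>{..n}. gr_act p R (steenrod_op p (Sq i)) x \<otimes>\<^bsub>?G\<^esub> gr_act p R (steenrod_op p (Sq (n - i))) y)"
    if x: "x \<in> carrier ?G" and y: "y \<in> carrier ?G" for x y n
  proof -
    let ?f = "\<lambda>i. gr_gen_act p R (Sq i) x \<otimes>\<^bsub>?G\<^esub> gr_gen_act p R (Sq (n - i)) y"
    have cl: "?f i \<in> carrier ?G" for i using x y gr_gen_act_closed by (intro gr_ring.m_closed)
    \<comment> \<open>For odd \<open>n\<close> one of \<open>i\<close> and \<open>n - i\<close> is
      odd, so all summands vanish, as does the left side; for even \<open>n\<close> only even
      \<open>i\<close> survive.\<close>
    have f_odd: "?f i = \<zero>\<^bsub>?G\<^esub>" if "i \<le> n" "odd i \<or> odd n" for i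
      using that x y by (auto simp: gr_P_closed)
    have "(\<Oplus>\<^bsub>?G\<^esub>i\<in>{..n}. ?f i) = gr_gen_act p R (Sq n) (x \<otimes>\<^bsub>?G\<^esub> y)"
    proof (cases "even n")
      case True
      then obtain k where k: "n = 2 * k" by (rule evenE)
      have "(\<Oplus>\<^bsub>?G\<^esub>i\<in>{..n}. ?f i) = (\<Oplus>\<^bsub>?G\<^esub>i\<in>{..n div 2}. ?f (2 * i))"
        by (rule gr_ring.finsum_even) (use cl f_odd in blast)+
      also have "\<dots> = (\<Oplus>\<^bsub>?G\<^esub>i\<in>{..k}. gr_P p R i x \<otimes>\<^bsub>?G\<^esub> gr_P p R (k - i) y)"
      proof (intro gr_ring.finsum_cong')
        fix i assume "i \<in> {..k}"
        have "n - 2 * i = 2 * (k - i)" by (simp add: k)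
        then show "?f (2 * i) = gr_P p R i x \<otimes>\<^bsub>?G\<^esub> gr_P p R (k - i) y" by simp
      qed (use x y in \<open>auto simp: k gr_P_closed\<close>)
      also have "\<dots> = gr_gen_act p R (Sq n) (x \<otimes>\<^bsub>?G\<^esub> y)"
        using gr_P_cartan[OF x y, of k] by (simp add: k)
      finally show ?thesis .
    next
      case False
      then have "(\<Oplus>\<^bsub>?G\<^esub>i\<in>{..n}. ?f i) = \<zero>\<^bsub>?G\<^esub>"
        using f_odd by (intro gr_ring.add.finprod_one_eqI) blast
      with False show ?thesis by simp
    qed
    then show ?thesis
      by (simp only: gr_act_op[OF gens x] gr_act_op[OF gens y] gr_act_op[OF gens gr_ring.m_closed[OF x y]])
  qed
  with True show ?thesis
    unfolding cartan_formula_def gr_alg_simps(1-6) gr_alg_derived by simp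
next
  case False
  then have gens: "Pow i \<in> steenrod_gens p" "Bockstein \<in> steenrod_gens p" for i
    by (simp_all add: steenrod_gens_def)
  have "x \<in> carrier (gr_ring p R)" if "x \<in> part (gr_alg p R) m" for x m
    using that by (simp add: gr_alg_simps)
  then show ?thesis
    using False gr_P_cartan gens
    by (auto simp: cartan_formula_def gr_alg_simps(1-6) gr_alg_derived gr_act_op gr_ring.int_mult_zero)
qed

lemma gr_part_odd: "x \<in> gr_part n \<Longrightarrow> odd n \<Longrightarrow> x = \<zero>\<^bsub>gr_ring p R\<^esub>"
  using cls_odd by (auto simp: gr_part_iff elim!: oddE)

lemma gr_P_part_top: "x \<in> gr_part (2 * q) \<Longrightarrow> gr_P p R q x = x [^]\<^bsub>gr_ring p R\<^esub> p"
  by (auto simp: gr_part_iff gr_P_top cls_pow)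

lemma gr_P_part_above: "x \<in> gr_part n \<Longrightarrow> n < 2 * i \<Longrightarrow> gr_P p R i x = \<zero>\<^bsub>gr_ring p R\<^esub>"
  using gr_P_above gr_part_odd[of x n] gr_P_zero
  by (cases "even n") (auto simp: gr_part_iff elim!: evenE)

lemma steenrod_unstable_gr_alg: "steenrod_unstable p (gr_alg p R)"
proof (cases "p = 2")
  case True
  then have gens: "Sq i \<in> steenrod_gens p" for i by (simp add: steenrod_gens_def)
  have "gr_act p R (steenrod_op p (Sq i)) x = x [^]\<^bsub>gr_ring p R\<^esub> (2::nat)" if x: "x \<in> gr_part i" for i x
  proof (cases "even i")
    case True
    have "x \<in> carrier (gr_ring p R)" using x gr_part_subset by blast
    then have "gr_act p R (steenrod_op p (Sq i)) x = gr_P p R (i div 2) x"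
      using True by (simp add: gr_act_op[OF gens])
    also have "\<dots> = x [^]\<^bsub>gr_ring p R\<^esub> p"
      using gr_P_part_top[of x "i div 2"] x True by simp
    finally show ?thesis by (simp only: \<open>p = 2\<close>)
  next
    case False
    \<comment> \<open>An element of odd degree is zero, hence so is its square, while the odd
      squares act as zero.\<close>
    then show ?thesis
      using gr_part_odd[OF x] gens by (simp add: gr_act_op numeral_2_eq_2)
  qed
  moreover have "gr_act p R (steenrod_op p (Sq i)) x = \<zero>\<^bsub>gr_ring p R\<^esub>" if x: "x \<in> gr_part n" "n < i" for i n x
  proof -
    have "x \<in> carrier (gr_ring p R)" using x gr_part_subset by blast
    then show ?thesis
      using x gr_P_part_above[of x n "i div 2"] by (cases "even i") (simp_all add: gr_act_op[OF gens])
  qed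
  ultimately show ?thesis
    using True unfolding steenrod_unstable_def part_gr_alg gr_alg_simps(1-6) gr_alg_derived by simp
next
  case False
  then have gens: "Pow i \<in> steenrod_gens p" "Bockstein \<in> steenrod_gens p" for i
    by (simp_all add: steenrod_gens_def)
  \<comment> \<open>The Bockstein is applied last, so the composite is zero in every degree.\<close>
  have "gr_act p R (steenrod_op p Bockstein \<otimes>\<^bsub>steenrod_algebra p\<^esub> steenrod_op p (Pow i)) x = \<zero>\<^bsub>gr_ring p R\<^esub>"
    if "x \<in> carrier (gr_ring p R)" for i x
    using that gens
    by (simp add: steenrod_op_def quot_mult act.monomial_closed gr_act_coset act.Act_mult act.Act_monomial gr_P_closed)
  with False show ?thesis
    using gr_P_part_top gr_P_part_above gens gr_part_subset
    unfolding steenrod_unstable_def part_gr_alg gr_alg_simps(1-6) gr_alg_derived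
    by (auto simp: gr_act_op subset_iff)
qed

lemma unstable_steenrod_algebra_gr_alg: "unstable_steenrod_algebra p (gr_alg p R)"
  by (simp add: unstable_steenrod_algebra_def steenrod_algebra_object_def graded_gr_alg
    graded_steenrod_module_gr_alg cartan_formula_gr_alg steenrod_unstable_gr_alg)

end

section \<open>Functoriality\<close>

locale psi_map = R: psi_alg R p + S: psi_alg S p
  for R :: "('a, 'z) psi_ring_scheme" and S :: "('b, 'y) psi_ring_scheme" and p :: nat +
  fixes f :: "'a \<Rightarrow> 'b"
  assumes psi_map: "psi_algebra_map R S f"
begin

lemma ring_hom: "f \<in> ring_hom R S"
  and map_filt: "r \<in> filt R n \<Longrightarrow> f r \<in> filt S n"
  and map_psi: "r \<in> carrier R \<Longrightarrow> f (psi R r) = psi S (f r)"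
  using psi_map by (auto simp: psi_algebra_map_def filtered_map_def)

sublocale ring_hom_cring R S f
  using ring_hom R.cring_axioms S.cring_axioms by (simp add: ring_hom_cring_def ring_hom_cring_axioms_def)

lemma map_nat_mult: "r \<in> carrier R \<Longrightarrow> f ([(k::nat)] \<cdot>\<^bsub>R\<^esub> r) = [k] \<cdot>\<^bsub>S\<^esub> f r"
  by (induction k) simp_all

lemma map_pow: "r \<in> carrier R \<Longrightarrow> f (r [^]\<^bsub>R\<^esub> (k::nat)) = f r [^]\<^bsub>S\<^esub> k"
  by (induction k) simp_all

text \<open>Naturality of the operations rests on this: \<open>f\<close> preserves filtrations and
  commutes with psi, so it carries the terms of a formula, correction included, to those of a
  formula for \<open>f r\<close>.\<close>

lemma map_weak_atiyah:
  assumes r: "r \<in> filt R (2 * q)" and c: "R.weak_atiyah q r c"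
  shows "S.weak_atiyah q (f r) (\<lambda>i. f (c i))"
proof -
  note [simp] = R.weak_atiyah_carrier[OF c] R.filt_carrier[OF r]
  obtain u where u: "u \<in> filt R (2 * q * p)" "c q \<oplus>\<^bsub>R\<^esub> [p] \<cdot>\<^bsub>R\<^esub> u = r [^]\<^bsub>R\<^esub> p"
    using c by (auto simp: R.weak_atiyah_def)
  have [simp]: "u \<in> carrier R" using u R.filt_carrier by blast
  have "f (c q) \<oplus>\<^bsub>S\<^esub> [p] \<cdot>\<^bsub>S\<^esub> f u = f (c q \<oplus>\<^bsub>R\<^esub> [p] \<cdot>\<^bsub>R\<^esub> u)"
    by (simp add: map_nat_mult)
  also have "\<dots> = f r [^]\<^bsub>S\<^esub> p" by (simp add: u(2) map_pow)
  finally have top: "f (c q) \<oplus>\<^bsub>S\<^esub> [p] \<cdot>\<^bsub>S\<^esub> f u = f r [^]\<^bsub>S\<^esub> p" .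
  have "psi S (f r) = f (\<Oplus>\<^bsub>R\<^esub>i\<in>{..q}. [(p ^ (q - i))] \<cdot>\<^bsub>R\<^esub> c i)"
    using c by (simp add: R.weak_atiyah_def flip: map_psi)
  also have "\<dots> = (\<Oplus>\<^bsub>S\<^esub>i\<in>{..q}. [(p ^ (q - i))] \<cdot>\<^bsub>S\<^esub> f (c i))"
    by (simp add: comp_def map_nat_mult)
  finally show ?thesis
    using c u(1) top map_filt by (auto simp: R.weak_atiyah_def S.weak_atiyah_def)
qed

section \<open>The induced map and its compatibility with products and operations\<close>

abbreviation h :: "(nat \<Rightarrow> 'a set set) \<Rightarrow> nat \<Rightarrow> 'b set set"
  where "h \<equiv> gr_map p R S f"

lemma map_bar_cong:
  assumes r: "r \<in> filt R n" and s: "s \<in> filt R n" and "bar p R n r = bar p R n s"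
  shows "bar p S n (f r) = bar p S n (f s)"
proof -
  obtain t u where "t \<in> filt R n" "u \<in> filt R (Suc n)" "r = s \<oplus>\<^bsub>R\<^esub> ([p] \<cdot>\<^bsub>R\<^esub> t \<oplus>\<^bsub>R\<^esub> u)"
    using assms R.bar_eq_iff by blast
  moreover from this have "f r = f s \<oplus>\<^bsub>S\<^esub> ([p] \<cdot>\<^bsub>S\<^esub> f t \<oplus>\<^bsub>S\<^esub> f u)"
    using s R.filt_carrier by (simp add: map_nat_mult)
  ultimately show ?thesis
    using S.bar_eq_iff[OF map_filt[OF r] map_filt[OF s]] map_filt by blast
qed

text \<open>The description operator in \<open>gr_map\<close> sees only the component
  \<open>x n\<close>, so \<open>x\<close> may be any family. The map can thus be computed before it
  is known to land in the direct sum.\<close>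

lemma gr_map_apply:
  assumes r: "r \<in> filt R n" and "x n = bar p R n r"
  shows "h x n = bar p S n (f r)"
  unfolding gr_map_def using assms map_bar_cong by (intro the_equality) (metis, metis)

lemma gr_map_cls:
  assumes r: "r \<in> filt R n"
  shows "h (R.cls n r) = S.cls n (f r)"
proof (rule ext)
  fix m
  show "h (R.cls n r) m = S.cls n (f r) m"
  proof (cases "m = n")
    case True
    then show ?thesis using gr_map_apply[OF r, of "R.cls n r"] by (simp add: gr_hom_def)
  next
    case False
    then show ?thesis
      using gr_map_apply[OF R.filt_zero, of "R.cls n r" m] by (simp add: gr_hom_def R.bar_zero S.bar_zero)
  qed
qed

lemma gr_map_zero: "h \<zero>\<^bsub>gr_ring p R\<^esub> = \<zero>\<^bsub>gr_ring p S\<^esub>"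
  using gr_map_cls[OF R.filt_zero] by (simp add: R.cls_zero S.cls_zero)

lemma gr_map_add:
  assumes x: "x \<in> carrier (gr_ring p R)" and y: "y \<in> carrier (gr_ring p R)"
  shows "h (x \<oplus>\<^bsub>gr_ring p R\<^esub> y) = h x \<oplus>\<^bsub>gr_ring p S\<^esub> h y"
proof (rule ext)
  fix n
  obtain r s where rs: "r \<in> filt R n" "x n = bar p R n r" "s \<in> filt R n" "y n = bar p R n s"
    using R.bar_surj R.gr_ring_mem[OF x] R.gr_ring_mem[OF y] by metis
  then have "h (x \<oplus>\<^bsub>gr_ring p R\<^esub> y) n = bar p S n (f (r \<oplus>\<^bsub>R\<^esub> s))"
    by (intro gr_map_apply) (simp_all add: R.filt_add R.gr_ring_simps R.bar_add)
  then show "h (x \<oplus>\<^bsub>gr_ring p R\<^esub> y) n = (h x \<oplus>\<^bsub>gr_ring p S\<^esub> h y) n"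
    using rs by (simp add: R.filt_carrier S.gr_ring_simps gr_map_apply S.bar_add map_filt)
qed

lemma gr_map_closed: "x \<in> carrier (gr_ring p R) \<Longrightarrow> h x \<in> carrier (gr_ring p S)"
  by (induction rule: R.gr_ring_induct) (simp_all add: gr_map_zero gr_map_cls S.cls_closed map_filt gr_map_add)

lemma gr_map_mult:
  assumes x: "x \<in> carrier (gr_ring p R)" and y: "y \<in> carrier (gr_ring p R)"
  shows "h (x \<otimes>\<^bsub>gr_ring p R\<^esub> y) = h x \<otimes>\<^bsub>gr_ring p S\<^esub> h y"
  using x
proof (induction rule: R.gr_ring_induct)
  case zero
  then show ?case using y by (simp add: gr_map_zero gr_map_closed)
next
  case (add x x')
  then show ?case using y by (simp add: R.gr_ring.l_distr S.gr_ring.l_distr gr_map_add gr_map_closed)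
next
  case x: (cls m r)
  note cx = R.cls_closed[OF x]
  show ?case using y
  proof (induction rule: R.gr_ring_induct)
    case zero
    then show ?case using cx by (simp add: gr_map_zero gr_map_closed)
  next
    case (add y y')
    then show ?case using cx by (simp add: R.gr_ring.r_distr S.gr_ring.r_distr gr_map_add gr_map_closed)
  next
    case (cls n s)
    then show ?case
      using x by (simp add: R.cls_mult S.cls_mult gr_map_cls map_filt R.filt_mult R.filt_carrier)
  qed
qed

lemma gr_map_P: "x \<in> carrier (gr_ring p R) \<Longrightarrow> h (gr_P p R i x) = gr_P p S i (h x)"
proof (induction rule: R.gr_ring_even_induct)
  case (cls q r)
  obtain c where c: "R.weak_atiyah q r c" using R.weak_atiyah_ex[OF cls] by blast
  show ?case
    unfolding R.gr_P_cls[OF cls c] gr_map_cls[OF cls] S.gr_P_cls[OF map_filt[OF cls] map_weak_atiyah[OF cls c]]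
    by (rule gr_map_cls[OF R.weak_atiyah_filt[OF c]])
qed (simp_all add: gr_map_zero R.gr_P_zero S.gr_P_zero gr_map_add R.gr_P_add S.gr_P_add gr_map_closed R.gr_P_closed)

lemma gr_map_gen: "x \<in> carrier (gr_ring p R) \<Longrightarrow> h (gr_gen_act p R g x) = gr_gen_act p S g (h x)"
  by (cases g) (simp_all add: gr_map_P gr_map_zero)

lemma gr_map_word:
  "set w \<subseteq> steenrod_gens p \<Longrightarrow> x \<in> carrier (gr_ring p R) \<Longrightarrow>
    h (foldr (gr_gen_act p R) w x) = foldr (gr_gen_act p S) w (h x)"
  by (induction w) (simp_all add: gr_map_gen R.act.word_closed)

lemma gr_map_add_hom: "group_hom (add_monoid (gr_ring p R)) (add_monoid (gr_ring p S)) h"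
  using R.gr_ring.a_group S.gr_ring.a_group
  by (auto simp: group_hom_def group_hom_axioms_def hom_def gr_map_closed gr_map_add)

text \<open>Words are handled by naturality of each letter, scalars by additivity of the induced
  map; the induction avoids comparing sums over supports.\<close>

lemma gr_map_Act:
  assumes a: "a \<in> carrier (steenrod_free p)" and x: "x \<in> carrier (gr_ring p R)"
  shows "h (R.act.Act a x) = S.act.Act a (h x)"
  using a
proof (induction a rule: R.act.K.free_algebra_induct)
  case zero
  then show ?case by (simp only: R.act.Act_zero S.act.Act_zero gr_map_zero)
next
  case (add a b)
  then show ?case
    using x by (simp add: R.act.Act_add S.act.Act_add gr_map_add R.act.Act_closed gr_map_closed)
next
  case (word_term c w)
  have "h ([c] \<cdot>\<^bsub>gr_ring p R\<^esub> foldr (gr_gen_act p R) w x) = [c] \<cdot>\<^bsub>gr_ring p S\<^esub> h (foldr (gr_gen_act p R) w x)"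
    using group_hom.hom_int_pow[OF gr_map_add_hom, of "foldr (gr_gen_act p R) w x" c]
      R.act.word_closed[OF word_term(2) x] by (simp add: add_pow_def)
  then show ?case
    using word_term x by (simp add: R.act.Act_word_term S.act.Act_word_term gr_map_closed gr_map_word)
qed

lemma steenrod_algebra_map_gr_map: "steenrod_algebra_map p (gr_alg p R) (gr_alg p S) h"
  unfolding steenrod_algebra_map_def
proof (intro conjI allI ballI)
  have "h \<one>\<^bsub>gr_ring p R\<^esub> = \<one>\<^bsub>gr_ring p S\<^esub>"
    using gr_map_cls[of "\<one>\<^bsub>R\<^esub>" 0] by (simp add: R.gr_ring_simps(4) S.gr_ring_simps(4) R.filt_0)
  then show "h \<in> ring_hom (gr_alg p R) (gr_alg p S)"
    by (intro ring_hom_memI) (simp_all add: gr_alg_simps gr_map_closed gr_map_mult gr_map_add)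
next
  fix n
  show "h ` part (gr_alg p R) n \<subseteq> part (gr_alg p S) n"
    unfolding R.part_gr_alg S.part_gr_alg by (auto simp: R.gr_part_iff S.gr_part_iff gr_map_cls intro!: bexI[OF refl map_filt])
next
  fix a x assume "a \<in> carrier (steenrod_algebra p)" "x \<in> carrier (gr_alg p R)"
  then show "h (act (gr_alg p R) a x) = act (gr_alg p S) a (h x)"
    by (elim steenrod_carrier_cases)
      (simp add: gr_alg_simps R.gr_act_coset S.gr_act_coset gr_map_closed gr_map_Act)
qed

end

lemma psi_algI: "prime p \<Longrightarrow> psi_algebra p R \<Longrightarrow> psi_alg R p"
  by (simp add: psi_alg_def psi_alg_axioms_def pre_psi_alg_def psi_algebra_def)

lemma psi_mapI:
  "prime p \<Longrightarrow> psi_algebra p R \<Longrightarrow> psi_algebra p S \<Longrightarrow> psi_algebra_map R S f \<Longrightarrow> psi_map R S p f"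
  by (simp add: psi_map_def psi_map_axioms_def psi_algI)

theorem corollary1p5:
  fixes p :: nat
  assumes "prime p"
  shows
    "(\<forall>R :: 'a psi_ring. psi_algebra p R \<longrightarrow>
        unstable_steenrod_algebra p (gr_alg p R) \<and>
        (\<forall>i. \<forall>x\<in>carrier (gr_alg p R). act (gr_alg p R) (steenrod_P p i) x = gr_P p R i x) \<and>
        (\<forall>q>0. \<forall>r\<in>filt R (2 * q). \<forall>c. atiyah_formula p R q r c \<longrightarrow> (\<forall>i\<le>q.
           act (gr_alg p R) (steenrod_P p i) (gr_hom p R (2 * q) (bar p R (2 * q) r)) =
             gr_hom p R (2 * q + 2 * i * (p - 1)) (bar p R (2 * q + 2 * i * (p - 1)) (c i)))) \<and>
        (\<forall>r\<in>filt R 0.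
           act (gr_alg p R) (steenrod_P p 0) (gr_hom p R 0 (bar p R 0 r)) =
             gr_hom p R 0 (bar p R 0 (r [^]\<^bsub>R\<^esub> p))) \<and>
        (\<forall>q. \<forall>r\<in>filt R (2 * q). \<forall>i>q.
           act (gr_alg p R) (steenrod_P p i) (gr_hom p R (2 * q) (bar p R (2 * q) r)) =
             \<zero>\<^bsub>gr_alg p R\<^esub>) \<and>
        (\<forall>x\<in>carrier (gr_alg p R).
           if p = 2 then (\<forall>j. odd j \<longrightarrow> act (gr_alg p R) (steenrod_op p (Sq j)) x = \<zero>\<^bsub>gr_alg p R\<^esub>)
           else act (gr_alg p R) (steenrod_op p Bockstein) x = \<zero>\<^bsub>gr_alg p R\<^esub>)) \<and>
     (\<forall>(R :: 'a psi_ring) (S :: 'b psi_ring) f.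
        psi_algebra p R \<longrightarrow> psi_algebra p S \<longrightarrow> psi_algebra_map R S f \<longrightarrow>
          steenrod_algebra_map p (gr_alg p R) (gr_alg p S) (gr_map p R S f) \<and>
          (\<forall>n. \<forall>r\<in>filt R n.
             gr_map p R S f (gr_hom p R n (bar p R n r)) = gr_hom p S n (bar p S n (f r)))) \<and>
     (\<forall>R :: 'a psi_ring. psi_algebra p R \<longrightarrow>
        (\<forall>x\<in>carrier (gr_alg p R). gr_map p R R id x = x)) \<and>
     (\<forall>(R :: 'a psi_ring) (S :: 'b psi_ring) (T :: 'c psi_ring) f g.
        psi_algebra p R \<longrightarrow> psi_algebra p S \<longrightarrow> psi_algebra p T \<longrightarrow>
        psi_algebra_map R S f \<longrightarrow> psi_algebra_map S T g \<longrightarrow>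
          (\<forall>x\<in>carrier (gr_alg p R). gr_map p R T (g \<circ> f) x = gr_map p S T g (gr_map p R S f x)))"
proof (intro conjI allI impI)
  note alg = psi_algI[OF assms] and map = psi_mapI[OF assms]
  {
    fix R :: "'a psi_ring" assume "psi_algebra p R"
    then interpret psi_alg R p by (rule alg)
    show "unstable_steenrod_algebra p (gr_alg p R)" by (rule unstable_steenrod_algebra_gr_alg)
    show "\<forall>x\<in>carrier (gr_alg p R). act (gr_alg p R) (steenrod_P p i) x = gr_P p R i x" for i
      by (simp add: gr_alg_simps gr_act_P)
    show "\<forall>r\<in>filt R (2 * q). \<forall>c. atiyah_formula p R q r c \<longrightarrow> (\<forall>i\<le>q.
        act (gr_alg p R) (steenrod_P p i) (cls (2 * q) r) =
          cls (2 * q + 2 * i * (p - 1)) (c i))" if "q > 0" for q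
      using that by (auto simp only: gr_alg_simps gr_act_P cls_closed gr_P_atiyah)
    show "\<forall>r\<in>filt R 0. act (gr_alg p R) (steenrod_P p 0) (cls 0 r) = cls 0 (r [^]\<^bsub>R\<^esub> p)"
      using gr_P_top[of _ 0] by (simp add: gr_alg_simps gr_act_P cls_closed)
    show "\<forall>r\<in>filt R (2 * q). \<forall>i>q.
        act (gr_alg p R) (steenrod_P p i) (cls (2 * q) r) = \<zero>\<^bsub>gr_alg p R\<^esub>" for q
      by (simp add: gr_alg_simps gr_act_P cls_closed gr_P_above)
    show "\<forall>x\<in>carrier (gr_alg p R).
        if p = 2 then (\<forall>j. odd j \<longrightarrow> act (gr_alg p R) (steenrod_op p (Sq j)) x = \<zero>\<^bsub>gr_alg p R\<^esub>)
        else act (gr_alg p R) (steenrod_op p Bockstein) x = \<zero>\<^bsub>gr_alg p R\<^esub>"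
    proof -
      have 1: "gr_act p R (steenrod_op p (Sq j)) x = \<zero>\<^bsub>gr_ring p R\<^esub>"
        if "p = 2" "odd j" "x \<in> carrier (gr_ring p R)" for j x
        using that(2) gr_act_op[OF _ that(3), of "Sq j"] that(1) by (simp only: steenrod_gens_def) simp
      have 2: "gr_act p R (steenrod_op p Bockstein) x = \<zero>\<^bsub>gr_ring p R\<^esub>"
        if "p \<noteq> 2" "x \<in> carrier (gr_ring p R)" for x
        using that by (simp add: gr_act_op steenrod_gens_def)
      show ?thesis
      proof (cases "p = 2")
        case True
        show ?thesis unfolding gr_alg_simps if_P[OF True] using 1[OF True] by blast
      next
        case False
        show ?thesis unfolding gr_alg_simps if_not_P[OF False] using 2[OF False] by blast
      qed
    qed
    show "\<forall>x\<in>carrier (gr_alg p R). gr_map p R R id x = x"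
    \<comment> \<open>Each component is the class of some lift \<open>r\<close>, which
      \<open>id\<close> sends to itself.\<close>
    proof (intro ballI ext)
      fix x n assume "x \<in> carrier (gr_alg p R)"
      then have "x n \<in> carrier (grp p R n)" by (simp add: gr_alg_simps gr_ring_mem)
      then obtain r where r: "r \<in> filt R n" "x n = bar p R n r" by (rule bar_surj)
      have "psi_algebra_map R R id"
        by (simp add: psi_algebra_map_def filtered_map_def ring_hom_def)
      then interpret psi_map R R p id using \<open>psi_algebra p R\<close> map by blast
      show "gr_map p R R id x n = x n" using gr_map_apply[OF r(1), of x] r(2) by simp
    qed
  }
  {
    fix R :: "'a psi_ring" and S :: "'b psi_ring" and f
    assume R: "psi_algebra p R" and S: "psi_algebra p S" and f: "psi_algebra_map R S f"
    then interpret psi_map R S p f by (rule map)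
    show "steenrod_algebra_map p (gr_alg p R) (gr_alg p S) (gr_map p R S f)"
      by (rule steenrod_algebra_map_gr_map)
    show "\<forall>r\<in>filt R n. gr_map p R S f (R.cls n r) = S.cls n (f r)" for n
      by (simp add: gr_map_cls)
    fix T :: "'c psi_ring" and g
    assume T: "psi_algebra p T" and g: "psi_algebra_map S T g"
    interpret g: psi_map S T p g by (rule map[OF S T g])
    \<comment> \<open>Once the composite is a map of psi-algebras, its induced map can be evaluated
      on lifts as well: from a lift \<open>r\<close> of \<open>x n\<close> both sides become the
      class of \<open>g (f r)\<close>.\<close>
    have "psi_algebra_map R T (g \<circ> f)"
      using map_filt g.map_filt map_psi g.map_psi hom_closed ring_hom_trans[OF ring_hom g.ring_hom]
      by (auto simp: psi_algebra_map_def filtered_map_def)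
    then interpret gf: psi_map R T p "g \<circ> f" by (rule map[OF R T])
    show "\<forall>x\<in>carrier (gr_alg p R). gr_map p R T (g \<circ> f) x = gr_map p S T g (gr_map p R S f x)"
    proof (intro ballI ext)
      fix x n assume "x \<in> carrier (gr_alg p R)"
      then have "x n \<in> carrier (grp p R n)" by (simp add: gr_alg_simps R.gr_ring_mem)
      then obtain r where r: "r \<in> filt R n" "x n = bar p R n r" by (rule R.bar_surj)
      show "gr_map p R T (g \<circ> f) x n = gr_map p S T g (gr_map p R S f x) n"
        using gf.gr_map_apply[OF r(1), of x, OF r(2)]
          g.gr_map_apply[OF map_filt[OF r(1)], of "gr_map p R S f x", OF gr_map_apply[OF r(1), of x, OF r(2)]]
        by simp
    qed
  }
qed

end
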